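(* Let $\mathcal{C}$ be a small category, let $\mathcal{E}$ be a full (replete) reflective subcategory of the presheaf category $[\mathcal{C}^{\mathrm{op}},\mathbf{Set}]$, and let $L\colon [\mathcal{C}^{\mathrm{op}},\mathbf{Set}]\to\mathcal{E}$ be the reflection (left adjoint to the inclusion). Then the following conditions are equivalent: (i) there exist Grothendieck topologies $j$ and $k$ on $\mathcal{C}$ with $j\subseteq k$ such that $\mathcal{E}=\mathrm{Sep}(k)\cap\mathrm{Sh}(j)$; (ii) $L$ is semi-left-exact and preserves finite products and monomorphisms; (iii) $L$ has stable units and preserves monomorphisms.
   Context: Write $\mathcal{S}=[\mathcal{C}^{\mathrm{op}},\mathbf{Set}]$. Full subcategories are assumed replete (closed under isomorphism). $\ell X\colon X\to LX$ denotes the unit of the reflection. For a Grothendieck topology $j$ on $\mathcal{C}$, $\mathrm{Sh}(j)$ is the full subcategory of $\mathcal{S}$ of $j$-sheaves. For a Grothendieck topology $k$, $\mathrm{Sep}(k)$ is the full subcategory of $k$-separated presheaves, i.e. those satisfying the uniqueness (but not necessarily existence) of gluings in the sheaf condition for $k$. $L$ is semi-left-exact if, for every $X\in\mathcal{S}$, $A\in\mathcal{E}$ and $u\colon A\to LX$, $L$ preserves the pullback of $u$ along $\ell X\colon X\to LX$. $L$ has stable units if $L$ preserves all pullbacks (in $\mathcal{S}$) over objects of $\mathcal{E}$, i.e. the pullback of any cospan $X\to B\leftarrow Y$ in $\mathcal{S}$ with $B\in\mathcal{E}$. *)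

theory Defs
  imports Main "HOL-Library.FuncSet"
begin

section \<open>Categories, functors and limits\<close>

datatype ('o, 'm) cat =
  Cat (Obj: "'o set") (Arr: "'m set") (Dom: "'m \<Rightarrow> 'o") (Cod: "'m \<Rightarrow> 'o")
    (Idn: "'o \<Rightarrow> 'm") (Cmp: "'m \<Rightarrow> 'm \<Rightarrow> 'm")

text \<open>\<open>Cmp S g f\<close> is the composite ``first \<open>f\<close>, then \<open>g\<close>''.\<close>

definition hom :: "('o, 'm) cat \<Rightarrow> 'o \<Rightarrow> 'o \<Rightarrow> 'm set" where
  "hom S A B = {f \<in> Arr S. Dom S f = A \<and> Cod S f = B}"

definition is_category :: "('o, 'm) cat \<Rightarrow> bool" where
  "is_category S \<longleftrightarrow>
     (\<forall>f\<in>Arr S. Dom S f \<in> Obj S \<and> Cod S f \<in> Obj S) \<and>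
     (\<forall>A\<in>Obj S. Idn S A \<in> hom S A A) \<and>
     (\<forall>f\<in>Arr S. \<forall>g\<in>Arr S. Dom S g = Cod S f \<longrightarrow> Cmp S g f \<in> hom S (Dom S f) (Cod S g)) \<and>
     (\<forall>f\<in>Arr S. Cmp S f (Idn S (Dom S f)) = f \<and> Cmp S (Idn S (Cod S f)) f = f) \<and>
     (\<forall>f\<in>Arr S. \<forall>g\<in>Arr S. \<forall>h\<in>Arr S. Dom S g = Cod S f \<longrightarrow> Dom S h = Cod S g \<longrightarrow>
        Cmp S h (Cmp S g f) = Cmp S (Cmp S h g) f)"

definition isomorphic :: "('o, 'm) cat \<Rightarrow> 'o \<Rightarrow> 'o \<Rightarrow> bool" where
  "isomorphic S A B \<longleftrightarrow>
     (\<exists>f\<in>hom S A B. \<exists>g\<in>hom S B A. Cmp S g f = Idn S A \<and> Cmp S f g = Idn S B)"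

definition monic :: "('o, 'm) cat \<Rightarrow> 'm \<Rightarrow> bool" where
  "monic S m \<longleftrightarrow> m \<in> Arr S \<and>
     (\<forall>f\<in>Arr S. \<forall>g\<in>Arr S. Dom S f = Dom S g \<longrightarrow> Cod S f = Dom S m \<longrightarrow> Cod S g = Dom S m \<longrightarrow>
        Cmp S m f = Cmp S m g \<longrightarrow> f = g)"

text \<open>\<open>p\<close> and \<open>q\<close> are the projections of a pullback of the cospan \<open>f\<close>, \<open>g\<close>.\<close>

definition is_pullback :: "('o, 'm) cat \<Rightarrow> 'm \<Rightarrow> 'm \<Rightarrow> 'm \<Rightarrow> 'm \<Rightarrow> bool" where
  "is_pullback S f g p q \<longleftrightarrow>
     f \<in> Arr S \<and> g \<in> Arr S \<and> p \<in> Arr S \<and> q \<in> Arr S \<and>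
     Cod S f = Cod S g \<and> Dom S p = Dom S q \<and> Cod S p = Dom S f \<and> Cod S q = Dom S g \<and>
     Cmp S f p = Cmp S g q \<and>
     (\<forall>h\<in>Arr S. \<forall>k\<in>Arr S.
        Dom S h = Dom S k \<longrightarrow> Cod S h = Dom S f \<longrightarrow> Cod S k = Dom S g \<longrightarrow> Cmp S f h = Cmp S g k \<longrightarrow>
        (\<exists>!u. u \<in> hom S (Dom S h) (Dom S p) \<and> Cmp S p u = h \<and> Cmp S q u = k))"

text \<open>\<open>P\<close> with projections \<open>p i\<close> is a product of the objects \<open>X i\<close>, \<open>i \<in> I\<close>;
  for \<open>I = {}\<close> this says that \<open>P\<close> is terminal.\<close>

definition is_product :: "('o, 'm) cat \<Rightarrow> 'i set \<Rightarrow> ('i \<Rightarrow> 'o) \<Rightarrow> 'o \<Rightarrow> ('i \<Rightarrow> 'm) \<Rightarrow> bool" where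
  "is_product S I X P p \<longleftrightarrow>
     P \<in> Obj S \<and> (\<forall>i\<in>I. X i \<in> Obj S \<and> p i \<in> hom S P (X i)) \<and>
     (\<forall>Q\<in>Obj S. \<forall>q. (\<forall>i\<in>I. q i \<in> hom S Q (X i)) \<longrightarrow>
        (\<exists>!u. u \<in> hom S Q P \<and> (\<forall>i\<in>I. Cmp S (p i) u = q i)))"

datatype ('o, 'm, 'p, 'n) fctr = Fctr (onObj: "'o \<Rightarrow> 'p") (onArr: "'m \<Rightarrow> 'n")

definition is_functor :: "('o, 'm) cat \<Rightarrow> ('p, 'n) cat \<Rightarrow> ('o, 'm, 'p, 'n) fctr \<Rightarrow> bool" where
  "is_functor S T F \<longleftrightarrow>
     (\<forall>A\<in>Obj S. onObj F A \<in> Obj T) \<and>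
     (\<forall>f\<in>Arr S. onArr F f \<in> hom T (onObj F (Dom S f)) (onObj F (Cod S f))) \<and>
     (\<forall>A\<in>Obj S. onArr F (Idn S A) = Idn T (onObj F A)) \<and>
     (\<forall>f\<in>Arr S. \<forall>g\<in>Arr S. Dom S g = Cod S f \<longrightarrow>
        onArr F (Cmp S g f) = Cmp T (onArr F g) (onArr F f))"

definition preserves_monos :: "('o, 'm) cat \<Rightarrow> ('p, 'n) cat \<Rightarrow> ('o, 'm, 'p, 'n) fctr \<Rightarrow> bool" where
  "preserves_monos S T F \<longleftrightarrow> (\<forall>m. monic S m \<longrightarrow> monic T (onArr F m))"

definition preserves_finite_products ::
    "('o, 'm) cat \<Rightarrow> ('p, 'n) cat \<Rightarrow> ('o, 'm, 'p, 'n) fctr \<Rightarrow> bool" where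
  "preserves_finite_products S T F \<longleftrightarrow>
     (\<forall>(I :: nat set) X P p. finite I \<longrightarrow> is_product S I X P p \<longrightarrow>
        is_product T I (\<lambda>i. onObj F (X i)) (onObj F P) (\<lambda>i. onArr F (p i)))"

definition preserves_pullback_of ::
    "('o, 'm) cat \<Rightarrow> ('p, 'n) cat \<Rightarrow> ('o, 'm, 'p, 'n) fctr \<Rightarrow> 'm \<Rightarrow> 'm \<Rightarrow> bool" where
  "preserves_pullback_of S T F f g \<longleftrightarrow>
     (\<forall>p q. is_pullback S f g p q \<longrightarrow>
        is_pullback T (onArr F f) (onArr F g) (onArr F p) (onArr F q))"


section \<open>Reflective subcategories\<close>

text \<open>A full subcategory is given by its set \<open>E\<close> of objects.\<close>

definition full_subcat :: "('o, 'm) cat \<Rightarrow> 'o set \<Rightarrow> ('o, 'm) cat" where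
  "full_subcat S E =
     Cat E {f \<in> Arr S. Dom S f \<in> E \<and> Cod S f \<in> E} (Dom S) (Cod S) (Idn S) (Cmp S)"

definition replete :: "('o, 'm) cat \<Rightarrow> 'o set \<Rightarrow> bool" where
  "replete S E \<longleftrightarrow> E \<subseteq> Obj S \<and> (\<forall>A\<in>E. \<forall>B\<in>Obj S. isomorphic S A B \<longrightarrow> B \<in> E)"

text \<open>\<open>L\<close> is left adjoint to the inclusion of \<open>full_subcat S E\<close> in \<open>S\<close>, with unit \<open>\<eta>\<close>.\<close>

definition is_reflection ::
    "('o, 'm) cat \<Rightarrow> 'o set \<Rightarrow> ('o, 'm, 'o, 'm) fctr \<Rightarrow> ('o \<Rightarrow> 'm) \<Rightarrow> bool" where
  "is_reflection S E L \<eta> \<longleftrightarrow>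
     is_functor S (full_subcat S E) L \<and>
     (\<forall>X\<in>Obj S. \<eta> X \<in> hom S X (onObj L X)) \<and>
     (\<forall>f\<in>Arr S. Cmp S (onArr L f) (\<eta> (Dom S f)) = Cmp S (\<eta> (Cod S f)) f) \<and>
     (\<forall>X\<in>Obj S. \<forall>A\<in>E. \<forall>f\<in>hom S X A. \<exists>!g. g \<in> hom S (onObj L X) A \<and> Cmp S g (\<eta> X) = f)"

definition semi_left_exact ::
    "('o, 'm) cat \<Rightarrow> 'o set \<Rightarrow> ('o, 'm, 'o, 'm) fctr \<Rightarrow> ('o \<Rightarrow> 'm) \<Rightarrow> bool" where
  "semi_left_exact S E L \<eta> \<longleftrightarrow>
     (\<forall>X\<in>Obj S. \<forall>A\<in>E. \<forall>u\<in>hom S A (onObj L X).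
        preserves_pullback_of S (full_subcat S E) L u (\<eta> X))"

definition has_stable_units ::
    "('o, 'm) cat \<Rightarrow> 'o set \<Rightarrow> ('o, 'm, 'o, 'm) fctr \<Rightarrow> bool" where
  "has_stable_units S E L \<longleftrightarrow>
     (\<forall>B\<in>E. \<forall>f\<in>Arr S. \<forall>g\<in>Arr S. Cod S f = B \<longrightarrow> Cod S g = B \<longrightarrow>
        preserves_pullback_of S (full_subcat S E) L f g)"


section \<open>Small sets\<close>

text \<open>
  The category \<open>Set\<close> is the category of sets belonging to a universe \<open>U\<close> of subsets of
  some type, and a set \<open>X\<close> of any type counts as small if it is in bijection with a member of
  \<open>U\<close>. The universe is only required to be closed under the set constructions that are needed
  relative to the small category \<open>C\<close>: subsets, images, binary products and sums, and products
  indexed by the arrows of \<open>C\<close>.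
  Every Grothendieck universe in which \<open>C\<close> is small qualifies (\<open>universe_for_if_grothendieck\<close>
  below). The closure conditions are not stated for Grothendieck universes directly because HOL
  does not prove that there is an uncountable one; in the present form, every \<open>C\<close> has a
  universe (\<open>universe_for_exists\<close>).
\<close>

definition small_in :: "'u set set \<Rightarrow> 'x set \<Rightarrow> bool" where
  "small_in U X \<longleftrightarrow> (\<exists>e. inj_on e X \<and> e ` X \<in> U)"

definition universe_for :: "('o, 'a) cat \<Rightarrow> 'u set set \<Rightarrow> bool" where
  "universe_for C U \<longleftrightarrow>
     small_in U (Obj C) \<and> small_in U (Arr C) \<and>
     (\<forall>A\<in>U. \<forall>B. B \<subseteq> A \<longrightarrow> B \<in> U) \<and>
     (\<forall>A\<in>U. \<forall>f :: 'u \<Rightarrow> 'u. f ` A \<in> U) \<and>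
     (\<forall>A\<in>U. \<forall>B\<in>U. small_in U (A \<times> B) \<and> small_in U (A <+> B)) \<and>
     (\<forall>F. (\<forall>f\<in>Arr C. F f \<in> U) \<longrightarrow> small_in U (\<Pi>\<^sub>E f\<in>Arr C. F f))"

lemma small_in_inj:
  assumes sub: "\<forall>A\<in>U. \<forall>B. B \<subseteq> A \<longrightarrow> B \<in> U"
    and X: "small_in U X" and g: "inj_on g Y" "g ` Y \<subseteq> X"
  shows "small_in U Y"
proof -
  obtain e where e: "inj_on e X" "e ` X \<in> U" using X by (auto simp: small_in_def)
  have "inj_on (e \<circ> g) Y" using g e(1) by (meson comp_inj_on inj_on_subset)
  moreover have "(e \<circ> g) ` Y \<subseteq> e ` X" using g(2) by auto
  then have "(e \<circ> g) ` Y \<in> U" using sub e(2) by blast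
  ultimately show ?thesis unfolding small_in_def by blast
qed

lemma universe_for_if_grothendieck:
  fixes U :: "'u set set"
  assumes sub: "\<forall>A\<in>U. \<forall>B. B \<subseteq> A \<longrightarrow> B \<in> U"
    and pair: "\<And>a b. {a, b} \<in> U"
    and pow: "\<And>A. A \<in> U \<Longrightarrow> small_in U (Pow A)"
    and un: "\<And>A F. A \<in> U \<Longrightarrow> (\<And>a. a \<in> A \<Longrightarrow> F a \<in> U) \<Longrightarrow> (\<Union>a\<in>A. F a) \<in> U"
    and C: "small_in U (Obj C)" "small_in U (Arr C)"
  shows "universe_for C U"
proof -
  note small_inj = small_in_inj[OF sub]
  have sing: "{a} \<in> U" for a using pair[of a a] by simp
  have image: "f ` A \<in> U" if "A \<in> U" for A and f :: "'u \<Rightarrow> 'u"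
    using un[OF that, of "\<lambda>a. {f a}"] sing by (simp add: UNION_singleton_eq_range)
  have union: "A \<union> B \<in> U" if "A \<in> U" "B \<in> U" for A B
  proof (cases "\<exists>x y :: 'u. x \<noteq> y")
    case True
    then obtain x y :: 'u where "x \<noteq> y" by blast
    then show ?thesis
      using un[OF pair[of x y], of "\<lambda>z. if z = x then A else B"] that by (auto simp: Un_commute)
  next
    case False
    then have "A \<union> B \<subseteq> {undefined, undefined}" by blast
    then show ?thesis using sub pair[of undefined undefined] by blast
  qed
  have Pow_small: "small_in U (Pow X)" if X: "small_in U X" for X :: "'x set"
  proof -
    obtain e where e: "inj_on e X" "e ` X \<in> U" using X by (auto simp: small_in_def)
    show ?thesis
      by (rule small_inj[OF pow[OF e(2)] inj_on_image_Pow[OF e(1)]]) auto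
  qed
  have prod: "small_in U (A \<times> B)" if "A \<in> U" "B \<in> U" for A B
  proof (rule small_inj)
    show "small_in U (Pow (Pow (A \<union> B)))"
      using Pow_small[OF pow[OF union[OF that]]] .
    have "a = a' \<and> b = b'" if "{{a}, {a, b}} = {{a'}, {a', b'}}" for a b a' b' :: 'u
      using that by (metis doubleton_eq_iff insert_absorb2)
    then show "inj_on (\<lambda>p. {{fst p}, {fst p, snd p}}) (A \<times> B)"
      unfolding inj_on_def by (metis prod_eq_iff)
  qed auto
  have sum: "small_in U (A <+> B)" if "A \<in> U" "B \<in> U" for A B
  proof (rule small_inj)
    show "small_in U (Pow (Pow (A \<union> B)))"
      using Pow_small[OF pow[OF union[OF that]]] .
    show "inj_on (case_sum (\<lambda>a. {{a}}) (\<lambda>b. {{b}, {}})) (A <+> B)"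
      by (auto simp: inj_on_def dest: equalityD1 equalityD2)
  qed auto
  have fn: "small_in U (Pi\<^sub>E (Arr C) F)" if F: "\<forall>f\<in>Arr C. F f \<in> U" for F
  proof -
    obtain e where e: "inj_on e (Arr C)" "e ` Arr C \<in> U" using C(2) by (auto simp: small_in_def)
    have "(\<Union>i\<in>e ` Arr C. F (inv_into (Arr C) e i)) \<in> U"
      using e F by (intro un) auto
    then have A: "(\<Union>a\<in>Arr C. F a) \<in> U" using e(1) by simp
    show ?thesis
    proof (rule small_inj)
      show "small_in U (Pow (e ` Arr C \<times> (\<Union>a\<in>Arr C. F a)))"
        using Pow_small[OF prod[OF e(2) A]] .
      show "inj_on (\<lambda>f. (\<lambda>a. (e a, f a)) ` Arr C) (Pi\<^sub>E (Arr C) F)"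
      proof (rule inj_onI)
        fix f g assume fg: "f \<in> Pi\<^sub>E (Arr C) F" "g \<in> Pi\<^sub>E (Arr C) F"
          and eq: "(\<lambda>a. (e a, f a)) ` Arr C = (\<lambda>a. (e a, g a)) ` Arr C"
        show "f = g"
        proof (rule PiE_ext[OF fg])
          fix a assume a: "a \<in> Arr C"
          then have "(e a, f a) \<in> (\<lambda>a. (e a, g a)) ` Arr C" using eq by blast
          then show "f a = g a" using e(1) a by (auto simp: inj_on_def)
        qed
      qed
    qed auto
  qed
  show ?thesis
    unfolding universe_for_def
    by (intro conjI ballI allI impI C image prod sum fn) (use sub in auto)
qed

lemma universe_for_exists:
  fixes C :: "('o, 'a) cat"
  assumes "is_category C"
  shows "universe_for C (UNIV :: ('a option list \<Rightarrow> bool) set set)"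
proof -
  let ?U = "UNIV :: ('a option list \<Rightarrow> bool) set set"
  have small: "small_in ?U X" if "inj_on e X" for X :: "'x set" and e :: "'x \<Rightarrow> 'a option list \<Rightarrow> bool"
    using that unfolding small_in_def by blast
  define code :: "'a \<Rightarrow> 'a option list \<Rightarrow> bool" where "code a = (\<lambda>l. l = [Some a])" for a
  have code: "inj code"
  proof (rule injI)
    fix a b assume "code a = code b"
    from fun_cong[OF this, of "[Some a]"] show "a = b" by (simp add: code_def)
  qed
  have "inj_on (Idn C) (Obj C)"
    using assms unfolding inj_on_def is_category_def hom_def by (metis (mono_tags, lifting) mem_Collect_eq)
  then have Ob: "small_in ?U (Obj C)"
    using small[of "code \<circ> Idn C"] code by (meson comp_inj_on inj_on_subset subset_UNIV)
  have Ar: "small_in ?U (Arr C)"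
    using small[of code] code by (meson inj_on_subset subset_UNIV)
  define mix :: "('a option list \<Rightarrow> bool) \<Rightarrow> ('a option list \<Rightarrow> bool) \<Rightarrow> 'a option list \<Rightarrow> bool" where
    "mix s t = (\<lambda>l. case l of [] \<Rightarrow> False | None # l \<Rightarrow> s l | Some a # l \<Rightarrow> t l)" for s t
  have mix: "s = s' \<and> t = t'" if eq: "mix s t = mix s' t'" for s t s' t'
  proof
    show "s = s'" using fun_cong[OF eq, of "None # l" for l] by (auto simp: mix_def)
    show "t = t'" using fun_cong[OF eq, of "Some undefined # l" for l] by (auto simp: mix_def)
  qed
  have prod: "small_in ?U (A \<times> B)" for A B :: "('a option list \<Rightarrow> bool) set"
    by (rule small[of "\<lambda>(s, t). mix s t"]) (auto simp: inj_on_def dest: mix)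
  have sum: "small_in ?U (A <+> B)" for A B :: "('a option list \<Rightarrow> bool) set"
  proof (rule small)
    have "(\<lambda>_ :: 'a option list. True) \<noteq> (\<lambda>_. False)" by (simp add: fun_eq_iff)
    then show "inj_on (case_sum (\<lambda>s. mix s (\<lambda>_. True)) (\<lambda>t. mix t (\<lambda>_. False))) (A <+> B)"
      by (auto simp: inj_on_def dest!: mix)
  qed
  define pw :: "('a \<Rightarrow> 'a option list \<Rightarrow> bool) \<Rightarrow> 'a option list \<Rightarrow> bool" where
    "pw f = (\<lambda>l. case l of [] \<Rightarrow> False | None # l \<Rightarrow> False | Some a # l \<Rightarrow> f a l)" for f
  have pw: "inj pw"
  proof (rule injI)
    fix f g assume eq: "pw f = pw g"
    show "f = g"
    proof (intro ext)
      fix a l show "f a l = g a l"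
        using fun_cong[OF eq, of "Some a # l"] by (simp add: pw_def)
    qed
  qed
  have fn: "small_in ?U (Pi\<^sub>E (Arr C) F)" for F :: "'a \<Rightarrow> ('a option list \<Rightarrow> bool) set"
    by (rule small[of pw]) (meson pw inj_on_subset subset_UNIV)
  show ?thesis
    unfolding universe_for_def by (intro conjI ballI allI impI Ob Ar prod sum fn) auto
qed


section \<open>Presheaves\<close>

datatype ('o, 'a, 'u) presheaf =
  Presheaf (sects: "'o \<Rightarrow> 'u set") (restr: "'a \<Rightarrow> 'u \<Rightarrow> 'u")

text \<open>Contravariant functors from \<open>C\<close> to sets in \<open>U\<close>; all functions involved are normalized
  to \<open>undefined\<close> outside their domains, so that equality is equality of functors.\<close>

definition is_presheaf :: "('o, 'a) cat \<Rightarrow> 'u set set \<Rightarrow> ('o, 'a, 'u) presheaf \<Rightarrow> bool" where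
  "is_presheaf C U X \<longleftrightarrow>
     sects X \<in> Obj C \<rightarrow>\<^sub>E U \<and>
     restr X \<in> extensional (Arr C) \<and>
     (\<forall>f\<in>Arr C. restr X f \<in> sects X (Cod C f) \<rightarrow>\<^sub>E sects X (Dom C f)) \<and>
     (\<forall>c\<in>Obj C. \<forall>x\<in>sects X c. restr X (Idn C c) x = x) \<and>
     (\<forall>f\<in>Arr C. \<forall>g\<in>Arr C. Dom C g = Cod C f \<longrightarrow>
        (\<forall>x\<in>sects X (Cod C g). restr X (Cmp C g f) x = restr X f (restr X g x)))"

datatype ('o, 'a, 'u) transf =
  Transf (source: "('o, 'a, 'u) presheaf") (target: "('o, 'a, 'u) presheaf")
    (app: "'o \<Rightarrow> 'u \<Rightarrow> 'u")

definition is_transf :: "('o, 'a) cat \<Rightarrow> ('o, 'a, 'u) transf \<Rightarrow> bool" where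
  "is_transf C t \<longleftrightarrow>
     app t \<in> extensional (Obj C) \<and>
     (\<forall>c\<in>Obj C. app t c \<in> sects (source t) c \<rightarrow>\<^sub>E sects (target t) c) \<and>
     (\<forall>f\<in>Arr C. \<forall>x\<in>sects (source t) (Cod C f).
        app t (Dom C f) (restr (source t) f x) = restr (target t) f (app t (Cod C f) x))"

definition presheaf_cat ::
    "('o, 'a) cat \<Rightarrow> 'u set set \<Rightarrow> (('o, 'a, 'u) presheaf, ('o, 'a, 'u) transf) cat" where
  "presheaf_cat C U =
     Cat {X. is_presheaf C U X}
       {t. is_presheaf C U (source t) \<and> is_presheaf C U (target t) \<and> is_transf C t}
       source target
       (\<lambda>X. Transf X X (\<lambda>c\<in>Obj C. \<lambda>x\<in>sects X c. x))
       (\<lambda>t s. Transf (source s) (target t)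
          (\<lambda>c\<in>Obj C. \<lambda>x\<in>sects (source s) c. app t c (app s c x)))"


section \<open>Grothendieck topologies, sheaves and separated presheaves\<close>

definition maximal_sieve :: "('o, 'a) cat \<Rightarrow> 'o \<Rightarrow> 'a set" where
  "maximal_sieve C c = {f \<in> Arr C. Cod C f = c}"

definition is_sieve :: "('o, 'a) cat \<Rightarrow> 'o \<Rightarrow> 'a set \<Rightarrow> bool" where
  "is_sieve C c R \<longleftrightarrow> R \<subseteq> maximal_sieve C c \<and>
     (\<forall>f\<in>R. \<forall>g\<in>Arr C. Cod C g = Dom C f \<longrightarrow> Cmp C f g \<in> R)"

definition pull_sieve :: "('o, 'a) cat \<Rightarrow> 'a \<Rightarrow> 'a set \<Rightarrow> 'a set" where
  "pull_sieve C f R = {g \<in> Arr C. Cod C g = Dom C f \<and> Cmp C f g \<in> R}"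

text \<open>The values of \<open>j\<close> outside \<open>Obj C\<close> are irrelevant.\<close>

definition grothendieck_topology :: "('o, 'a) cat \<Rightarrow> ('o \<Rightarrow> 'a set set) \<Rightarrow> bool" where
  "grothendieck_topology C j \<longleftrightarrow>
     (\<forall>c\<in>Obj C. \<forall>R\<in>j c. is_sieve C c R) \<and>
     (\<forall>c\<in>Obj C. maximal_sieve C c \<in> j c) \<and>
     (\<forall>f\<in>Arr C. \<forall>R\<in>j (Cod C f). pull_sieve C f R \<in> j (Dom C f)) \<and>
     (\<forall>c\<in>Obj C. \<forall>R\<in>j c. \<forall>Q. is_sieve C c Q \<longrightarrow>
        (\<forall>f\<in>R. pull_sieve C f Q \<in> j (Dom C f)) \<longrightarrow> Q \<in> j c)"

definition topology_le :: "('o, 'a) cat \<Rightarrow> ('o \<Rightarrow> 'a set set) \<Rightarrow> ('o \<Rightarrow> 'a set set) \<Rightarrow> bool" where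
  "topology_le C j k \<longleftrightarrow> (\<forall>c\<in>Obj C. j c \<subseteq> k c)"

definition matching_family ::
    "('o, 'a) cat \<Rightarrow> ('o, 'a, 'u) presheaf \<Rightarrow> 'a set \<Rightarrow> ('a \<Rightarrow> 'u) \<Rightarrow> bool" where
  "matching_family C X R x \<longleftrightarrow>
     (\<forall>f\<in>R. x f \<in> sects X (Dom C f)) \<and>
     (\<forall>f\<in>R. \<forall>g\<in>Arr C. Cod C g = Dom C f \<longrightarrow> x (Cmp C f g) = restr X g (x f))"

definition gluing ::
    "('o, 'a, 'u) presheaf \<Rightarrow> 'o \<Rightarrow> 'a set \<Rightarrow> ('a \<Rightarrow> 'u) \<Rightarrow> 'u \<Rightarrow> bool" where
  "gluing X c R x y \<longleftrightarrow> y \<in> sects X c \<and> (\<forall>f\<in>R. restr X f y = x f)"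

definition Sh :: "('o, 'a) cat \<Rightarrow> 'u set set \<Rightarrow> ('o \<Rightarrow> 'a set set) \<Rightarrow> ('o, 'a, 'u) presheaf set" where
  "Sh C U j = {X. is_presheaf C U X \<and>
     (\<forall>c\<in>Obj C. \<forall>R\<in>j c. \<forall>x. matching_family C X R x \<longrightarrow> (\<exists>!y. gluing X c R x y))}"

definition Sep :: "('o, 'a) cat \<Rightarrow> 'u set set \<Rightarrow> ('o \<Rightarrow> 'a set set) \<Rightarrow> ('o, 'a, 'u) presheaf set" where
  "Sep C U k = {X. is_presheaf C U X \<and>
     (\<forall>c\<in>Obj C. \<forall>R\<in>k c. \<forall>x. matching_family C X R x \<longrightarrow> (\<exists>\<^sub>\<le>\<^sub>1y. gluing X c R x y))}"

end

theory Submission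
  imports Defs
begin

text \<open>
  Limits, monomorphisms and isomorphisms of presheaves are computed sectionwise, and so are limits
  in \<open>E\<close>, because the inclusion of a reflective subcategory creates them.

  \<^item> Stable units give finite products, as products are pullbacks over the terminal object,
    which lies in \<open>E\<close>. Conversely a pullback of \<open>X\<close> and \<open>Y\<close> over \<open>B \<in> E\<close> is the pullback along the unit of
    \<open>X \<times> Y\<close> of the subobject of \<open>L (X \<times> Y) = L X \<times> L Y\<close> on which the two maps to \<open>B\<close> agree, so
    semi-left-exactness applies.

  \<^item> If \<open>E = Sep k \<inter> Sh j\<close> then every unit \<open>X \<rightarrow> L X\<close> is \<open>j\<close>-locally surjective and identifies exactly the
    sections that are \<open>k\<close>-locally equal. The rest follows by arguing locally with sections.

  \<^item> Given stable units and preservation of monomorphisms, let \<open>j\<close> and \<open>k\<close> be the largest topologies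
    for which all objects of \<open>E\<close> are sheaves and separated, respectively. The unit of \<open>X\<close> identifies
    only \<open>k\<close>-locally equal sections, so it is injective if \<open>X\<close> is \<open>k\<close>-separated, and an injective unit
    is \<open>j\<close>-locally surjective, so it is bijective if \<open>X\<close> is moreover a \<open>j\<close>-sheaf.
\<close>

section \<open>Presheaves as a category\<close>

text \<open>The reflection is known only through its universal property, so facts about the unit
  have to be obtained by mapping into well-chosen objects of \<open>E\<close>. To see that the unit
  identifies only \<open>k\<close>-locally equal sections, one \<open>k\<close>-sheaf suffices that
  distinguishes a given section \<open>x\<close> over \<open>c\<close> from all sections over
  \<open>c\<close> not \<open>k\<close>-locally equal to it. The exponential of the classifier of
  \<open>k\<close>-closed subobjects by the representable of \<open>c\<close> does this: a section
  is sent to the closed locus where it agrees with \<open>x\<close>. It lies in \<open>E\<close>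
  because \<open>j \<subseteq> k\<close>. No associated sheaf has to be constructed, and the
  sections of the exponential are sets of pairs of arrows, hence small under the weak closure
  conditions on \<open>U\<close>.

  In the passage from stable units to topologies the lever is that
  \<open>LA (\<eta> X) = \<eta> (LO X)\<close> is invertible. In a pullback of the unit of
  \<open>X\<close> along any map to \<open>LO X\<close>, the projection opposite to the unit is
  therefore inverted by \<open>L\<close>, and maps into objects of \<open>E\<close> can be
  transported along it.\<close>

lemma in_full_subcat [simp]:
  "Obj (full_subcat S E) = E"
  "Arr (full_subcat S E) = {f \<in> Arr S. Dom S f \<in> E \<and> Cod S f \<in> E}"
  "Dom (full_subcat S E) = Dom S" "Cod (full_subcat S E) = Cod S"
  "Idn (full_subcat S E) = Idn S" "Cmp (full_subcat S E) = Cmp S"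
  by (simp_all add: full_subcat_def)

lemma presheaf_cat_sel [simp]:
  "Obj (presheaf_cat C U) = {X. is_presheaf C U X}"
  "Arr (presheaf_cat C U) = {t. is_presheaf C U (source t) \<and> is_presheaf C U (target t) \<and> is_transf C t}"
  "Dom (presheaf_cat C U) = source" "Cod (presheaf_cat C U) = target"
  "Idn (presheaf_cat C U) = (\<lambda>X. Transf X X (\<lambda>c\<in>Obj C. \<lambda>x\<in>sects X c. x))"
  "Cmp (presheaf_cat C U) = (\<lambda>t s. Transf (source s) (target t)
          (\<lambda>c\<in>Obj C. \<lambda>x\<in>sects (source s) c. app t c (app s c x)))"
  by (simp_all add: presheaf_cat_def)

locale presheaves =
  fixes C :: "('o, 'a) cat" and U :: "'u set set"
  assumes cat: "is_category C" and univ: "universe_for C U"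
begin

abbreviation S :: "(('o, 'a, 'u) presheaf, ('o, 'a, 'u) transf) cat" where
  "S \<equiv> presheaf_cat C U"

abbreviation psh :: "('o, 'a, 'u) presheaf \<Rightarrow> bool" where
  "psh X \<equiv> is_presheaf C U X"

abbreviation comp :: "('o, 'a, 'u) transf \<Rightarrow> ('o, 'a, 'u) transf \<Rightarrow> ('o, 'a, 'u) transf"
    (infixr "\<odot>" 70) where
  "t \<odot> s \<equiv> Cmp S t s"

lemma dom_cod [simp]: "f \<in> Arr C \<Longrightarrow> Dom C f \<in> Obj C" "f \<in> Arr C \<Longrightarrow> Cod C f \<in> Obj C"
  using cat unfolding is_category_def by blast+

lemma idn [simp]:
  assumes "c \<in> Obj C"
  shows "Idn C c \<in> Arr C" "Dom C (Idn C c) = c" "Cod C (Idn C c) = c"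
  using cat assms unfolding is_category_def hom_def by auto

lemma cmp [simp]:
  assumes "f \<in> Arr C" "g \<in> Arr C" "Dom C g = Cod C f"
  shows "Cmp C g f \<in> Arr C" "Dom C (Cmp C g f) = Dom C f" "Cod C (Cmp C g f) = Cod C g"
  using cat assms unfolding is_category_def hom_def by auto

lemma cmp_idn [simp]:
  "f \<in> Arr C \<Longrightarrow> Dom C f = c \<Longrightarrow> Cmp C f (Idn C c) = f"
  "f \<in> Arr C \<Longrightarrow> Cod C f = c \<Longrightarrow> Cmp C (Idn C c) f = f"
  using cat unfolding is_category_def by auto

lemma cmp_assoc:
  assumes "f \<in> Arr C" "g \<in> Arr C" "h \<in> Arr C" "Dom C g = Cod C f" "Dom C h = Cod C g"
  shows "Cmp C (Cmp C h g) f = Cmp C h (Cmp C g f)"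
  using cat assms unfolding is_category_def by auto

lemma sects_U: "psh X \<Longrightarrow> c \<in> Obj C \<Longrightarrow> sects X c \<in> U"
  unfolding is_presheaf_def by auto

lemma restr_in [simp]:
  "psh X \<Longrightarrow> f \<in> Arr C \<Longrightarrow> Dom C f = d \<Longrightarrow> x \<in> sects X (Cod C f) \<Longrightarrow> restr X f x \<in> sects X d"
  unfolding is_presheaf_def by auto

lemma restr_idn [simp]: "psh X \<Longrightarrow> c \<in> Obj C \<Longrightarrow> x \<in> sects X c \<Longrightarrow> restr X (Idn C c) x = x"
  unfolding is_presheaf_def by auto

lemma restr_cmp:
  "psh X \<Longrightarrow> f \<in> Arr C \<Longrightarrow> g \<in> Arr C \<Longrightarrow> Dom C g = Cod C f \<Longrightarrow> x \<in> sects X (Cod C g)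
    \<Longrightarrow> restr X (Cmp C g f) x = restr X f (restr X g x)"
  unfolding is_presheaf_def by auto

lemma hom_iff: "t \<in> hom S X Y \<longleftrightarrow> psh X \<and> psh Y \<and> source t = X \<and> target t = Y \<and> is_transf C t"
  by (auto simp: hom_def)

lemma Arr_hom: "t \<in> Arr S \<Longrightarrow> t \<in> hom S (source t) (target t)"
  by (simp add: hom_iff)

lemma homD:
  assumes "t \<in> hom S X Y"
  shows "psh X" "psh Y" "source t = X" "target t = Y" "t \<in> Arr S"
  using assms by (auto simp: hom_iff)

lemma app_in [simp]: "t \<in> hom S X Y \<Longrightarrow> c \<in> Obj C \<Longrightarrow> x \<in> sects X c \<Longrightarrow> app t c x \<in> sects Y c"
  by (auto simp: hom_iff is_transf_def)

lemma app_nat: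
  "t \<in> hom S X Y \<Longrightarrow> f \<in> Arr C \<Longrightarrow> x \<in> sects X (Cod C f)
    \<Longrightarrow> app t (Dom C f) (restr X f x) = restr Y f (app t (Cod C f) x)"
  by (auto simp: hom_iff is_transf_def)

text \<open>Components are normalised to \<open>undefined\<close> outside the sections, so agreement
  on sections already forces equality of the records.\<close>

lemma hom_eqI:
  assumes t: "t \<in> hom S X Y" and s: "s \<in> hom S X Y"
    and eq: "\<And>c x. c \<in> Obj C \<Longrightarrow> x \<in> sects X c \<Longrightarrow> app t c x = app s c x"
  shows "t = s"
proof (rule transf.expand, intro conjI)
  show "source t = source s" "target t = target s" using homD[OF t] homD[OF s] by auto
  have "app t c = app s c" if "c \<in> Obj C" for c
    by (rule extensionalityI[of _ "sects X c"])
       (use t s eq that in \<open>auto simp: hom_iff is_transf_def PiE_iff\<close>)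
  then show "app t = app s"
    by (intro extensionalityI[of _ "Obj C"]) (use t s in \<open>auto simp: hom_iff is_transf_def\<close>)
qed

lemma comp_hom [simp]: "s \<in> hom S X Y \<Longrightarrow> t \<in> hom S Y Z \<Longrightarrow> t \<odot> s \<in> hom S X Z"
  by (auto simp: hom_iff is_transf_def)

lemma app_comp [simp]:
  "c \<in> Obj C \<Longrightarrow> x \<in> sects (source s) c \<Longrightarrow> app (t \<odot> s) c x = app t c (app s c x)"
  by simp

lemma source_target_simps [simp]:
  "source (t \<odot> s) = source s" "target (t \<odot> s) = target t"
  "source (Idn S X) = X" "target (Idn S X) = X"
  by simp_all

lemma idn_hom [simp]: "psh X \<Longrightarrow> Idn S X \<in> hom S X X"
  by (auto simp: hom_iff is_transf_def)

lemma app_idn [simp]: "c \<in> Obj C \<Longrightarrow> x \<in> sects X c \<Longrightarrow> app (Idn S X) c x = x"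
  by simp

declare presheaf_cat_sel [simp del]
declare presheaf_cat_sel(3,4) [simp]

definition transf_of where
  "transf_of X Y \<alpha> = Transf X Y (\<lambda>c\<in>Obj C. \<lambda>x\<in>sects X c. \<alpha> c x)"

lemma transf_of_hom:
  assumes "psh X" "psh Y" "\<And>c x. c \<in> Obj C \<Longrightarrow> x \<in> sects X c \<Longrightarrow> \<alpha> c x \<in> sects Y c"
    and "\<And>f x. f \<in> Arr C \<Longrightarrow> x \<in> sects X (Cod C f)
           \<Longrightarrow> \<alpha> (Dom C f) (restr X f x) = restr Y f (\<alpha> (Cod C f) x)"
  shows "transf_of X Y \<alpha> \<in> hom S X Y"
  using assms by (auto simp: hom_iff is_transf_def transf_of_def)

lemma transf_of_simps [simp]: "source (transf_of X Y \<alpha>) = X" "target (transf_of X Y \<alpha>) = Y"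
  by (simp_all add: transf_of_def)

lemma app_transf_of [simp]: "c \<in> Obj C \<Longrightarrow> x \<in> sects X c \<Longrightarrow> app (transf_of X Y \<alpha>) c x = \<alpha> c x"
  by (simp add: transf_of_def)

lemma comp_assoc:
  assumes "s \<in> hom S W X" "t \<in> hom S X Y" "u \<in> hom S Y Z"
  shows "(u \<odot> t) \<odot> s = u \<odot> (t \<odot> s)"
proof (rule hom_eqI[of _ W Z])
  note [simp] = homD[OF assms(1)] homD[OF assms(2)] homD[OF assms(3)]
  show "app ((u \<odot> t) \<odot> s) c x = app (u \<odot> (t \<odot> s)) c x" if "c \<in> Obj C" "x \<in> sects W c" for c x
    using that app_in[OF assms(1)] by simp
qed (use assms in \<open>auto intro!: comp_hom\<close>)

lemma comp_idn [simp]: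
  assumes "t \<in> hom S X Y"
  shows "t \<odot> Idn S X = t" "Idn S Y \<odot> t = t"
proof -
  note [simp] = homD[OF assms]
  show "t \<odot> Idn S X = t"
    by (rule hom_eqI[OF comp_hom[OF idn_hom assms] assms]) simp_all
  show "Idn S Y \<odot> t = t"
    by (rule hom_eqI[OF comp_hom[OF assms idn_hom] assms]) (simp_all add: app_in[OF assms])
qed

lemma cat_inverse:
  assumes t: "t \<in> hom S X Y" and bij: "\<And>c. c \<in> Obj C \<Longrightarrow> bij_betw (app t c) (sects X c) (sects Y c)"
  shows "\<exists>s\<in>hom S Y X. s \<odot> t = Idn S X \<and> t \<odot> s = Idn S Y"
proof -
  note h = homD[OF t]
  define s where "s = transf_of Y X (\<lambda>c. inv_into (sects X c) (app t c))"
  have inv: "inv_into (sects X c) (app t c) y \<in> sects X c"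
      "app t c (inv_into (sects X c) (app t c) y) = y" if "c \<in> Obj C" "y \<in> sects Y c" for c y
    using bij[OF that(1)] that(2) by (auto simp: bij_betw_def inv_into_into f_inv_into_f)
  have inv2: "inv_into (sects X c) (app t c) (app t c x) = x" if "c \<in> Obj C" "x \<in> sects X c" for c x
    using bij[OF that(1)] that(2) by (auto simp: bij_betw_def)
  have s: "s \<in> hom S Y X"
    unfolding s_def
  proof (rule transf_of_hom)
    fix f y assume f: "f \<in> Arr C" and y: "y \<in> sects Y (Cod C f)"
    let ?x = "inv_into (sects X (Cod C f)) (app t (Cod C f)) y"
    have "restr Y f y = app t (Dom C f) (restr X f ?x)"
      using inv f y app_nat[OF t f] by simp
    then show "inv_into (sects X (Dom C f)) (app t (Dom C f)) (restr Y f y) = restr X f ?x"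
      using inv2 inv f y h by simp
  qed (use h inv in auto)
  have "s \<odot> t = Idn S X"
    by (rule hom_eqI[OF comp_hom[OF t s] idn_hom]) (simp_all add: h, simp add: s_def app_in[OF t] inv2)
  moreover have "t \<odot> s = Idn S Y"
    by (rule hom_eqI[OF comp_hom[OF s t] idn_hom]) (simp_all add: h homD[OF s], simp add: s_def inv)
  ultimately show ?thesis using s by blast
qed

section \<open>Smallness, and presheaves built from small sets\<close>

lemma U_subset: "A \<in> U \<Longrightarrow> B \<subseteq> A \<Longrightarrow> B \<in> U"
  using univ unfolding universe_for_def by blast

lemma small_inj: "small_in U X \<Longrightarrow> inj_on g Y \<Longrightarrow> g ` Y \<subseteq> X \<Longrightarrow> small_in U Y"
  using small_in_inj U_subset by metis

lemma small_U: "A \<in> U \<Longrightarrow> small_in U A"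
  unfolding small_in_def by (metis image_ident inj_on_id2)

lemma small_prod:
  assumes "small_in U A" "small_in U B"
  shows "small_in U (A \<times> B)"
proof -
  obtain e where e: "inj_on e A" "e ` A \<in> U" using assms(1) by (auto simp: small_in_def)
  obtain e' where e': "inj_on e' B" "e' ` B \<in> U" using assms(2) by (auto simp: small_in_def)
  have "small_in U (e ` A \<times> e' ` B)" using univ e e' unfolding universe_for_def by blast
  then show ?thesis
    by (rule small_inj[where g = "map_prod e e'"]) (use e e' in \<open>auto simp: map_prod_inj_on\<close>)
qed

lemma small_Arr: "small_in U (Arr C)"
  using univ unfolding universe_for_def by blast

lemma small_PiE:
  assumes "\<And>f. f \<in> Arr C \<Longrightarrow> F f \<in> U"
  shows "small_in U (Pi\<^sub>E (Arr C) F)"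
proof -
  have "\<forall>F. (\<forall>f\<in>Arr C. F f \<in> U) \<longrightarrow> small_in U (Pi\<^sub>E (Arr C) F)"
    using univ unfolding universe_for_def by (elim conjE)
  then show ?thesis using assms by simp
qed

lemma small_funs:
  assumes "small_in U A"
  shows "small_in U (Arr C \<rightarrow>\<^sub>E A)"
proof -
  obtain e where e: "inj_on e A" "e ` A \<in> U" using assms by (auto simp: small_in_def)
  have "small_in U (Arr C \<rightarrow>\<^sub>E e ` A)" using small_PiE[of "\<lambda>_. e ` A"] e by simp
  then show ?thesis
  proof (rule small_inj[where g = "\<lambda>h. \<lambda>a\<in>Arr C. e (h a)"])
    show "inj_on (\<lambda>h. \<lambda>a\<in>Arr C. e (h a)) (Arr C \<rightarrow>\<^sub>E A)"
    proof (rule inj_onI)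
      fix g h assume gh: "g \<in> Arr C \<rightarrow>\<^sub>E A" "h \<in> Arr C \<rightarrow>\<^sub>E A"
        and eq: "(\<lambda>a\<in>Arr C. e (g a)) = (\<lambda>a\<in>Arr C. e (h a))"
      show "g = h"
      proof (rule PiE_ext[OF gh])
        fix a assume a: "a \<in> Arr C"
        have "e (g a) = e (h a)" using fun_cong[OF eq, of a] a by (simp only: restrict_apply' if_True)
        then show "g a = h a" using inj_onD[OF e(1), of "g a" "h a"] PiE_mem[OF gh(1) a] PiE_mem[OF gh(2) a] by simp
      qed
    qed
    show "(\<lambda>h. \<lambda>a\<in>Arr C. e (h a)) ` (Arr C \<rightarrow>\<^sub>E A) \<subseteq> Arr C \<rightarrow>\<^sub>E e ` A"
      by (rule image_subsetI, rule restrict_PiE_iff[THEN iffD2]) (blast dest: PiE_mem)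
  qed
qed

text \<open>Subsets are coded as characteristic functions, which requires a small two-element set. A
  two-element set embeds in the sum \<open>Arr C <+> Arr C\<close> as soon as there is an
  arrow.\<close>

lemma small_Pow_Arr: "small_in U (Pow (Arr C))"
proof (cases "Arr C = {}")
  case True
  \<comment> \<open>Without arrows, the product over the empty index set still supplies a small set
    with one element, into which \<open>Pow {}\<close> embeds.\<close>
  have "small_in U {\<lambda>_ :: 'a. undefined :: 'u}" using small_PiE[of "\<lambda>_. {}"] True by simp
  then have "small_in U {()}" by (rule small_inj[where g = "\<lambda>_ _. undefined"]) auto
  then show ?thesis by (rule small_inj[where g = "\<lambda>_. ()"]) (use True in auto)
next
  case False
  obtain e where e: "inj_on e (Arr C)" "e ` Arr C \<in> U" using small_Arr by (auto simp: small_in_def)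
  have "small_in U (e ` Arr C <+> e ` Arr C)" using univ e unfolding universe_for_def by blast
  moreover obtain a where "a \<in> Arr C" using False by blast
  ultimately have bool: "small_in U (UNIV :: bool set)"
    by (elim small_inj[where g = "\<lambda>b. if b then Inl (e a) else Inr (e a)"]) (auto simp: inj_on_def)
  show ?thesis
  proof (rule small_inj[OF small_funs[OF bool], where g = "\<lambda>R. \<lambda>a\<in>Arr C. a \<in> R"])
    show "inj_on (\<lambda>R. \<lambda>a\<in>Arr C. a \<in> R) (Pow (Arr C))"
    proof (rule inj_onI, rule set_eqI)
      fix R Q a assume RQ: "R \<in> Pow (Arr C)" "Q \<in> Pow (Arr C)"
        and eq: "(\<lambda>a\<in>Arr C. a \<in> R) = (\<lambda>a\<in>Arr C. a \<in> Q)"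
      have "a \<in> R \<longleftrightarrow> a \<in> Q" if "a \<in> Arr C" using fun_cong[OF eq, of a] that by simp
      then show "a \<in> R \<longleftrightarrow> a \<in> Q" using RQ by blast
    qed
  qed auto
qed

text \<open>A relation is curried into a function from arrows to sets of arrows. This bounds the
  sections of the presheaf \<open>\<Omega>\<close> of closed sets of spans.\<close>

lemma small_Pow_Arr_Arr: "small_in U (Pow (Arr C \<times> Arr C))"
proof (rule small_inj[OF small_funs[OF small_Pow_Arr], where g = "\<lambda>R. \<lambda>a\<in>Arr C. R `` {a}"])
  show "inj_on (\<lambda>R. \<lambda>a\<in>Arr C. R `` {a}) (Pow (Arr C \<times> Arr C))"
  proof (rule inj_onI, rule set_eqI)
    fix R Q :: "('a \<times> 'a) set" and p :: "'a \<times> 'a" assume RQ: "R \<in> Pow (Arr C \<times> Arr C)" "Q \<in> Pow (Arr C \<times> Arr C)"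
      and eq: "(\<lambda>a\<in>Arr C. R `` {a}) = (\<lambda>a\<in>Arr C. Q `` {a})"
    have "R `` {fst p} = Q `` {fst p}" if "fst p \<in> Arr C" using fun_cong[OF eq, of "fst p"] that by simp
    then show "p \<in> R \<longleftrightarrow> p \<in> Q" using RQ by (cases p) auto
  qed
qed auto

text \<open>Natural constructions of sections live in types other than \<open>'u\<close>. Each set
  \<open>F c\<close> is moved into \<open>U\<close> along an injection, and restriction is
  conjugated by these injections.\<close>

lemma small_presheaf:
  assumes small: "\<And>c. c \<in> Obj C \<Longrightarrow> small_in U (F c)"
    and r: "\<And>f x. f \<in> Arr C \<Longrightarrow> x \<in> F (Cod C f) \<Longrightarrow> r f x \<in> F (Dom C f)"
    and r_id: "\<And>c x. c \<in> Obj C \<Longrightarrow> x \<in> F c \<Longrightarrow> r (Idn C c) x = x"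
    and r_cmp: "\<And>f g x. f \<in> Arr C \<Longrightarrow> g \<in> Arr C \<Longrightarrow> Dom C g = Cod C f \<Longrightarrow> x \<in> F (Cod C g)
      \<Longrightarrow> r (Cmp C g f) x = r f (r g x)"
  obtains X \<phi> where "psh X" "\<And>c. c \<in> Obj C \<Longrightarrow> bij_betw (\<phi> c) (F c) (sects X c)"
    "\<And>f x. f \<in> Arr C \<Longrightarrow> x \<in> F (Cod C f) \<Longrightarrow> restr X f (\<phi> (Cod C f) x) = \<phi> (Dom C f) (r f x)"
proof -
  have "\<forall>c\<in>Obj C. \<exists>e. inj_on e (F c) \<and> e ` F c \<in> U" using small unfolding small_in_def by blast
  then obtain \<phi> where \<phi>: "\<And>c. c \<in> Obj C \<Longrightarrow> inj_on (\<phi> c) (F c)" "\<And>c. c \<in> Obj C \<Longrightarrow> \<phi> c ` F c \<in> U"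
    by metis
  define X where "X = Presheaf (\<lambda>c\<in>Obj C. \<phi> c ` F c)
    (\<lambda>f\<in>Arr C. \<lambda>y\<in>\<phi> (Cod C f) ` F (Cod C f). \<phi> (Dom C f) (r f (inv_into (F (Cod C f)) (\<phi> (Cod C f)) y)))"
  have rX: "restr X f (\<phi> (Cod C f) x) = \<phi> (Dom C f) (r f x)" if "f \<in> Arr C" "x \<in> F (Cod C f)" for f x
    using that \<phi> by (auto simp: X_def)
  have sX: "sects X c = \<phi> c ` F c" if "c \<in> Obj C" for c using that by (simp add: X_def)
  have "psh X"
    unfolding is_presheaf_def
  proof (intro conjI ballI impI)
    show "sects X \<in> Obj C \<rightarrow>\<^sub>E U" using \<phi> by (auto simp: X_def)
    show "restr X \<in> extensional (Arr C)" by (simp add: X_def)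
    show "restr X f \<in> sects X (Cod C f) \<rightarrow>\<^sub>E sects X (Dom C f)" if f: "f \<in> Arr C" for f
    proof -
      have "restr X f y \<in> sects X (Dom C f)" if "y \<in> sects X (Cod C f)" for y
        using that rX[OF f] r f by (auto simp: sX)
      moreover have "restr X f \<in> extensional (sects X (Cod C f))" using f by (simp add: X_def)
      ultimately show ?thesis by (auto simp: PiE_iff)
    qed
    show "restr X (Idn C c) y = y" if "c \<in> Obj C" "y \<in> sects X c" for c y
      using that rX[of "Idn C c"] r_id by (auto simp: sX)
    show "restr X (Cmp C g f) y = restr X f (restr X g y)"
      if "f \<in> Arr C" "g \<in> Arr C" "Dom C g = Cod C f" "y \<in> sects X (Cod C g)" for f g y
      using that r[of g] r_cmp rX[of "Cmp C g f"] rX[of g] rX[of f] by (auto simp: sX)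
  qed
  then show ?thesis using that \<phi>(1) rX sX by (metis bij_betw_imageI)
qed

text \<open>The sections of \<open>A\<close> are literally those of \<open>F\<close>, and the
  inclusion acts as the identity on them, so sections can pass between \<open>A\<close> and
  \<open>X\<close> without any coding.\<close>

lemma subpresheaf:
  assumes X: "psh X" and F: "\<And>c. c \<in> Obj C \<Longrightarrow> F c \<subseteq> sects X c"
    and r: "\<And>f x. f \<in> Arr C \<Longrightarrow> x \<in> F (Cod C f) \<Longrightarrow> restr X f x \<in> F (Dom C f)"
  obtains A i where "i \<in> hom S A X" "\<And>c. c \<in> Obj C \<Longrightarrow> sects A c = F c"
    "\<And>c x. c \<in> Obj C \<Longrightarrow> x \<in> F c \<Longrightarrow> app i c x = x"
    "\<And>f x. f \<in> Arr C \<Longrightarrow> x \<in> F (Cod C f) \<Longrightarrow> restr A f x = restr X f x"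
proof -
  define A where "A = Presheaf (\<lambda>c\<in>Obj C. F c) (\<lambda>f\<in>Arr C. \<lambda>x\<in>F (Cod C f). restr X f x)"
  have F': "x \<in> sects X c" if "c \<in> Obj C" "x \<in> F c" for c x using F that by blast
  have rA: "restr A f x = restr X f x" if "f \<in> Arr C" "x \<in> F (Cod C f)" for f x
    using that by (simp add: A_def)
  have sA: "sects A c = F c" if "c \<in> Obj C" for c using that by (simp add: A_def)
  have A: "psh A"
    unfolding is_presheaf_def
  proof (intro conjI ballI impI)
    show "sects A \<in> Obj C \<rightarrow>\<^sub>E U" using U_subset[OF sects_U[OF X] F] by (auto simp: A_def)
    show "restr A \<in> extensional (Arr C)" by (simp add: A_def)
    show "restr A f \<in> sects A (Cod C f) \<rightarrow>\<^sub>E sects A (Dom C f)" if f: "f \<in> Arr C" for f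
      using f r by (auto simp: A_def)
    show "restr A (Idn C c) y = y" if "c \<in> Obj C" "y \<in> sects A c" for c y
      using that X F' by (auto simp: sA rA)
    show "restr A (Cmp C g f) y = restr A f (restr A g y)"
      if "f \<in> Arr C" "g \<in> Arr C" "Dom C g = Cod C f" "y \<in> sects A (Cod C g)" for f g y
      using that X r[of g] F' by (simp add: sA rA restr_cmp)
  qed
  have "transf_of A X (\<lambda>c x. x) \<in> hom S A X"
    by (rule transf_of_hom) (use A X F' sA rA in auto)
  then show ?thesis using that[of "transf_of A X (\<lambda>c x. x)" A] sA rA by simp
qed

text \<open>The hom-sets consist of arrows, not of elements of type \<open>'u\<close>, so a
  representable presheaf is fixed only up to isomorphism. The universal element
  \<open>\<iota>\<close> plays the part of the identity of \<open>c\<close>.\<close>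

definition represents where
  "represents c Y \<iota> \<longleftrightarrow> psh Y \<and> \<iota> \<in> sects Y c \<and>
     (\<forall>d\<in>Obj C. bij_betw (\<lambda>f. restr Y f \<iota>) {f \<in> Arr C. Dom C f = d \<and> Cod C f = c} (sects Y d))"

lemma representable:
  assumes c: "c \<in> Obj C"
  obtains Y \<iota> where "represents c Y \<iota>"
proof -
  obtain Y \<phi> where Y: "psh Y" and \<phi>: "\<And>d. d \<in> Obj C \<Longrightarrow>
      bij_betw (\<phi> d) {f \<in> Arr C. Dom C f = d \<and> Cod C f = c} (sects Y d)"
    and r: "\<And>g f. g \<in> Arr C \<Longrightarrow> f \<in> {f \<in> Arr C. Dom C f = Cod C g \<and> Cod C f = c} \<Longrightarrow>
      restr Y g (\<phi> (Cod C g) f) = \<phi> (Dom C g) (Cmp C f g)"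
  proof (rule small_presheaf[of "\<lambda>d. {f \<in> Arr C. Dom C f = d \<and> Cod C f = c}" "\<lambda>g f. Cmp C f g"])
    show "small_in U {f \<in> Arr C. Dom C f = d \<and> Cod C f = c}" for d
      by (rule small_inj[OF small_Arr, where g = "\<lambda>x. x"]) auto
  qed (auto simp: cmp_assoc)
  have "bij_betw (\<lambda>f. restr Y f (\<phi> c (Idn C c))) {f \<in> Arr C. Dom C f = d \<and> Cod C f = c} (sects Y d)"
    if "d \<in> Obj C" for d
    using \<phi>[OF that] by (rule bij_betw_cong[THEN iffD1, rotated]) (use r[of _ "Idn C c"] c in auto)
  moreover have "\<phi> c (Idn C c) \<in> sects Y c" using bij_betwE[OF \<phi>[OF c]] c by simp
  ultimately show ?thesis using that[of Y "\<phi> c (Idn C c)"] Y unfolding represents_def by blast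
qed

lemma yoneda:
  assumes Y: "represents c Y \<iota>" and X: "psh X" and x: "x \<in> sects X c" and c: "c \<in> Obj C"
  obtains t where "t \<in> hom S Y X" "app t c \<iota> = x"
    "\<And>f. f \<in> Arr C \<Longrightarrow> Cod C f = c \<Longrightarrow> app t (Dom C f) (restr Y f \<iota>) = restr X f x"
proof -
  have Y': "psh Y" "\<iota> \<in> sects Y c" and bij: "\<And>d. d \<in> Obj C \<Longrightarrow>
      bij_betw (\<lambda>f. restr Y f \<iota>) {f \<in> Arr C. Dom C f = d \<and> Cod C f = c} (sects Y d)"
    using Y unfolding represents_def by auto
  define \<psi> where "\<psi> d = inv_into {f \<in> Arr C. Dom C f = d \<and> Cod C f = c} (\<lambda>f. restr Y f \<iota>)" for d
  have \<psi>: "\<psi> (Dom C f) (restr Y f \<iota>) = f" if "f \<in> Arr C" "Cod C f = c" for f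
    unfolding \<psi>_def using bij_betw_inv_into_left[OF bij[of "Dom C f"]] that by simp
  have ex: "\<exists>f\<in>Arr C. Dom C f = d \<and> Cod C f = c \<and> y = restr Y f \<iota>" if "d \<in> Obj C" "y \<in> sects Y d" for d y
    using bij[OF that(1)] that(2) unfolding bij_betw_def by auto
  define t where "t = transf_of Y X (\<lambda>d y. restr X (\<psi> d y) x)"
  have t: "t \<in> hom S Y X"
    unfolding t_def
  proof (rule transf_of_hom)
    fix d y assume d: "d \<in> Obj C" "y \<in> sects Y d"
    show "restr X (\<psi> d y) x \<in> sects X d" using ex[OF d] \<psi> X x by auto
  next
    fix g y assume g: "g \<in> Arr C" and y: "y \<in> sects Y (Cod C g)"
    obtain f where f: "f \<in> Arr C" "Dom C f = Cod C g" "Cod C f = c" "y = restr Y f \<iota>"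
      using ex[OF _ y] g by auto
    have "restr Y g y = restr Y (Cmp C f g) \<iota>" using f g Y' by (simp add: restr_cmp)
    then have "\<psi> (Dom C g) (restr Y g y) = Cmp C f g" using \<psi>[of "Cmp C f g"] f g by simp
    moreover have "\<psi> (Cod C g) y = f" using \<psi>[of f] f by simp
    ultimately show "restr X (\<psi> (Dom C g) (restr Y g y)) x = restr X g (restr X (\<psi> (Cod C g) y) x)"
      using f g X x by (simp add: restr_cmp)
  qed (use X Y' in auto)
  have f: "app t (Dom C f) (restr Y f \<iota>) = restr X f x" if "f \<in> Arr C" "Cod C f = c" for f
    unfolding t_def using \<psi>[OF that] that Y' by simp
  from f[of "Idn C c"] have "app t c \<iota> = x" using c Y' X x by simp
  then show ?thesis using that t f by blast
qed

lemma yoneda_eqI: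
  assumes Y: "represents c Y \<iota>" and s: "s \<in> hom S Y X" and t: "t \<in> hom S Y X" and c: "c \<in> Obj C"
    and eq: "app s c \<iota> = app t c \<iota>"
  shows "s = t"
proof (rule hom_eqI[OF s t])
  fix d y assume d: "d \<in> Obj C" "y \<in> sects Y d"
  then obtain f where f: "f \<in> Arr C" "Dom C f = d" "Cod C f = c" "y = restr Y f \<iota>"
    using Y unfolding represents_def bij_betw_def by auto
  have "\<iota> \<in> sects Y c" using Y by (simp add: represents_def)
  then show "app s d y = app t d y" using app_nat[OF s f(1)] app_nat[OF t f(1)] f eq by auto
qed

section \<open>Pullbacks, products and monomorphisms of presheaves\<close>

lemma comp_appD:
  assumes "t \<odot> s = r" "s \<in> hom S X Y" "c \<in> Obj C" "x \<in> sects X c"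
  shows "app t c (app s c x) = app r c x"
  using assms(3,4) app_comp[of c x s t] homD[OF assms(2)] unfolding assms(1)[symmetric] by simp

lemma comp_app_eqD:
  assumes "t \<odot> s = t' \<odot> s'" "s \<in> hom S X Y" "s' \<in> hom S X Z" "c \<in> Obj C" "x \<in> sects X c"
  shows "app t c (app s c x) = app t' c (app s' c x)"
  using comp_appD[OF assms(1,2,4,5)] comp_appD[OF refl assms(3,4,5)] by simp

lemma comp_eqI:
  assumes s: "s \<in> hom S X Y" and t: "t \<in> hom S Y Z" and r: "r \<in> hom S X Z"
    and eq: "\<And>c x. c \<in> Obj C \<Longrightarrow> x \<in> sects X c \<Longrightarrow> app t c (app s c x) = app r c x"
  shows "t \<odot> s = r"
  by (rule hom_eqI[OF comp_hom[OF s t] r]) (simp add: eq homD[OF s])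

lemma pullback_universal:
  assumes pb: "is_pullback S f g p q"
    and f: "f \<in> hom S X B" and g: "g \<in> hom S Y B" and p: "p \<in> hom S P X" and q: "q \<in> hom S P Y"
    and s: "s \<in> hom S Z X" and t: "t \<in> hom S Z Y" and eq: "f \<odot> s = g \<odot> t"
  shows "\<exists>!u. u \<in> hom S Z P \<and> p \<odot> u = s \<and> q \<odot> u = t"
proof -
  have *: "\<forall>h\<in>Arr S. \<forall>k\<in>Arr S. source h = source k \<longrightarrow> target h = source f \<longrightarrow> target k = source g \<longrightarrow>
      f \<odot> h = g \<odot> k \<longrightarrow> (\<exists>!u. u \<in> hom S (source h) (source p) \<and> p \<odot> u = h \<and> q \<odot> u = k)"
    using pb unfolding is_pullback_def presheaf_cat_sel(3,4) by (elim conjE)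
  show ?thesis
    using *[rule_format, of s t] eq homD[OF s] homD[OF t] homD[OF f] homD[OF g] homD[OF p] by metis
qed

definition pointwise_pullback where
  "pointwise_pullback f g p q \<longleftrightarrow>
     (\<forall>c\<in>Obj C. (\<forall>w\<in>sects (source p) c. app f c (app p c w) = app g c (app q c w)) \<and>
       (\<forall>x\<in>sects (source f) c. \<forall>y\<in>sects (source g) c. app f c x = app g c y \<longrightarrow>
         (\<exists>!w. w \<in> sects (source p) c \<and> app p c w = x \<and> app q c w = y)))"

text \<open>Sections over \<open>c\<close> are maps out of the representable of \<open>c\<close>, so
  testing the universal property against representables gives the sectionwise one. Conversely, the
  sectionwise lifts of a cone are natural because both sides of the naturality equation solve the
  same uniquely solvable problem.\<close>

lemma pullback_iff:
  assumes f: "f \<in> hom S X B" and g: "g \<in> hom S Y B" and p: "p \<in> hom S P X" and q: "q \<in> hom S P Y"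
  shows "is_pullback S f g p q \<longleftrightarrow> pointwise_pullback f g p q"
proof
  note [simp] = homD[OF f] homD[OF g] homD[OF p] homD[OF q]
  note [simp] = app_in[OF f] app_in[OF g] app_in[OF p] app_in[OF q]
  assume pb: "is_pullback S f g p q"
  show "pointwise_pullback f g p q"
    unfolding pointwise_pullback_def
  proof (intro ballI impI conjI)
    fix c w assume c: "c \<in> Obj C" and w: "w \<in> sects (source p) c"
    have "f \<odot> p = g \<odot> q" using pb unfolding is_pullback_def by blast
    then show "app f c (app p c w) = app g c (app q c w)"
      using comp_app_eqD[OF _ p q c] w by simp
  next
    fix c x y assume c: "c \<in> Obj C" and "x \<in> sects (source f) c" "y \<in> sects (source g) c"
      and eq: "app f c x = app g c y"
    then have x: "x \<in> sects X c" and y: "y \<in> sects Y c" by auto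
    obtain Z \<iota> where Z: "represents c Z \<iota>" using representable[OF c] .
    have \<iota>: "\<iota> \<in> sects Z c" using Z by (simp add: represents_def)
    obtain s where s: "s \<in> hom S Z X" "app s c \<iota> = x" using yoneda[OF Z _ x c] by auto
    obtain t where t: "t \<in> hom S Z Y" "app t c \<iota> = y" using yoneda[OF Z _ y c] by auto
    have "f \<odot> s = g \<odot> t"
      by (rule yoneda_eqI[OF Z comp_hom[OF s(1) f] comp_hom[OF t(1) g] c])
        (use c \<iota> s t eq homD[OF s(1)] homD[OF t(1)] in simp)
    then have u: "\<exists>!u. u \<in> hom S Z P \<and> p \<odot> u = s \<and> q \<odot> u = t"
      by (rule pullback_universal[OF pb f g p q s(1) t(1)])
    then obtain u where u': "u \<in> hom S Z P" "p \<odot> u = s" "q \<odot> u = t" by blast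
    have "app p c (app u c \<iota>) = x" "app q c (app u c \<iota>) = y" "app u c \<iota> \<in> sects P c"
      using comp_appD[OF u'(2,1) c \<iota>] comp_appD[OF u'(3,1) c \<iota>] s(2) t(2) app_in[OF u'(1) c \<iota>] by simp_all
    moreover have "w = w'" if w: "w \<in> sects P c" "w' \<in> sects P c" and pw: "app p c w = x" "app q c w = y"
      "app p c w' = x" "app q c w' = y" for w w'
    proof -
      have lift: "p \<odot> v = s \<and> q \<odot> v = t" if v: "v \<in> hom S Z P" "app p c (app v c \<iota>) = x" "app q c (app v c \<iota>) = y" for v
      proof
        show "p \<odot> v = s"
          by (rule yoneda_eqI[OF Z comp_hom[OF v(1) p] s(1) c]) (use v c \<iota> s homD[OF v(1)] in simp)
        show "q \<odot> v = t"
          by (rule yoneda_eqI[OF Z comp_hom[OF v(1) q] t(1) c]) (use v c \<iota> t homD[OF v(1)] in simp)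
      qed
      obtain v where v: "v \<in> hom S Z P" "app v c \<iota> = w" using yoneda[OF Z homD(1)[OF p] w(1) c] by auto
      obtain v' where v': "v' \<in> hom S Z P" "app v' c \<iota> = w'" using yoneda[OF Z homD(1)[OF p] w(2) c] by auto
      have "v = v'" using u lift[of v] lift[of v'] v v' pw by auto
      then show ?thesis using v v' by simp
    qed
    ultimately show "\<exists>!w. w \<in> sects (source p) c \<and> app p c w = x \<and> app q c w = y"
      unfolding homD[OF p] by blast
  qed
next
  note [simp] = homD[OF f] homD[OF g] homD[OF p] homD[OF q]
  note [simp] = app_in[OF f] app_in[OF g] app_in[OF p] app_in[OF q]
  assume pb: "pointwise_pullback f g p q"
  have sq: "app f c (app p c w) = app g c (app q c w)" if "c \<in> Obj C" "w \<in> sects P c" for c w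
    using pb that by (simp add: pointwise_pullback_def)
  have ex1: "\<exists>!w. w \<in> sects P c \<and> app p c w = x \<and> app q c w = y"
    if "c \<in> Obj C" "x \<in> sects X c" "y \<in> sects Y c" "app f c x = app g c y" for c x y
    using pb that by (simp add: pointwise_pullback_def)
  show "is_pullback S f g p q"
    unfolding is_pullback_def
  proof (intro conjI ballI impI)
    show "f \<odot> p = g \<odot> q"
      by (rule hom_eqI[OF comp_hom[OF p f] comp_hom[OF q g]]) (use sq in simp)
  next
    fix s t assume st: "s \<in> Arr S" "t \<in> Arr S" "Dom S s = Dom S t" "Cod S s = Dom S f" "Cod S t = Dom S g"
      and eq: "f \<odot> s = g \<odot> t"
    define Z where "Z = source s"
    have s: "s \<in> hom S Z X" and t: "t \<in> hom S Z Y" using st by (auto simp: hom_def Z_def)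
    note [simp] = homD[OF s] homD[OF t] app_in[OF s] app_in[OF t]
    have eq': "app f c (app s c z) = app g c (app t c z)" if "c \<in> Obj C" "z \<in> sects Z c" for c z
      by (rule comp_app_eqD[OF eq s t that])
    define \<upsilon> where "\<upsilon> c z = (THE w. w \<in> sects P c \<and> app p c w = app s c z \<and> app q c w = app t c z)" for c z
    have \<upsilon>: "\<upsilon> c z \<in> sects P c \<and> app p c (\<upsilon> c z) = app s c z \<and> app q c (\<upsilon> c z) = app t c z"
      if "c \<in> Obj C" "z \<in> sects Z c" for c z
      unfolding \<upsilon>_def by (rule theI', rule ex1) (use that eq' in auto)
    have uniq: "w = \<upsilon> c z" if "c \<in> Obj C" "z \<in> sects Z c" "w \<in> sects P c"
      "app p c w = app s c z" "app q c w = app t c z" for c z w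
    proof -
      have "\<exists>!w. w \<in> sects P c \<and> app p c w = app s c z \<and> app q c w = app t c z"
        by (rule ex1) (use that eq' in auto)
      then show ?thesis using that \<upsilon> by blast
    qed
    have u: "transf_of Z P \<upsilon> \<in> hom S Z P"
    proof (rule transf_of_hom)
      fix h z assume h: "h \<in> Arr C" "z \<in> sects Z (Cod C h)"
      show "\<upsilon> (Dom C h) (restr Z h z) = restr P h (\<upsilon> (Cod C h) z)"
        by (rule uniq[symmetric]) (use h \<upsilon> app_nat[OF p] app_nat[OF q] app_nat[OF s] app_nat[OF t] in auto)
    qed (use \<upsilon> in auto)
    have "p \<odot> transf_of Z P \<upsilon> = s"
      by (rule hom_eqI[OF comp_hom[OF u p] s]) (use \<upsilon> in simp)
    moreover have "q \<odot> transf_of Z P \<upsilon> = t"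
      by (rule hom_eqI[OF comp_hom[OF u q] t]) (use \<upsilon> in simp)
    moreover have "v = transf_of Z P \<upsilon>" if v: "v \<in> hom S Z P" "p \<odot> v = s" "q \<odot> v = t" for v
    proof (rule hom_eqI[OF v(1) u])
      fix c z assume c: "c \<in> Obj C" "z \<in> sects Z c"
      show "app v c z = app (transf_of Z P \<upsilon>) c z"
        using uniq[OF c app_in[OF v(1) c]] c comp_appD[OF v(2,1) c] comp_appD[OF v(3,1) c] by simp
    qed
    ultimately have "\<exists>!u. u \<in> hom S Z P \<and> p \<odot> u = s \<and> q \<odot> u = t"
      using u by blast
    then show "\<exists>!u. u \<in> hom S (Dom S s) (Dom S p) \<and> p \<odot> u = s \<and> q \<odot> u = t"
      by simp
  qed simp_all
qed

lemma pullbackD: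
  assumes pb: "is_pullback S f g p q"
    and f: "f \<in> hom S X B" and g: "g \<in> hom S Y B" and p: "p \<in> hom S P X" and q: "q \<in> hom S P Y"
    and c: "c \<in> Obj C"
  shows "w \<in> sects P c \<Longrightarrow> app f c (app p c w) = app g c (app q c w)"
    and "x \<in> sects X c \<Longrightarrow> y \<in> sects Y c \<Longrightarrow> app f c x = app g c y
      \<Longrightarrow> \<exists>w\<in>sects P c. app p c w = x \<and> app q c w = y"
    and "w \<in> sects P c \<Longrightarrow> w' \<in> sects P c \<Longrightarrow> app p c w = app p c w' \<Longrightarrow> app q c w = app q c w' \<Longrightarrow> w = w'"
proof -
  note [simp] = homD[OF f] homD[OF g] homD[OF p] homD[OF q]
  note [simp] = app_in[OF f] app_in[OF g] app_in[OF p] app_in[OF q]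
  have *: "pointwise_pullback f g p q" using pb pullback_iff[OF f g p q] by blast
  show sq: "app f c (app p c w) = app g c (app q c w)" if "w \<in> sects P c" for w
    using * c that by (simp add: pointwise_pullback_def)
  have ex1: "\<exists>!w. w \<in> sects P c \<and> app p c w = x \<and> app q c w = y"
    if "x \<in> sects X c" "y \<in> sects Y c" "app f c x = app g c y" for x y
    using * c that by (simp add: pointwise_pullback_def)
  then show "x \<in> sects X c \<Longrightarrow> y \<in> sects Y c \<Longrightarrow> app f c x = app g c y
      \<Longrightarrow> \<exists>w\<in>sects P c. app p c w = x \<and> app q c w = y" by blast
  assume w: "w \<in> sects P c" "w' \<in> sects P c" "app p c w = app p c w'" "app q c w = app q c w'"
  have "\<exists>!v. v \<in> sects P c \<and> app p c v = app p c w \<and> app q c v = app q c w"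
    by (rule ex1) (use w c sq in simp_all)
  then show "w = w'" using w by metis
qed

lemma pullbackI:
  assumes f: "f \<in> hom S X B" and g: "g \<in> hom S Y B" and p: "p \<in> hom S P X" and q: "q \<in> hom S P Y"
    and "\<And>c w. c \<in> Obj C \<Longrightarrow> w \<in> sects P c \<Longrightarrow> app f c (app p c w) = app g c (app q c w)"
    and "\<And>c x y. c \<in> Obj C \<Longrightarrow> x \<in> sects X c \<Longrightarrow> y \<in> sects Y c \<Longrightarrow> app f c x = app g c y
      \<Longrightarrow> \<exists>w\<in>sects P c. app p c w = x \<and> app q c w = y"
    and "\<And>c w w'. c \<in> Obj C \<Longrightarrow> w \<in> sects P c \<Longrightarrow> w' \<in> sects P c \<Longrightarrow> app p c w = app p c w'
      \<Longrightarrow> app q c w = app q c w' \<Longrightarrow> w = w'"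
  shows "is_pullback S f g p q"
  unfolding pullback_iff[OF f g p q] pointwise_pullback_def homD[OF f] homD[OF g] homD[OF p]
proof (intro ballI conjI impI)
  fix c x y assume c: "c \<in> Obj C" and "x \<in> sects X c" "y \<in> sects Y c" "app f c x = app g c y"
  then obtain w where w: "w \<in> sects P c" "app p c w = x" "app q c w = y" using assms(6)[OF c] by blast
  show "\<exists>!w. w \<in> sects P c \<and> app p c w = x \<and> app q c w = y"
  proof (rule ex1I[of _ w])
    fix w' assume "w' \<in> sects P c \<and> app p c w' = x \<and> app q c w' = y"
    then show "w' = w" using assms(7)[OF c, of w' w] w by simp
  qed (use w in simp)
qed (rule assms(5))

lemma pullback_exists:
  assumes f: "f \<in> hom S X B" and g: "g \<in> hom S Y B"
  obtains P p q where "p \<in> hom S P X" "q \<in> hom S P Y" "is_pullback S f g p q"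
proof -
  note [simp] = homD[OF f] homD[OF g] app_in[OF f] app_in[OF g]
  define F where "F c = {w \<in> sects X c \<times> sects Y c. app f c (fst w) = app g c (snd w)}" for c
  obtain P \<phi> where P: "psh P" and \<phi>: "\<And>c. c \<in> Obj C \<Longrightarrow> bij_betw (\<phi> c) (F c) (sects P c)"
    and r: "\<And>h w. h \<in> Arr C \<Longrightarrow> w \<in> F (Cod C h)
      \<Longrightarrow> restr P h (\<phi> (Cod C h) w) = \<phi> (Dom C h) (map_prod (restr X h) (restr Y h) w)"
  proof (rule small_presheaf[of F "\<lambda>h. map_prod (restr X h) (restr Y h)"])
    show "small_in U (F c)" if "c \<in> Obj C" for c
      by (rule small_inj[OF small_prod[OF small_U[OF sects_U] small_U[OF sects_U]], of X c Y c "\<lambda>w. w"])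
        (use that in \<open>auto simp: F_def\<close>)
    show "map_prod (restr X h) (restr Y h) w \<in> F (Dom C h)" if h: "h \<in> Arr C" "w \<in> F (Cod C h)" for h w
      using that app_nat[OF f h(1), of "fst w"] app_nat[OF g h(1), of "snd w"] by (auto simp: F_def)
  qed (auto simp: F_def restr_cmp)
  define \<psi> where "\<psi> c = inv_into (F c) (\<phi> c)" for c
  have \<psi>: "\<psi> c w \<in> F c" "\<phi> c (\<psi> c w) = w" if "c \<in> Obj C" "w \<in> sects P c" for c w
    using \<phi>[OF that(1)] that(2) by (auto simp: \<psi>_def bij_betw_def inv_into_into f_inv_into_f)
  have \<psi>\<phi>: "\<psi> c (\<phi> c w) = w" if "c \<in> Obj C" "w \<in> F c" for c w
    using \<phi>[OF that(1)] that(2) by (auto simp: \<psi>_def bij_betw_def)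
  have \<phi>_in: "\<phi> c w \<in> sects P c" if "c \<in> Obj C" "w \<in> F c" for c w
    using \<phi>[OF that(1)] that(2) by (auto simp: bij_betw_def)
  have \<psi>_nat: "\<psi> (Dom C h) (restr P h w) = map_prod (restr X h) (restr Y h) (\<psi> (Cod C h) w)"
    if h: "h \<in> Arr C" "w \<in> sects P (Cod C h)" for h w
  proof -
    let ?v = "\<psi> (Cod C h) w"
    have v: "?v \<in> F (Cod C h)" "\<phi> (Cod C h) ?v = w" using \<psi> h by auto
    then have "map_prod (restr X h) (restr Y h) ?v \<in> F (Dom C h)"
      using h app_nat[OF f h(1), of "fst ?v"] app_nat[OF g h(1), of "snd ?v"] by (auto simp: F_def)
    then show ?thesis using r[OF h(1) v(1)] v(2) \<psi>\<phi>[of "Dom C h"] h by simp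
  qed
  have \<psi>': "fst (\<psi> c w) \<in> sects X c" "snd (\<psi> c w) \<in> sects Y c"
    "app f c (fst (\<psi> c w)) = app g c (snd (\<psi> c w))" if "c \<in> Obj C" "w \<in> sects P c" for c w
    using \<psi>[OF that] by (auto simp: F_def)
  have p: "transf_of P X (\<lambda>c w. fst (\<psi> c w)) \<in> hom S P X"
    by (rule transf_of_hom) (use P \<psi>' \<psi>_nat in auto)
  have q: "transf_of P Y (\<lambda>c w. snd (\<psi> c w)) \<in> hom S P Y"
    by (rule transf_of_hom) (use P \<psi>' \<psi>_nat in auto)
  have "is_pullback S f g (transf_of P X (\<lambda>c w. fst (\<psi> c w))) (transf_of P Y (\<lambda>c w. snd (\<psi> c w)))"
  proof (rule pullbackI[OF f g p q])
    fix c x y assume c: "c \<in> Obj C" and xy: "x \<in> sects X c" "y \<in> sects Y c" "app f c x = app g c y"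
    then have "(x, y) \<in> F c" by (simp add: F_def)
    then show "\<exists>w\<in>sects P c. app (transf_of P X (\<lambda>c w. fst (\<psi> c w))) c w = x \<and>
        app (transf_of P Y (\<lambda>c w. snd (\<psi> c w))) c w = y"
      using c \<phi>_in \<psi>\<phi> by (intro bexI[of _ "\<phi> c (x, y)"]) simp_all
  next
    fix c w w' assume c: "c \<in> Obj C" and w: "w \<in> sects P c" "w' \<in> sects P c"
      and "app (transf_of P X (\<lambda>c w. fst (\<psi> c w))) c w = app (transf_of P X (\<lambda>c w. fst (\<psi> c w))) c w'"
      "app (transf_of P Y (\<lambda>c w. snd (\<psi> c w))) c w = app (transf_of P Y (\<lambda>c w. snd (\<psi> c w))) c w'"
    then have "\<psi> c w = \<psi> c w'" by (simp add: prod_eq_iff)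
    then show "w = w'" using \<psi>(2)[OF c] w by metis
  qed (simp add: \<psi>')
  then show ?thesis using that p q by blast
qed

lemma terminal_exists:
  obtains T a where "psh T" "\<And>c. c \<in> Obj C \<Longrightarrow> sects T c = {a c}"
proof -
  \<comment> \<open>A one-element set embeds in \<open>Arr C\<close> through the identity of the
    object at hand.\<close>
  have "small_in U {()}" if "c \<in> Obj C" for c
    using small_Arr idn[OF that] by (elim small_inj[where g = "\<lambda>_. Idn C c"]) auto
  then obtain T \<phi> where "psh T" "\<And>c. c \<in> Obj C \<Longrightarrow> bij_betw (\<phi> c) {()} (sects T c)"
    by (rule small_presheaf[of "\<lambda>_. {()}" "\<lambda>_ x. x"]) auto
  then show ?thesis using that[of T "\<lambda>c. \<phi> c ()"] by (force simp: bij_betw_def)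
qed

lemma terminal_map:
  assumes "psh X" "psh T" "\<And>c. c \<in> Obj C \<Longrightarrow> sects T c = {a c}"
  obtains t where "t \<in> hom S X T"
proof -
  have "transf_of X T (\<lambda>c _. a c) \<in> hom S X T"
    by (rule transf_of_hom) (use assms restr_in[of T] in \<open>auto, metis (no_types, lifting) dom_cod(1) dom_cod(2) insertI1 singletonD\<close>)
  then show ?thesis using that by blast
qed

text \<open>Taken as the pullback over the terminal presheaf, where the square commutes for lack of
  distinct sections.\<close>

lemma product_exists:
  assumes X: "psh X" and Y: "psh Y"
  obtains P p q where "p \<in> hom S P X" "q \<in> hom S P Y"
    "\<And>c x y. c \<in> Obj C \<Longrightarrow> x \<in> sects X c \<Longrightarrow> y \<in> sects Y c \<Longrightarrow> \<exists>w\<in>sects P c. app p c w = x \<and> app q c w = y"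
    "\<And>c w w'. c \<in> Obj C \<Longrightarrow> w \<in> sects P c \<Longrightarrow> w' \<in> sects P c \<Longrightarrow> app p c w = app p c w'
      \<Longrightarrow> app q c w = app q c w' \<Longrightarrow> w = w'"
    "\<And>Z s t. s \<in> hom S Z X \<Longrightarrow> t \<in> hom S Z Y \<Longrightarrow> \<exists>u\<in>hom S Z P. p \<odot> u = s \<and> q \<odot> u = t"
proof -
  obtain T a where T: "psh T" "\<And>c. c \<in> Obj C \<Longrightarrow> sects T c = {a c}" using terminal_exists by metis
  obtain f where f: "f \<in> hom S X T" using terminal_map[OF X T] .
  obtain g where g: "g \<in> hom S Y T" using terminal_map[OF Y T] .
  obtain P p q where pq: "p \<in> hom S P X" "q \<in> hom S P Y" "is_pullback S f g p q"
    using pullback_exists[OF f g] .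
  have sq: "app f c x = app g c y" if "c \<in> Obj C" "x \<in> sects X c" "y \<in> sects Y c" for c x y
    using app_in[OF f that(1,2)] app_in[OF g that(1,3)] T that by simp
  have "\<exists>u\<in>hom S Z P. p \<odot> u = s \<and> q \<odot> u = t" if st: "s \<in> hom S Z X" "t \<in> hom S Z Y" for Z s t
  proof -
    have "f \<odot> s = g \<odot> t"
      by (rule comp_eqI[OF st(1) f comp_hom[OF st(2) g]]) (simp add: sq app_in[OF st(1)] app_in[OF st(2)] homD[OF st(2)])
    then show ?thesis using pullback_universal[OF pq(3) f g pq(1,2) st] by blast
  qed
  then show ?thesis using that[OF pq(1,2)] sq pullbackD[OF pq(3) f g pq(1,2)] by blast
qed

lemma product_iff:
  assumes X: "\<And>i. i \<in> I \<Longrightarrow> psh (X i)" and p: "\<And>i. i \<in> I \<Longrightarrow> p i \<in> hom S P (X i)" and P: "psh P"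
  shows "is_product S I X P p \<longleftrightarrow> (\<forall>c\<in>Obj C. \<forall>x. (\<forall>i\<in>I. x i \<in> sects (X i) c) \<longrightarrow>
     (\<exists>!w. w \<in> sects P c \<and> (\<forall>i\<in>I. app (p i) c w = x i)))"
proof
  assume prod: "is_product S I X P p"
  show "\<forall>c\<in>Obj C. \<forall>x. (\<forall>i\<in>I. x i \<in> sects (X i) c) \<longrightarrow>
     (\<exists>!w. w \<in> sects P c \<and> (\<forall>i\<in>I. app (p i) c w = x i))"
  proof (intro ballI allI impI)
    fix c x assume c: "c \<in> Obj C" and x: "\<forall>i\<in>I. x i \<in> sects (X i) c"
    obtain Z \<iota> where Z: "represents c Z \<iota>" using representable[OF c] .
    have \<iota>: "\<iota> \<in> sects Z c" "psh Z" using Z by (simp_all add: represents_def)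
    have "\<forall>i\<in>I. \<exists>s. s \<in> hom S Z (X i) \<and> app s c \<iota> = x i"
    proof
      fix i assume i: "i \<in> I"
      show "\<exists>s. s \<in> hom S Z (X i) \<and> app s c \<iota> = x i"
        by (rule yoneda[OF Z X[OF i] bspec[OF x i] c]) blast
    qed
    then obtain s where s: "\<And>i. i \<in> I \<Longrightarrow> s i \<in> hom S Z (X i)" "\<And>i. i \<in> I \<Longrightarrow> app (s i) c \<iota> = x i" by metis
    have "\<forall>Q\<in>Obj S. \<forall>s. (\<forall>i\<in>I. s i \<in> hom S Q (X i)) \<longrightarrow> (\<exists>!u. u \<in> hom S Q P \<and> (\<forall>i\<in>I. p i \<odot> u = s i))"
      using prod unfolding is_product_def by (elim conjE)
    then have u: "\<exists>!u. u \<in> hom S Z P \<and> (\<forall>i\<in>I. p i \<odot> u = s i)"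
      using s(1) \<iota>(2) by (simp add: presheaf_cat_sel(1))
    then obtain u where u': "u \<in> hom S Z P" "\<And>i. i \<in> I \<Longrightarrow> p i \<odot> u = s i" by blast
    have a: "app (p i) c (app u c \<iota>) = x i" if "i \<in> I" for i
      using comp_appD[OF u'(2)[OF that] u'(1) c \<iota>(1)] s(2)[OF that] by simp
    have b: "app u c \<iota> \<in> sects P c" using app_in[OF u'(1) c \<iota>(1)] .
    have "w = w'" if w: "w \<in> sects P c" "w' \<in> sects P c" and pw: "\<forall>i\<in>I. app (p i) c w = x i"
      "\<forall>i\<in>I. app (p i) c w' = x i" for w w'
    proof -
      have lift: "p i \<odot> v = s i" if v: "v \<in> hom S Z P" "app (p i) c (app v c \<iota>) = x i" and i: "i \<in> I" for v i
        by (rule yoneda_eqI[OF Z comp_hom[OF v(1) p[OF i]] s(1)[OF i] c])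
          (use v c \<iota> s(2)[OF i] homD[OF v(1)] in simp)
      obtain v where v: "v \<in> hom S Z P" "app v c \<iota> = w" using yoneda[OF Z P w(1) c] by auto
      obtain v' where v': "v' \<in> hom S Z P" "app v' c \<iota> = w'" using yoneda[OF Z P w(2) c] by auto
      have "\<forall>i\<in>I. p i \<odot> v = s i" "\<forall>i\<in>I. p i \<odot> v' = s i"
        using lift[OF v(1)] lift[OF v'(1)] v(2) v'(2) pw by simp_all
      then have "v = v'" using u v(1) v'(1) by blast
      then show ?thesis using v(2) v'(2) by simp
    qed
    then show "\<exists>!w. w \<in> sects P c \<and> (\<forall>i\<in>I. app (p i) c w = x i)"
      using a b by (intro ex1I[of _ "app u c \<iota>"]) simp_all
  qed
next
  assume ex1: "\<forall>c\<in>Obj C. \<forall>x. (\<forall>i\<in>I. x i \<in> sects (X i) c) \<longrightarrow>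
     (\<exists>!w. w \<in> sects P c \<and> (\<forall>i\<in>I. app (p i) c w = x i))"
  show "is_product S I X P p"
    unfolding is_product_def
  proof (intro conjI ballI allI impI)
    fix Z s assume "Z \<in> Obj S" and "\<forall>i\<in>I. s i \<in> hom S Z (X i)"
    then have Z: "psh Z" and s: "\<And>i. i \<in> I \<Longrightarrow> s i \<in> hom S Z (X i)" by (auto simp: presheaf_cat_sel)
    define \<upsilon> where "\<upsilon> c z = (THE w. w \<in> sects P c \<and> (\<forall>i\<in>I. app (p i) c w = app (s i) c z))" for c z
    have ex1': "\<exists>!w. w \<in> sects P c \<and> (\<forall>i\<in>I. app (p i) c w = app (s i) c z)"
      if "c \<in> Obj C" "z \<in> sects Z c" for c z
      using ex1[rule_format, OF that(1), of "\<lambda>i. app (s i) c z"] app_in[OF s that] by simp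
    have \<upsilon>: "\<upsilon> c z \<in> sects P c \<and> (\<forall>i\<in>I. app (p i) c (\<upsilon> c z) = app (s i) c z)"
      if "c \<in> Obj C" "z \<in> sects Z c" for c z
      unfolding \<upsilon>_def by (rule theI'[OF ex1'[OF that]])
    have uniq: "w = \<upsilon> c z" if "c \<in> Obj C" "z \<in> sects Z c" "w \<in> sects P c"
      "\<And>i. i \<in> I \<Longrightarrow> app (p i) c w = app (s i) c z" for c z w
      using ex1'[OF that(1,2)] that \<upsilon>[OF that(1,2)] by blast
    have u: "transf_of Z P \<upsilon> \<in> hom S Z P"
    proof (rule transf_of_hom)
      fix h z assume h: "h \<in> Arr C" "z \<in> sects Z (Cod C h)"
      show "\<upsilon> (Dom C h) (restr Z h z) = restr P h (\<upsilon> (Cod C h) z)"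
        by (rule uniq[symmetric]) (use h \<upsilon> Z P app_nat[OF p] app_nat[OF s] in auto)
    qed (use \<upsilon> Z P in auto)
    have "p i \<odot> transf_of Z P \<upsilon> = s i" if "i \<in> I" for i
      by (rule hom_eqI[OF comp_hom[OF u p] s]) (use \<upsilon> that in simp_all)
    moreover have "v = transf_of Z P \<upsilon>" if v: "v \<in> hom S Z P" "\<forall>i\<in>I. p i \<odot> v = s i" for v
    proof (rule hom_eqI[OF v(1) u])
      fix c z assume c: "c \<in> Obj C" "z \<in> sects Z c"
      have "app (p i) c (app v c z) = app (s i) c z" if "i \<in> I" for i
        by (rule comp_appD[OF bspec[OF v(2) that] v(1) c])
      then show "app v c z = app (transf_of Z P \<upsilon>) c z"
        using uniq[OF c app_in[OF v(1) c]] c by simp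
    qed
    ultimately show "\<exists>!u. u \<in> hom S Z P \<and> (\<forall>i\<in>I. p i \<odot> u = s i)"
      using u by blast
  qed (simp_all add: X p P presheaf_cat_sel(1))
qed

text \<open>Two sections with the same image are two maps out of a representable that
  \<open>m\<close> does not distinguish.\<close>

lemma monic_iff:
  assumes m: "m \<in> hom S X Y"
  shows "monic S m \<longleftrightarrow> (\<forall>c\<in>Obj C. inj_on (app m c) (sects X c))"
proof
  note [simp] = homD[OF m]
  assume mono: "monic S m"
  show "\<forall>c\<in>Obj C. inj_on (app m c) (sects X c)"
  proof (intro ballI inj_onI)
    fix c x y assume c: "c \<in> Obj C" and x: "x \<in> sects X c" and y: "y \<in> sects X c" and eq: "app m c x = app m c y"
    obtain Z \<iota> where Z: "represents c Z \<iota>" using representable[OF c] .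
    have \<iota>: "\<iota> \<in> sects Z c" using Z by (simp add: represents_def)
    obtain s where s: "s \<in> hom S Z X" "app s c \<iota> = x" using yoneda[OF Z _ x c] by auto
    obtain t where t: "t \<in> hom S Z X" "app t c \<iota> = y" using yoneda[OF Z _ y c] by auto
    have "m \<odot> s = m \<odot> t"
      by (rule yoneda_eqI[OF Z comp_hom[OF s(1) m] comp_hom[OF t(1) m] c])
        (use c \<iota> s t eq homD[OF s(1)] homD[OF t(1)] in simp)
    then have "s = t" using mono homD[OF s(1)] homD[OF t(1)] unfolding monic_def by auto
    then show "x = y" using s t by simp
  qed
next
  note [simp] = homD[OF m]
  assume inj: "\<forall>c\<in>Obj C. inj_on (app m c) (sects X c)"
  show "monic S m"
    unfolding monic_def
  proof (intro conjI ballI impI)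
    fix s t assume st: "s \<in> Arr S" "t \<in> Arr S" "Dom S s = Dom S t" "Cod S s = Dom S m" "Cod S t = Dom S m"
      and eq: "m \<odot> s = m \<odot> t"
    define Z where "Z = source s"
    have s: "s \<in> hom S Z X" and t: "t \<in> hom S Z X" using st by (auto simp: hom_def Z_def)
    show "s = t"
    proof (rule hom_eqI[OF s t])
      fix c z assume c: "c \<in> Obj C" "z \<in> sects Z c"
      have "app m c (app s c z) = app m c (app t c z)"
        by (rule comp_app_eqD[OF eq s t c])
      then show "app s c z = app t c z"
        using inj c app_in[OF s c] app_in[OF t c] by (auto dest: inj_onD)
    qed
  qed simp
qed

end

section \<open>Reflective subcategories of presheaves\<close>

lemma hom_full_subcat: "A \<in> E \<Longrightarrow> B \<in> E \<Longrightarrow> hom (full_subcat S E) A B = hom S A B"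
  by (auto simp: hom_def)

locale reflective_presheaves = presheaves C U
  for C :: "('o, 'a) cat" and U :: "'u set set" +
  fixes E :: "('o, 'a, 'u) presheaf set"
    and L :: "(('o, 'a, 'u) presheaf, ('o, 'a, 'u) transf,
               ('o, 'a, 'u) presheaf, ('o, 'a, 'u) transf) fctr"
    and \<eta> :: "('o, 'a, 'u) presheaf \<Rightarrow> ('o, 'a, 'u) transf"
  assumes replete: "replete S E" and reflection: "is_reflection S E L \<eta>"
begin

abbreviation T :: "(('o, 'a, 'u) presheaf, ('o, 'a, 'u) transf) cat" where
  "T \<equiv> full_subcat S E"

abbreviation LO :: "('o, 'a, 'u) presheaf \<Rightarrow> ('o, 'a, 'u) presheaf" where
  "LO \<equiv> onObj L"

abbreviation LA :: "('o, 'a, 'u) transf \<Rightarrow> ('o, 'a, 'u) transf" where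
  "LA \<equiv> onArr L"

lemma E_psh: "A \<in> E \<Longrightarrow> psh A"
  using replete unfolding replete_def by (auto simp: presheaf_cat_sel(1))

lemma E_iso: "A \<in> E \<Longrightarrow> psh B \<Longrightarrow> isomorphic S A B \<Longrightarrow> B \<in> E"
  using replete unfolding replete_def by (auto simp: presheaf_cat_sel(1))

lemma L_functor: "is_functor S T L"
  using reflection unfolding is_reflection_def by (elim conjE)

lemma LO_E: "psh X \<Longrightarrow> LO X \<in> E"
  using L_functor unfolding is_functor_def by (simp add: presheaf_cat_sel(1))

lemma LO_psh: "psh X \<Longrightarrow> psh (LO X)"
  using LO_E E_psh by blast

lemma eta: "psh X \<Longrightarrow> \<eta> X \<in> hom S X (LO X)"
  using reflection unfolding is_reflection_def by (simp add: presheaf_cat_sel(1))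

lemma L_hom:
  assumes "t \<in> hom S X Y"
  shows "LA t \<in> hom S (LO X) (LO Y)"
proof -
  have "\<forall>f\<in>Arr S. LA f \<in> hom T (LO (source f)) (LO (target f))"
    using L_functor unfolding is_functor_def by simp
  then have "LA t \<in> hom T (LO X) (LO Y)" using homD[OF assms] by auto
  then show ?thesis using hom_full_subcat LO_E homD[OF assms] by metis
qed

lemma L_comp:
  assumes s: "s \<in> hom S X Y" and t: "t \<in> hom S Y Z"
  shows "LA (t \<odot> s) = LA t \<odot> LA s"
proof -
  have "\<forall>f\<in>Arr S. \<forall>g\<in>Arr S. source g = target f \<longrightarrow> LA (g \<odot> f) = LA g \<odot> LA f"
    using L_functor unfolding is_functor_def by simp
  then show ?thesis using homD[OF s] homD[OF t] by blast
qed

lemma L_idn: "psh X \<Longrightarrow> LA (Idn S X) = Idn S (LO X)"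
  using L_functor unfolding is_functor_def by (simp add: presheaf_cat_sel(1))

lemma L_eta:
  assumes t: "t \<in> hom S X Y" and c: "c \<in> Obj C" "x \<in> sects X c"
  shows "app (LA t) c (app (\<eta> X) c x) = app (\<eta> Y) c (app t c x)"
proof (rule comp_app_eqD[OF _ eta[OF homD(1)[OF t]] t c])
  have "\<forall>f\<in>Arr S. LA f \<odot> \<eta> (source f) = \<eta> (target f) \<odot> f"
    using reflection unfolding is_reflection_def by simp
  then show "LA t \<odot> \<eta> X = \<eta> Y \<odot> t" using homD[OF t] by metis
qed

lemma reflection_universal:
  assumes f: "f \<in> hom S X A" and A: "A \<in> E"
  shows "\<exists>!g. g \<in> hom S (LO X) A \<and> g \<odot> \<eta> X = f"
proof -
  have "\<forall>X\<in>Obj S. \<forall>A\<in>E. \<forall>f\<in>hom S X A. \<exists>!g. g \<in> hom S (LO X) A \<and> g \<odot> \<eta> X = f"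
    using reflection unfolding is_reflection_def by (elim conjE)
  then show ?thesis using f A homD[OF f] by (simp add: presheaf_cat_sel(1))
qed

lemma reflection_cancel:
  assumes A: "A \<in> E" and X: "psh X" and g: "g \<in> hom S (LO X) A" and h: "h \<in> hom S (LO X) A"
    and eq: "g \<odot> \<eta> X = h \<odot> \<eta> X"
  shows "g = h"
  using reflection_universal[OF comp_hom[OF eta[OF X] h] A] g h eq by blast

lemma extend:
  assumes f: "f \<in> hom S X A" and A: "A \<in> E"
  obtains g where "g \<in> hom S (LO X) A"
    "\<And>c x. c \<in> Obj C \<Longrightarrow> x \<in> sects X c \<Longrightarrow> app g c (app (\<eta> X) c x) = app f c x"
proof -
  obtain g where g: "g \<in> hom S (LO X) A" "g \<odot> \<eta> X = f" using reflection_universal[OF assms] by blast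
  show ?thesis using that[OF g(1)] comp_appD[OF g(2) eta[OF homD(1)[OF f]]] by simp
qed

lemma extend_unique:
  assumes A: "A \<in> E" and X: "psh X" and g: "g \<in> hom S (LO X) A" and h: "h \<in> hom S (LO X) A"
    and eq: "\<And>c x. c \<in> Obj C \<Longrightarrow> x \<in> sects X c \<Longrightarrow> app g c (app (\<eta> X) c x) = app h c (app (\<eta> X) c x)"
  shows "g = h"
  by (rule reflection_cancel[OF A X g h], rule comp_eqI[OF eta[OF X] g comp_hom[OF eta[OF X] h]])
    (simp add: eq homD[OF eta[OF X]])

text \<open>The composite \<open>\<eta> X \<odot> r\<close> agrees with the identity of
  \<open>LO X\<close> after the unit, so it is the identity. Thus \<open>X\<close> is isomorphic to
  \<open>LO X\<close>, and \<open>E\<close> is replete.\<close>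

lemma retract_in_E:
  assumes X: "psh X" and r: "r \<in> hom S (LO X) X"
    and eq: "\<And>c x. c \<in> Obj C \<Longrightarrow> x \<in> sects X c \<Longrightarrow> app r c (app (\<eta> X) c x) = x"
  shows "X \<in> E"
proof -
  note eta = eta[OF X]
  have "\<eta> X \<odot> r = Idn S (LO X)"
    by (rule extend_unique[OF LO_E[OF X] X comp_hom[OF r eta] idn_hom[OF LO_psh[OF X]]])
      (simp add: eq homD[OF r] app_in[OF eta])
  moreover have "r \<odot> \<eta> X = Idn S X"
    by (rule comp_eqI[OF eta r idn_hom[OF X]]) (simp add: eq)
  ultimately have "isomorphic S (LO X) X" unfolding isomorphic_def using r eta by blast
  then show ?thesis using E_iso[OF LO_E[OF X] X] by blast
qed

lemma eta_inverse:
  assumes A: "A \<in> E"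
  obtains r where "r \<in> hom S (LO A) A"
    "\<And>c x. c \<in> Obj C \<Longrightarrow> x \<in> sects A c \<Longrightarrow> app r c (app (\<eta> A) c x) = x"
    "\<And>c x. c \<in> Obj C \<Longrightarrow> x \<in> sects (LO A) c \<Longrightarrow> app (\<eta> A) c (app r c x) = x"
proof -
  note psh = E_psh[OF A]
  note eta = eta[OF psh]
  obtain r where r: "r \<in> hom S (LO A) A"
    and eq: "\<And>c x. c \<in> Obj C \<Longrightarrow> x \<in> sects A c \<Longrightarrow> app r c (app (\<eta> A) c x) = app (Idn S A) c x"
    by (rule extend[OF idn_hom[OF psh] A]) blast
  have eq': "app r c (app (\<eta> A) c x) = x" if "c \<in> Obj C" "x \<in> sects A c" for c x
    using eq that by simp
  have "\<eta> A \<odot> r = Idn S (LO A)"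
    by (rule extend_unique[OF LO_E[OF psh] psh comp_hom[OF r eta] idn_hom[OF LO_psh[OF psh]]])
      (simp add: eq' homD[OF r] app_in[OF eta])
  then have "app (\<eta> A) c (app r c x) = x" if "c \<in> Obj C" "x \<in> sects (LO A) c" for c x
    using comp_appD[OF _ r that, of "\<eta> A"] that by simp
  then show ?thesis using that[OF r eq'] by blast
qed

lemma eta_bij:
  assumes A: "A \<in> E" and c: "c \<in> Obj C"
  shows "bij_betw (app (\<eta> A) c) (sects A c) (sects (LO A) c)"
proof -
  obtain r where r: "r \<in> hom S (LO A) A"
    "\<And>c x. c \<in> Obj C \<Longrightarrow> x \<in> sects A c \<Longrightarrow> app r c (app (\<eta> A) c x) = x"
    "\<And>c x. c \<in> Obj C \<Longrightarrow> x \<in> sects (LO A) c \<Longrightarrow> app (\<eta> A) c (app r c x) = x"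
    by (rule eta_inverse[OF A]) blast
  show ?thesis
    by (rule bij_betw_byWitness[where f' = "app r c"])
      (use r c app_in[OF r(1) c] app_in[OF eta[OF E_psh[OF A]] c] in auto)
qed

lemma eta_inj:
  "A \<in> E \<Longrightarrow> c \<in> Obj C \<Longrightarrow> x \<in> sects A c \<Longrightarrow> y \<in> sects A c \<Longrightarrow> app (\<eta> A) c x = app (\<eta> A) c y \<Longrightarrow> x = y"
  using eta_bij by (meson bij_betw_imp_inj_on inj_onD)

lemma bij_eta_in_E:
  assumes X: "psh X" and bij: "\<And>c. c \<in> Obj C \<Longrightarrow> bij_betw (app (\<eta> X) c) (sects X c) (sects (LO X) c)"
  shows "X \<in> E"
proof -
  obtain r where "r \<in> hom S (LO X) X" "r \<odot> \<eta> X = Idn S X" using cat_inverse[OF eta[OF X] bij] by blast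
  then show ?thesis using retract_in_E[OF X] comp_appD[OF _ eta[OF X]] by simp
qed

text \<open>Naturality of the unit at \<open>\<eta> X\<close> makes both sides agree after
  \<open>\<eta> X\<close>. Consequently \<open>L\<close> sends units to isomorphisms.\<close>

lemma L_eta_eq:
  assumes X: "psh X"
  shows "LA (\<eta> X) = \<eta> (LO X)"
  by (rule extend_unique[OF LO_E[OF LO_psh[OF X]] X L_hom[OF eta[OF X]] eta[OF LO_psh[OF X]]])
    (rule L_eta[OF eta[OF X]])

text \<open>A cone in presheaves with vertex \<open>Z\<close> extends uniquely along the unit to a
  cone with vertex \<open>LO Z\<close>, because its legs end in \<open>E\<close>. There the
  universal property inside \<open>E\<close> applies, and restricting along the unit gives the lift
  for \<open>Z\<close>. The same extension argument handles monomorphisms and products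
  below.\<close>

lemma pullback_T_iff:
  assumes f: "f \<in> hom S X B" and g: "g \<in> hom S Y B" and p: "p \<in> hom S P X" and q: "q \<in> hom S P Y"
    and E: "X \<in> E" "Y \<in> E" "B \<in> E" "P \<in> E"
  shows "is_pullback T f g p q \<longleftrightarrow> is_pullback S f g p q"
proof
  note [simp] = homD[OF f] homD[OF g] homD[OF p] homD[OF q] E
  assume pb: "is_pullback S f g p q"
  show "is_pullback T f g p q"
    unfolding is_pullback_def
  proof (intro conjI ballI impI)
    fix s t assume "s \<in> Arr T" "t \<in> Arr T" "Dom T s = Dom T t" "Cod T s = Dom T f" "Cod T t = Dom T g"
      and eq: "Cmp T f s = Cmp T g t"
    then have st: "s \<in> hom S (source s) X" "t \<in> hom S (source s) Y" "source s \<in> E" by (auto simp: hom_def)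
    then show "\<exists>!u. u \<in> hom T (Dom T s) (Dom T p) \<and> Cmp T p u = s \<and> Cmp T q u = t"
      using pullback_universal[OF pb f g p q st(1,2)] eq by (simp add: hom_full_subcat)
  qed (use pb in \<open>auto simp: is_pullback_def\<close>)
next
  note [simp] = homD[OF f] homD[OF g] homD[OF p] homD[OF q] E
  assume pb: "is_pullback T f g p q"
  have sq: "f \<odot> p = g \<odot> q" using pb unfolding is_pullback_def by simp
  have T: "\<exists>!u. u \<in> hom S Z P \<and> p \<odot> u = s \<and> q \<odot> u = t"
    if s: "s \<in> hom S Z X" and t: "t \<in> hom S Z Y" and eq: "f \<odot> s = g \<odot> t" and Z: "Z \<in> E" for s t Z
  proof -
    have *: "\<forall>s\<in>Arr T. \<forall>t\<in>Arr T. Dom T s = Dom T t \<longrightarrow> Cod T s = Dom T f \<longrightarrow> Cod T t = Dom T g \<longrightarrow>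
      Cmp T f s = Cmp T g t \<longrightarrow> (\<exists>!u. u \<in> hom T (Dom T s) (Dom T p) \<and> Cmp T p u = s \<and> Cmp T q u = t)"
      using pb unfolding is_pullback_def by (elim conjE)
    show ?thesis using *[rule_format, of s t] homD[OF s] homD[OF t] eq Z by (simp add: hom_full_subcat)
  qed
  show "is_pullback S f g p q"
    unfolding is_pullback_def
  proof (intro conjI ballI impI)
    fix s t assume st: "s \<in> Arr S" "t \<in> Arr S" "Dom S s = Dom S t" "Cod S s = Dom S f" "Cod S t = Dom S g"
      and eq: "f \<odot> s = g \<odot> t"
    define Z where "Z = source s"
    have s: "s \<in> hom S Z X" and t: "t \<in> hom S Z Y" using st by (auto simp: hom_def Z_def)
    have Z: "psh Z" using homD(1)[OF s] .
    note \<eta>Z = eta[OF Z]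
    obtain s' where s': "s' \<in> hom S (LO Z) X" "s' \<odot> \<eta> Z = s" using reflection_universal[OF s E(1)] by blast
    obtain t' where t': "t' \<in> hom S (LO Z) Y" "t' \<odot> \<eta> Z = t" using reflection_universal[OF t E(2)] by blast
    have "f \<odot> s' = g \<odot> t'"
      by (rule reflection_cancel[OF E(3) Z comp_hom[OF s'(1) f] comp_hom[OF t'(1) g]])
        (simp add: comp_assoc[OF \<eta>Z s'(1) f] comp_assoc[OF \<eta>Z t'(1) g] s'(2) t'(2) eq)
    then have ex1: "\<exists>!u. u \<in> hom S (LO Z) P \<and> p \<odot> u = s' \<and> q \<odot> u = t'"
      using T[OF s'(1) t'(1)] LO_E[OF Z] by blast
    then obtain u where u: "u \<in> hom S (LO Z) P" "p \<odot> u = s'" "q \<odot> u = t'" by blast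
    have "p \<odot> (u \<odot> \<eta> Z) = s" "q \<odot> (u \<odot> \<eta> Z) = t"
      using comp_assoc[OF \<eta>Z u(1) p] comp_assoc[OF \<eta>Z u(1) q] u s' t' by simp_all
    moreover have "v = u \<odot> \<eta> Z" if v: "v \<in> hom S Z P" "p \<odot> v = s" "q \<odot> v = t" for v
    proof -
      obtain w where w: "w \<in> hom S (LO Z) P" "w \<odot> \<eta> Z = v" using reflection_universal[OF v(1) E(4)] by blast
      have "p \<odot> w = s'"
        by (rule reflection_cancel[OF E(1) Z comp_hom[OF w(1) p] s'(1)])
          (simp add: comp_assoc[OF \<eta>Z w(1) p] w(2) v(2) s'(2))
      moreover have "q \<odot> w = t'"
        by (rule reflection_cancel[OF E(2) Z comp_hom[OF w(1) q] t'(1)])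
          (simp add: comp_assoc[OF \<eta>Z w(1) q] w(2) v(3) t'(2))
      ultimately show ?thesis using ex1 u w by blast
    qed
    ultimately have "\<exists>!u. u \<in> hom S Z P \<and> p \<odot> u = s \<and> q \<odot> u = t"
      using comp_hom[OF eta[OF Z] u(1)] by blast
    then show "\<exists>!u. u \<in> hom S (Dom S s) (Dom S p) \<and> p \<odot> u = s \<and> q \<odot> u = t"
      by (simp add: Z_def)
  qed (simp_all add: sq)
qed

lemma monic_T_iff:
  assumes m: "m \<in> hom S X Y" and E: "X \<in> E" "Y \<in> E"
  shows "monic T m \<longleftrightarrow> (\<forall>c\<in>Obj C. inj_on (app m c) (sects X c))"
proof
  note [simp] = homD[OF m] E
  assume "\<forall>c\<in>Obj C. inj_on (app m c) (sects X c)"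
  then have "monic S m" using monic_iff[OF m] by blast
  then show "monic T m" unfolding monic_def by auto
next
  note [simp] = homD[OF m] E
  assume mono: "monic T m"
  have "monic S m"
    unfolding monic_def
  proof (intro conjI ballI impI)
    fix s t assume st: "s \<in> Arr S" "t \<in> Arr S" "Dom S s = Dom S t" "Cod S s = Dom S m" "Cod S t = Dom S m"
      and eq: "m \<odot> s = m \<odot> t"
    define Z where "Z = source s"
    have s: "s \<in> hom S Z X" and t: "t \<in> hom S Z X" using st by (auto simp: hom_def Z_def)
    have Z: "psh Z" using homD(1)[OF s] .
    obtain s' where s': "s' \<in> hom S (LO Z) X" "s' \<odot> \<eta> Z = s" using reflection_universal[OF s E(1)] by blast
    obtain t' where t': "t' \<in> hom S (LO Z) X" "t' \<odot> \<eta> Z = t" using reflection_universal[OF t E(1)] by blast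
    have "m \<odot> s' = m \<odot> t'"
      by (rule reflection_cancel[OF E(2) Z comp_hom[OF s'(1) m] comp_hom[OF t'(1) m]])
        (simp add: comp_assoc[OF eta[OF Z] s'(1) m] comp_assoc[OF eta[OF Z] t'(1) m] s'(2) t'(2) eq)
    then have "s' = t'"
      using mono homD[OF s'(1)] homD[OF t'(1)] LO_E[OF Z] unfolding monic_def by simp
    then show "s = t" using s' t' by simp
  qed simp
  then show "\<forall>c\<in>Obj C. inj_on (app m c) (sects X c)" using monic_iff[OF m] by blast
qed

lemma product_T_iff:
  assumes X: "\<And>i. i \<in> I \<Longrightarrow> X i \<in> E" and p: "\<And>i. i \<in> I \<Longrightarrow> p i \<in> hom S P (X i)" and P: "P \<in> E"
  shows "is_product T I X P p \<longleftrightarrow> is_product S I X P p"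
proof
  assume prod: "is_product S I X P p"
  have *: "\<exists>!u. u \<in> hom S Q P \<and> (\<forall>i\<in>I. p i \<odot> u = q i)" if "psh Q" "\<forall>i\<in>I. q i \<in> hom S Q (X i)" for Q q
    using prod that unfolding is_product_def presheaf_cat_sel(1) mem_Collect_eq by (elim conjE) (drule bspec[of _ _ Q], auto)
  show "is_product T I X P p"
    unfolding is_product_def
  proof (intro conjI ballI allI impI)
    fix Q q assume Q: "Q \<in> Obj T" and "\<forall>i\<in>I. q i \<in> hom T Q (X i)"
    then have "\<forall>i\<in>I. q i \<in> hom S Q (X i)" using X by (simp add: hom_full_subcat)
    then show "\<exists>!u. u \<in> hom T Q P \<and> (\<forall>i\<in>I. Cmp T (p i) u = q i)"
      using *[of Q q] E_psh[of Q] Q P by (simp add: hom_full_subcat)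
  qed (use X p P in \<open>simp_all add: hom_full_subcat\<close>)
next
  assume prod: "is_product T I X P p"
  have T: "\<exists>!u. u \<in> hom S Q P \<and> (\<forall>i\<in>I. p i \<odot> u = q i)" if "Q \<in> E" "\<forall>i\<in>I. q i \<in> hom S Q (X i)" for Q q
  proof -
    have "\<forall>Q\<in>Obj T. \<forall>q. (\<forall>i\<in>I. q i \<in> hom T Q (X i)) \<longrightarrow> (\<exists>!u. u \<in> hom T Q P \<and> (\<forall>i\<in>I. Cmp T (p i) u = q i))"
      using prod unfolding is_product_def by (elim conjE)
    from this[rule_format, of Q q] show ?thesis using that X P by (simp add: hom_full_subcat)
  qed
  show "is_product S I X P p"
    unfolding is_product_def
  proof (intro conjI ballI allI impI)
    fix Z s assume "Z \<in> Obj S" and s: "\<forall>i\<in>I. s i \<in> hom S Z (X i)"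
    then have Z: "psh Z" by (simp add: presheaf_cat_sel(1))
    have "\<forall>i\<in>I. \<exists>s'. s' \<in> hom S (LO Z) (X i) \<and> s' \<odot> \<eta> Z = s i"
      using reflection_universal[OF bspec[OF s] X] by blast
    then obtain s' where s': "\<And>i. i \<in> I \<Longrightarrow> s' i \<in> hom S (LO Z) (X i)" "\<And>i. i \<in> I \<Longrightarrow> s' i \<odot> \<eta> Z = s i" by metis
    have ex1: "\<exists>!u. u \<in> hom S (LO Z) P \<and> (\<forall>i\<in>I. p i \<odot> u = s' i)"
      using T[OF LO_E[OF Z]] s' by blast
    then obtain u where u: "u \<in> hom S (LO Z) P" "\<And>i. i \<in> I \<Longrightarrow> p i \<odot> u = s' i" by blast
    have 1: "\<forall>i\<in>I. p i \<odot> (u \<odot> \<eta> Z) = s i"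
      using comp_assoc[OF eta[OF Z] u(1) p] u(2) s'(2) by simp
    have 2: "v = u \<odot> \<eta> Z" if v: "v \<in> hom S Z P" "\<forall>i\<in>I. p i \<odot> v = s i" for v
    proof -
      obtain w where w: "w \<in> hom S (LO Z) P" "w \<odot> \<eta> Z = v"
        using reflection_universal[OF v(1) P] by blast
      have "p i \<odot> w = s' i" if i: "i \<in> I" for i
      proof -
        have "(p i \<odot> w) \<odot> \<eta> Z = s i" using comp_assoc[OF eta[OF Z] w(1) p[OF i]] w(2) v(2) i by simp
        then show ?thesis
          using reflection_universal[OF bspec[OF s i] X[OF i]] s'[OF i] comp_hom[OF w(1) p[OF i]] by blast
      qed
      then have "w = u" using ex1 u w(1) by blast
      then show ?thesis using w by simp
    qed
    show "\<exists>!u. u \<in> hom S Z P \<and> (\<forall>i\<in>I. p i \<odot> u = s i)"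
    proof (rule ex1I)
      show "u \<odot> \<eta> Z \<in> hom S Z P \<and> (\<forall>i\<in>I. p i \<odot> (u \<odot> \<eta> Z) = s i)"
        using 1 comp_hom[OF eta[OF Z] u(1)] by (rule conjI[rotated])
    qed (use 2 in blast)
  qed (simp_all add: X p P E_psh presheaf_cat_sel(1))
qed

lemma stable_units_pullback:
  assumes su: "has_stable_units S E L" and pb: "is_pullback S f g p q"
    and f: "f \<in> hom S X B" and g: "g \<in> hom S Y B" and p: "p \<in> hom S P X" and q: "q \<in> hom S P Y"
    and B: "B \<in> E"
  shows "is_pullback S (LA f) (LA g) (LA p) (LA q)"
proof -
  have "is_pullback T (LA f) (LA g) (LA p) (LA q)"
    using su[unfolded has_stable_units_def preserves_pullback_of_def, rule_format, of B f g p q]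
      pb B homD[OF f] homD[OF g] by simp
  then show ?thesis
    using pullback_T_iff[OF L_hom[OF f] L_hom[OF g] L_hom[OF p] L_hom[OF q]]
      LO_E homD(1)[OF f] homD(2)[OF f] homD(1)[OF g] homD(1)[OF p] by simp
qed

lemma semi_left_exact_pullback:
  assumes sle: "semi_left_exact S E L \<eta>" and pb: "is_pullback S u (\<eta> X) p q"
    and u: "u \<in> hom S A (LO X)" and A: "A \<in> E" and X: "psh X"
    and p: "p \<in> hom S P A" and q: "q \<in> hom S P X"
  shows "is_pullback S (LA u) (LA (\<eta> X)) (LA p) (LA q)"
proof -
  have "is_pullback T (LA u) (LA (\<eta> X)) (LA p) (LA q)"
    using sle[unfolded semi_left_exact_def preserves_pullback_of_def, rule_format, of X A u p q]
      pb A X u by (simp add: presheaf_cat_sel(1))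
  then show ?thesis
    using pullback_T_iff[OF L_hom[OF u] L_hom[OF eta[OF X]] L_hom[OF p] L_hom[OF q]]
      LO_E LO_psh homD(1)[OF u] homD(1)[OF p] X A by simp
qed

lemma L_mono:
  assumes pm: "preserves_monos S T L" and m: "m \<in> hom S X Y"
    and inj: "\<And>c. c \<in> Obj C \<Longrightarrow> inj_on (app m c) (sects X c)"
    and c: "c \<in> Obj C"
  shows "inj_on (app (LA m) c) (sects (LO X) c)"
proof -
  have "monic T (LA m)" using pm monic_iff[OF m] inj unfolding preserves_monos_def by blast
  then show ?thesis
    using monic_T_iff[OF L_hom[OF m]] LO_E homD(1,2)[OF m] c by blast
qed

section \<open>Stable units and finite products\<close>

lemma product_hom:
  assumes "is_product S I X P p"
  shows "psh P" "i \<in> I \<Longrightarrow> psh (X i)" "i \<in> I \<Longrightarrow> p i \<in> hom S P (X i)"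
  using assms unfolding is_product_def presheaf_cat_sel(1) by simp_all

lemma productD:
  assumes prod: "is_product S I X P p" and c: "c \<in> Obj C"
  shows "(\<And>i. i \<in> I \<Longrightarrow> x i \<in> sects (X i) c) \<Longrightarrow> \<exists>w\<in>sects P c. \<forall>i\<in>I. app (p i) c w = x i"
    and "w \<in> sects P c \<Longrightarrow> w' \<in> sects P c \<Longrightarrow> (\<And>i. i \<in> I \<Longrightarrow> app (p i) c w = app (p i) c w') \<Longrightarrow> w = w'"
proof -
  note P = product_hom(1)[OF prod] and X = product_hom(2)[OF prod] and p = product_hom(3)[OF prod]
  have *: "\<exists>!w. w \<in> sects P c \<and> (\<forall>i\<in>I. app (p i) c w = x i)" if "\<forall>i\<in>I. x i \<in> sects (X i) c" for x
    using product_iff[of I X p P, OF X p P] prod c that by simp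
  then show "(\<And>i. i \<in> I \<Longrightarrow> x i \<in> sects (X i) c) \<Longrightarrow> \<exists>w\<in>sects P c. \<forall>i\<in>I. app (p i) c w = x i" by blast
  assume w: "w \<in> sects P c" "w' \<in> sects P c" "\<And>i. i \<in> I \<Longrightarrow> app (p i) c w = app (p i) c w'"
  have "\<forall>i\<in>I. app (p i) c w \<in> sects (X i) c" using app_in[OF p c w(1)] by blast
  from *[OF this] show "w = w'" using w by metis
qed

lemma productI:
  assumes X: "\<And>i. i \<in> I \<Longrightarrow> psh (X i)" and p: "\<And>i. i \<in> I \<Longrightarrow> p i \<in> hom S P (X i)" and P: "psh P"
    and ex: "\<And>c x. c \<in> Obj C \<Longrightarrow> (\<And>i. i \<in> I \<Longrightarrow> x i \<in> sects (X i) c)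
      \<Longrightarrow> \<exists>w\<in>sects P c. \<forall>i\<in>I. app (p i) c w = x i"
    and uniq: "\<And>c w w'. c \<in> Obj C \<Longrightarrow> w \<in> sects P c \<Longrightarrow> w' \<in> sects P c
      \<Longrightarrow> (\<And>i. i \<in> I \<Longrightarrow> app (p i) c w = app (p i) c w') \<Longrightarrow> w = w'"
  shows "is_product S I X P p"
proof (rule product_iff[of I X p P, OF X p P, THEN iffD2], assumption, assumption, intro ballI allI impI)
  fix c x assume c: "c \<in> Obj C" and x: "\<forall>i\<in>I. x i \<in> sects (X i) c"
  obtain w where w: "w \<in> sects P c" "\<forall>i\<in>I. app (p i) c w = x i" using ex[OF c] x by blast
  show "\<exists>!w. w \<in> sects P c \<and> (\<forall>i\<in>I. app (p i) c w = x i)"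
  proof (rule ex1I)
    fix w' assume "w' \<in> sects P c \<and> (\<forall>i\<in>I. app (p i) c w' = x i)"
    then show "w' = w" using uniq[OF c, of w' w] w by simp
  qed (use w in simp)
qed

lemma finite_product_exists:
  assumes "finite I" "\<And>i. i \<in> I \<Longrightarrow> psh (X i)"
  shows "\<exists>P p. is_product S I X P p"
  using assms
proof (induction I rule: finite_induct)
  case empty
  obtain T a where T: "psh T" "\<And>c. c \<in> Obj C \<Longrightarrow> sects T c = {a c}" using terminal_exists by metis
  have "is_product S {} X T p" for p by (rule productI) (use T in auto)
  then show ?case by blast
next
  case (insert i I)
  then obtain Q q where Q: "is_product S I X Q q" by blast
  note Q' = product_hom(1)[OF Q] and q = product_hom(3)[OF Q]
  obtain P s t where s: "s \<in> hom S P Q" and t: "t \<in> hom S P (X i)"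
    and ex: "\<And>c x y. c \<in> Obj C \<Longrightarrow> x \<in> sects Q c \<Longrightarrow> y \<in> sects (X i) c \<Longrightarrow> \<exists>w\<in>sects P c. app s c w = x \<and> app t c w = y"
    and uniq: "\<And>c w w'. c \<in> Obj C \<Longrightarrow> w \<in> sects P c \<Longrightarrow> w' \<in> sects P c \<Longrightarrow> app s c w = app s c w'
      \<Longrightarrow> app t c w = app t c w' \<Longrightarrow> w = w'"
    by (rule product_exists[OF Q' insert.prems[of i]]) blast+
  have st: "app (q j \<odot> s) c w = app (q j) c (app s c w)" if "c \<in> Obj C" "w \<in> sects P c" for j c w
    using that homD[OF s] by simp
  have "is_product S (insert i I) X P (\<lambda>j. if j = i then t else q j \<odot> s)"
  proof (rule productI)
    fix c x assume c: "c \<in> Obj C" and x: "\<And>j. j \<in> insert i I \<Longrightarrow> x j \<in> sects (X j) c"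
    obtain v where v: "v \<in> sects Q c" "\<forall>j\<in>I. app (q j) c v = x j"
      using productD(1)[OF Q c, of x] x by auto
    obtain w where w: "w \<in> sects P c" "app s c w = v" "app t c w = x i" using ex[OF c v(1) x[of i]] by auto
    then show "\<exists>w\<in>sects P c. \<forall>j\<in>insert i I. app (if j = i then t else q j \<odot> s) c w = x j"
      using v st[OF c w(1)] by (intro bexI[OF _ w(1)]) auto
  next
    fix c w w' assume c: "c \<in> Obj C" and w: "w \<in> sects P c" "w' \<in> sects P c"
      and eq: "\<And>j. j \<in> insert i I \<Longrightarrow> app (if j = i then t else q j \<odot> s) c w = app (if j = i then t else q j \<odot> s) c w'"
    have "app (q j) c (app s c w) = app (q j) c (app s c w')" if "j \<in> I" for j
      using eq[of j] that insert.hyps st[OF c w(1)] st[OF c w(2)] by (auto split: if_splits)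
    then have "app s c w = app s c w'"
      using productD(2)[OF Q c] app_in[OF s c] w by blast
    then show "w = w'" using uniq[OF c w] eq[of i] by simp
  qed (use insert.prems s t q in \<open>auto intro: homD(1)\<close>)
  then show ?case by blast
qed

end

context reflective_presheaves
begin

text \<open>Any map from \<open>LO X\<close> to \<open>X\<close> is a retraction of the unit, since
  \<open>X\<close> has only one section over each object.\<close>

lemma terminal_in_E:
  assumes X: "psh X" and a: "\<And>c. c \<in> Obj C \<Longrightarrow> sects X c = {a c}"
  shows "X \<in> E"
proof -
  obtain r where r: "r \<in> hom S (LO X) X" using terminal_map[OF LO_psh[OF X] X a] .
  show ?thesis
  proof (rule retract_in_E[OF X r])
    fix c x assume "c \<in> Obj C" "x \<in> sects X c"
    then show "app r c (app (\<eta> X) c x) = x"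
      using app_in[OF r, of c "app (\<eta> X) c x"] app_in[OF eta[OF X]] a by simp
  qed
qed

text \<open>A product over \<open>insert i I\<close> is the pullback, over the terminal presheaf, of
  a product \<open>Q\<close> over \<open>I\<close> and of \<open>X i\<close>. The induction
  hypothesis turns \<open>LO Q\<close> into the smaller product, and stable units handle the
  pullback. The reflection of the terminal presheaf still has one section over each object, so the
  pullback over it is again a product.\<close>

lemma L_product:
  assumes su: "has_stable_units S E L"
  shows "finite I \<Longrightarrow> is_product S I X P p \<Longrightarrow> is_product S I (\<lambda>i. LO (X i)) (LO P) (\<lambda>i. LA (p i))"
proof (induction I arbitrary: P p rule: finite_induct)
  case empty
  note P = product_hom(1)[OF empty]
  have "\<exists>a. sects P c = {a}" if c: "c \<in> Obj C" for c
    using productD[OF empty(1) c] by force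
  then obtain a where a: "\<And>c. c \<in> Obj C \<Longrightarrow> sects P c = {a c}" by metis
  have "sects (LO P) c = {app (\<eta> P) c (a c)}" if c: "c \<in> Obj C" for c
    using eta_bij[OF terminal_in_E[OF P a] c] a[OF c] by (simp add: bij_betw_def)
  then show ?case by (intro productI) (auto simp: LO_psh[OF P])
next
  case (insert i I)
  note P = product_hom(1)[OF insert.prems] and X = product_hom(2)[OF insert.prems]
    and p = product_hom(3)[OF insert.prems]
  obtain Q q where Q: "is_product S I X Q q" using finite_product_exists[of I X] insert.hyps X by auto
  note Q' = product_hom(1)[OF Q] and q = product_hom(3)[OF Q]
  have IH: "is_product S I (\<lambda>i. LO (X i)) (LO Q) (\<lambda>i. LA (q i))" using insert.IH[OF Q] .
  have "\<forall>Z\<in>Obj S. \<forall>s. (\<forall>i\<in>I. s i \<in> hom S Z (X i)) \<longrightarrow> (\<exists>!u. u \<in> hom S Z Q \<and> (\<forall>i\<in>I. q i \<odot> u = s i))"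
    using Q unfolding is_product_def by (elim conjE)
  from this[rule_format, of P p] obtain u where u: "u \<in> hom S P Q" "\<forall>j\<in>I. q j \<odot> u = p j"
    using P p by (auto simp: presheaf_cat_sel(1))
  have qu: "app (q j) c (app u c w) = app (p j) c w" if "j \<in> I" "c \<in> Obj C" "w \<in> sects P c" for j c w
    by (rule comp_appD[OF bspec[OF u(2) that(1)] u(1) that(2,3)])
  have Lqu: "app (LA (q j)) c (app (LA u) c w) = app (LA (p j)) c w"
    if j: "j \<in> I" and c: "c \<in> Obj C" and w: "w \<in> sects (LO P) c" for j c w
    by (rule comp_appD[OF _ L_hom[OF u(1)] c w]) (use L_comp[OF u(1) q[OF j]] u(2) j in simp)
  obtain T a where T: "psh T" "\<And>c. c \<in> Obj C \<Longrightarrow> sects T c = {a c}" using terminal_exists by metis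
  obtain f where f: "f \<in> hom S Q T" using terminal_map[OF Q' T] .
  obtain g where g: "g \<in> hom S (X i) T" using terminal_map[OF X[of i] T] by auto
  have T_sub: "x = y" if "c \<in> Obj C" "x \<in> sects T c" "y \<in> sects T c" for c x y using T that by simp
  have pi: "p i \<in> hom S P (X i)" using p by simp
  have "is_pullback S f g u (p i)"
  proof (rule pullbackI[OF f g u(1) pi])
    fix c w assume "c \<in> Obj C" "w \<in> sects P c"
    then show "app f c (app u c w) = app g c (app (p i) c w)"
      by (intro T_sub[of c] app_in[OF f] app_in[OF g] app_in[OF u(1)] app_in[OF pi])
  next
    fix c x y assume c: "c \<in> Obj C" and x: "x \<in> sects Q c" and y: "y \<in> sects (X i) c"
    obtain w where w: "w \<in> sects P c" "\<forall>j\<in>insert i I. app (p j) c w = (if j = i then y else app (q j) c x)"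
    proof -
      have "(if j = i then y else app (q j) c x) \<in> sects (X j) c" if "j \<in> insert i I" for j
        using that y app_in[OF q c x] by auto
      then have "\<exists>w\<in>sects P c. \<forall>j\<in>insert i I. app (p j) c w = (if j = i then y else app (q j) c x)"
        by (rule productD(1)[OF insert.prems c])
      then show ?thesis using that by (elim bexE)
    qed
    have "app u c w = x"
    proof (rule productD(2)[OF Q c app_in[OF u(1) c w(1)] x])
      fix j assume "j \<in> I"
      then show "app (q j) c (app u c w) = app (q j) c x"
        using qu[OF _ c w(1)] w(2) insert.hyps by auto
    qed
    then show "\<exists>w\<in>sects P c. app u c w = x \<and> app (p i) c w = y" using w by auto
  next
    fix c w w' assume c: "c \<in> Obj C" and w: "w \<in> sects P c" "w' \<in> sects P c"
      and eq: "app u c w = app u c w'" "app (p i) c w = app (p i) c w'"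
    show "w = w'"
    proof (rule productD(2)[OF insert.prems c w])
      fix j assume "j \<in> insert i I"
      then show "app (p j) c w = app (p j) c w'" using qu[OF _ c w(1)] qu[OF _ c w(2)] eq by (metis insertE)
    qed
  qed
  then have pb: "is_pullback S (LA f) (LA g) (LA u) (LA (p i))"
    using stable_units_pullback[OF su _ f g u(1) pi terminal_in_E[OF T]] by blast
  note pbD = pullbackD[OF pb L_hom[OF f] L_hom[OF g] L_hom[OF u(1)] L_hom[OF pi]]
  have LT_sub: "x = y" if c: "c \<in> Obj C" and xy: "x \<in> sects (LO T) c" "y \<in> sects (LO T) c" for c x y
    using eta_bij[OF terminal_in_E[OF T] c] T(2)[OF c] xy by (simp add: bij_betw_def) (metis singletonD)
  show ?case
  proof (rule productI)
    fix c x assume c: "c \<in> Obj C" and x: "\<And>j. j \<in> insert i I \<Longrightarrow> x j \<in> sects (LO (X j)) c"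
    obtain v where v: "v \<in> sects (LO Q) c" "\<forall>j\<in>I. app (LA (q j)) c v = x j"
      using productD(1)[OF IH c, of x] x by auto
    have xi: "x i \<in> sects (LO (X i)) c" using x by simp
    obtain w where w: "w \<in> sects (LO P) c" "app (LA u) c w = v" "app (LA (p i)) c w = x i"
      using pbD(2)[OF c v(1) xi] LT_sub[OF c] app_in[OF L_hom[OF f] c v(1)] app_in[OF L_hom[OF g] c xi] by blast
    then show "\<exists>w\<in>sects (LO P) c. \<forall>j\<in>insert i I. app (LA (p j)) c w = x j"
      using v Lqu[OF _ c w(1)] by (intro bexI[OF _ w(1)]) auto
  next
    fix c w w' assume c: "c \<in> Obj C" and w: "w \<in> sects (LO P) c" "w' \<in> sects (LO P) c"
      and eq: "\<And>j. j \<in> insert i I \<Longrightarrow> app (LA (p j)) c w = app (LA (p j)) c w'"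
    have "app (LA u) c w = app (LA u) c w'"
      by (rule productD(2)[OF IH c app_in[OF L_hom[OF u(1)] c w(1)] app_in[OF L_hom[OF u(1)] c w(2)]])
        (use Lqu[OF _ c w(1)] Lqu[OF _ c w(2)] eq in simp)
    then show "w = w'" using pbD(3)[OF c w] eq[of i] by simp
  qed (use X p P in \<open>auto intro: LO_psh L_hom\<close>)
qed

lemma stable_units_preserves_products:
  assumes "has_stable_units S E L"
  shows "preserves_finite_products S T L"
  unfolding preserves_finite_products_def
proof (intro allI impI)
  fix I :: "nat set" and X P p assume I: "finite I" and prod: "is_product S I X P p"
  show "is_product T I (\<lambda>i. LO (X i)) (LO P) (\<lambda>i. LA (p i))"
    using L_product[OF assms I prod] product_T_iff[of I "\<lambda>i. LO (X i)" "\<lambda>i. LA (p i)" "LO P"]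
      product_hom[OF prod] LO_E L_hom by simp
qed

lemma stable_units_semi_left_exact:
  assumes "has_stable_units S E L"
  shows "semi_left_exact S E L \<eta>"
  unfolding semi_left_exact_def
proof (intro ballI)
  fix X A u assume X: "X \<in> Obj S" and u: "u \<in> hom S A (LO X)"
  then have "psh X" by (simp add: presheaf_cat_sel(1))
  then show "preserves_pullback_of S T L u (\<eta> X)"
    using assms[unfolded has_stable_units_def, rule_format, of "LO X" u "\<eta> X"]
      homD[OF u] homD[OF eta[of X]] LO_E[of X] by simp
qed

lemma L_binary_product:
  assumes pfp: "preserves_finite_products S T L"
    and p: "p \<in> hom S P X" and q: "q \<in> hom S P Y"
    and ex: "\<And>c x y. c \<in> Obj C \<Longrightarrow> x \<in> sects X c \<Longrightarrow> y \<in> sects Y c \<Longrightarrow> \<exists>w\<in>sects P c. app p c w = x \<and> app q c w = y"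
    and uniq: "\<And>c w w'. c \<in> Obj C \<Longrightarrow> w \<in> sects P c \<Longrightarrow> w' \<in> sects P c \<Longrightarrow> app p c w = app p c w'
      \<Longrightarrow> app q c w = app q c w' \<Longrightarrow> w = w'"
    and c: "c \<in> Obj C"
  shows "x \<in> sects (LO X) c \<Longrightarrow> y \<in> sects (LO Y) c \<Longrightarrow> \<exists>w\<in>sects (LO P) c. app (LA p) c w = x \<and> app (LA q) c w = y"
    and "w \<in> sects (LO P) c \<Longrightarrow> w' \<in> sects (LO P) c \<Longrightarrow> app (LA p) c w = app (LA p) c w'
      \<Longrightarrow> app (LA q) c w = app (LA q) c w' \<Longrightarrow> w = w'"
proof -
  define XX where "XX i = (if i = (0::nat) then X else Y)" for i
  define pp where "pp i = (if i = (0::nat) then p else q)" for i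
  have psh: "psh X" "psh Y" "psh P" using homD[OF p] homD[OF q] by auto
  have "is_product S {0, 1} XX P pp"
  proof (rule productI)
    fix c x assume c: "c \<in> Obj C" and "\<And>i. i \<in> {0, 1} \<Longrightarrow> x i \<in> sects (XX i) c"
    from this(2)[of 0] this(2)[of 1] have "x 0 \<in> sects X c" "x 1 \<in> sects Y c" by (auto simp: XX_def)
    then show "\<exists>w\<in>sects P c. \<forall>i\<in>{0, 1}. app (pp i) c w = x i" using ex[OF c] by (simp add: pp_def)
  next
    fix c w w' assume c: "c \<in> Obj C" and w: "w \<in> sects P c" "w' \<in> sects P c"
      and eq: "\<And>i. i \<in> {0, 1} \<Longrightarrow> app (pp i) c w = app (pp i) c w'"
    show "w = w'" using uniq[OF c w] eq[of 0] eq[of 1] by (simp add: pp_def)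
  qed (use psh p q in \<open>auto simp: XX_def pp_def\<close>)
  then have "is_product T {0, 1} (\<lambda>i. LO (XX i)) (LO P) (\<lambda>i. LA (pp i))"
    using pfp[unfolded preserves_finite_products_def, rule_format, of "{0, 1}" XX P pp] by simp
  then have *: "is_product S {0, 1} (\<lambda>i. LO (XX i)) (LO P) (\<lambda>i. LA (pp i))"
    by (subst (asm) product_T_iff) (use psh p q in \<open>auto simp: XX_def pp_def intro: LO_E L_hom\<close>)
  show "x \<in> sects (LO X) c \<Longrightarrow> y \<in> sects (LO Y) c \<Longrightarrow> \<exists>w\<in>sects (LO P) c. app (LA p) c w = x \<and> app (LA q) c w = y"
    using productD(1)[OF * c, of "\<lambda>i. if i = 0 then x else y"] by (simp add: XX_def pp_def)
  show "w \<in> sects (LO P) c \<Longrightarrow> w' \<in> sects (LO P) c \<Longrightarrow> app (LA p) c w = app (LA p) c w'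
      \<Longrightarrow> app (LA q) c w = app (LA q) c w' \<Longrightarrow> w = w'"
    using productD(2)[OF * c, of w w'] by (simp add: pp_def)
qed

text \<open>Both sides agree on the image of the unit. As \<open>\<eta> B\<close> is invertible, an
  equation between values of \<open>LA f\<close> can thus be tested in \<open>B\<close> itself,
  through the extension \<open>f'\<close>.\<close>

lemma L_factor:
  assumes f: "f \<in> hom S X B" and B: "B \<in> E" and f': "f' \<in> hom S (LO X) B"
    and eq: "\<And>c x. c \<in> Obj C \<Longrightarrow> x \<in> sects X c \<Longrightarrow> app f' c (app (\<eta> X) c x) = app f c x"
    and x: "c \<in> Obj C" "x \<in> sects (LO X) c"
  shows "app (LA f) c x = app (\<eta> B) c (app f' c x)"
proof -
  note etaX = eta[OF homD(1)[OF f]] and etaB = eta[OF homD(2)[OF f]]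
  have "LA f = \<eta> B \<odot> f'"
    by (rule extend_unique[OF LO_E homD(1)[OF f] L_hom[OF f] comp_hom[OF f' etaB]])
      (simp_all add: homD[OF f] homD[OF f'] L_eta[OF f] eq app_in[OF etaX])
  then show ?thesis using x by (simp add: homD[OF f'])
qed

text \<open>On objects of \<open>E\<close> the units are isomorphisms, so \<open>LA u\<close> is a
  conjugate of \<open>u\<close>.\<close>

lemma LA_inj_on_E:
  assumes u: "u \<in> hom S A B" and E: "A \<in> E" "B \<in> E" and c: "c \<in> Obj C" and inj: "inj_on (app u c) (sects A c)"
    and a: "a \<in> sects (LO A) c" "a' \<in> sects (LO A) c" "app (LA u) c a = app (LA u) c a'"
  shows "a = a'"
proof -
  obtain x x' where x: "x \<in> sects A c" "a = app (\<eta> A) c x" "x' \<in> sects A c" "a' = app (\<eta> A) c x'"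
    using a(1,2) eta_bij[OF E(1) c] unfolding bij_betw_def by blast
  then have "app (\<eta> B) c (app u c x) = app (\<eta> B) c (app u c x')"
    using L_eta[OF u c] a(3) by simp
  then show ?thesis using eta_inj[OF E(2) c] app_in[OF u c] x inj by (metis inj_onD)
qed

lemma semi_left_exact_stable_units:
  assumes sle: "semi_left_exact S E L \<eta>" and pfp: "preserves_finite_products S T L"
  shows "has_stable_units S E L"
  unfolding has_stable_units_def preserves_pullback_of_def
proof (intro ballI allI impI)
  fix B f g p q
  assume B: "B \<in> E" and "f \<in> Arr S" "g \<in> Arr S" "Cod S f = B" "Cod S g = B" and pb: "is_pullback S f g p q"
  then obtain X Y P where f: "f \<in> hom S X B" and g: "g \<in> hom S Y B" and p: "p \<in> hom S P X" and q: "q \<in> hom S P Y"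
    unfolding is_pullback_def hom_def by auto
  have psh: "psh X" "psh Y" "psh P" using homD[OF f] homD[OF g] homD[OF p] by auto
  note pbD = pullbackD[OF pb f g p q]
  obtain M pr1 pr2 where pr1: "pr1 \<in> hom S M X" and pr2: "pr2 \<in> hom S M Y"
    and M_ex: "\<And>c x y. c \<in> Obj C \<Longrightarrow> x \<in> sects X c \<Longrightarrow> y \<in> sects Y c \<Longrightarrow> \<exists>w\<in>sects M c. app pr1 c w = x \<and> app pr2 c w = y"
    and M_uniq: "\<And>c w w'. c \<in> Obj C \<Longrightarrow> w \<in> sects M c \<Longrightarrow> w' \<in> sects M c \<Longrightarrow> app pr1 c w = app pr1 c w'
      \<Longrightarrow> app pr2 c w = app pr2 c w' \<Longrightarrow> w = w'"
    and M_map: "\<And>Z s t. s \<in> hom S Z X \<Longrightarrow> t \<in> hom S Z Y \<Longrightarrow> \<exists>u\<in>hom S Z M. pr1 \<odot> u = s \<and> pr2 \<odot> u = t"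
    by (rule product_exists[OF psh(1,2)]) blast+
  have LM_ex: "\<exists>w\<in>sects (LO M) c. app (LA pr1) c w = x \<and> app (LA pr2) c w = y"
    if "c \<in> Obj C" "x \<in> sects (LO X) c" "y \<in> sects (LO Y) c" for c x y
    by (rule L_binary_product(1)[OF pfp pr1 pr2 _ _ that]) (fact M_ex, fact M_uniq)
  have LM_uniq: "w = w'" if "c \<in> Obj C" "w \<in> sects (LO M) c" "w' \<in> sects (LO M) c"
    "app (LA pr1) c w = app (LA pr1) c w'" "app (LA pr2) c w = app (LA pr2) c w'" for c w w'
    by (rule L_binary_product(2)[OF pfp pr1 pr2 _ _ that]) (fact M_ex, fact M_uniq)
  have M: "psh M" using homD[OF pr1] by simp
  note etaM = eta[OF M]
  obtain s where s: "s \<in> hom S P M" and pr1s: "pr1 \<odot> s = p" and pr2s: "pr2 \<odot> s = q" using M_map[OF p q] by blast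
  note s1 = comp_appD[OF pr1s s] and s2 = comp_appD[OF pr2s s]
  obtain f' where f': "f' \<in> hom S (LO X) B"
    and f'_eta: "\<And>c x. c \<in> Obj C \<Longrightarrow> x \<in> sects X c \<Longrightarrow> app f' c (app (\<eta> X) c x) = app f c x"
    using extend[OF f B] by blast
  obtain g' where g': "g' \<in> hom S (LO Y) B"
    and g'_eta: "\<And>c x. c \<in> Obj C \<Longrightarrow> x \<in> sects Y c \<Longrightarrow> app g' c (app (\<eta> Y) c x) = app g c x"
    using extend[OF g B] by blast
  \<comment> \<open>The two maps are compared through the extensions \<open>f'\<close> and
    \<open>g'\<close>, with values in \<open>B\<close>. By \<open>L_factor\<close> and injectivity
    of \<open>\<eta> B\<close>, comparing through \<open>LA f\<close> and \<open>LA g\<close> would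
    select the same sections.\<close>
  define F where "F c = {m \<in> sects (LO M) c. app f' c (app (LA pr1) c m) = app g' c (app (LA pr2) c m)}" for c
  note [simp] = app_in[OF f'] app_in[OF g'] app_in[OF L_hom[OF pr1]] app_in[OF L_hom[OF pr2]]
  have LMpsh: "psh (LO M)" using LO_psh[OF M] .
  obtain A u where u: "u \<in> hom S A (LO M)" and A: "\<And>c. c \<in> Obj C \<Longrightarrow> sects A c = F c"
    and u_app: "\<And>c x. c \<in> Obj C \<Longrightarrow> x \<in> F c \<Longrightarrow> app u c x = x"
  proof (rule subpresheaf[OF LMpsh, of F])
    show "restr (LO M) h m \<in> F (Dom C h)" if "h \<in> Arr C" "m \<in> F (Cod C h)" for h m
      using that LMpsh app_nat[OF L_hom[OF pr1]] app_nat[OF L_hom[OF pr2]] app_nat[OF f'] app_nat[OF g']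
      by (simp add: F_def)
  qed (auto simp: F_def)
  have Apsh: "psh A" using homD[OF u] by simp
  have u_inj: "inj_on (app u c) (sects A c)" if "c \<in> Obj C" for c
    using A u_app that by (simp add: inj_on_def)
  \<comment> \<open>An equaliser of maps between objects of \<open>E\<close> stays in
    \<open>E\<close>: the extension \<open>e\<close> of \<open>u\<close> along the unit of
    \<open>A\<close> still equalises both maps to \<open>B\<close>, by uniqueness of extensions. So
    \<open>e\<close> takes its values in \<open>A\<close> and is a retraction of the unit.\<close>
  have AE: "A \<in> E"
  proof -
    obtain e where e: "e \<in> hom S (LO A) (LO M)"
      and e_eta: "\<And>c x. c \<in> Obj C \<Longrightarrow> x \<in> sects A c \<Longrightarrow> app e c (app (\<eta> A) c x) = app u c x"
      using extend[OF u LO_E[OF M]] by blast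
    have "f' \<odot> (LA pr1 \<odot> e) = g' \<odot> (LA pr2 \<odot> e)"
      by (rule extend_unique[OF B Apsh comp_hom[OF comp_hom[OF e L_hom[OF pr1]] f'] comp_hom[OF comp_hom[OF e L_hom[OF pr2]] g']])
        (use A u_app e_eta in \<open>simp add: homD[OF e] app_in[OF eta[OF Apsh]] F_def\<close>)
    then have e_in: "app e c x \<in> sects A c" if "c \<in> Obj C" "x \<in> sects (LO A) c" for c x
      using comp_app_eqD[OF _ comp_hom[OF e L_hom[OF pr1]] comp_hom[OF e L_hom[OF pr2]] that]
        that A app_in[OF e that] by (simp add: F_def homD[OF e])
    have r: "transf_of (LO A) A (app e) \<in> hom S (LO A) A"
    proof (rule transf_of_hom[OF LO_psh[OF Apsh] Apsh])
      fix h x assume h: "h \<in> Arr C" "x \<in> sects (LO A) (Cod C h)"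
      then have *: "app e (Dom C h) (restr (LO A) h x) \<in> sects A (Dom C h)" "app e (Cod C h) x \<in> sects A (Cod C h)"
        using e_in LO_psh[OF Apsh] by simp_all
      have "app u (Dom C h) (restr A h (app e (Cod C h) x)) = restr (LO M) h (app u (Cod C h) (app e (Cod C h) x))"
        using app_nat[OF u h(1) *(2)] .
      then show "app e (Dom C h) (restr (LO A) h x) = restr A h (app e (Cod C h) x)"
        using * h app_nat[OF e h] u_app A restr_in[OF Apsh h(1) refl *(2)] by simp
    qed (use e_in in auto)
    show ?thesis
      by (rule retract_in_E[OF Apsh r])
        (use A u_app e_eta app_in[OF eta[OF Apsh]] in simp)
  qed
  have Leta1: "app (LA pr1) c (app (\<eta> M) c m) = app (\<eta> X) c (app pr1 c m)" if "c \<in> Obj C" "m \<in> sects M c" for c m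
    using L_eta[OF pr1 that] .
  have Leta2: "app (LA pr2) c (app (\<eta> M) c m) = app (\<eta> Y) c (app pr2 c m)" if "c \<in> Obj C" "m \<in> sects M c" for c m
    using L_eta[OF pr2 that] .
  have in_F: "app (\<eta> M) c m \<in> F c \<longleftrightarrow> app f c (app pr1 c m) = app g c (app pr2 c m)"
    if "c \<in> Obj C" "m \<in> sects M c" for c m
    using that f'_eta g'_eta Leta1 Leta2 app_in[OF pr1] app_in[OF pr2] app_in[OF etaM] by (simp add: F_def)
  have s_F: "app (\<eta> M) c (app s c w) \<in> F c" if "c \<in> Obj C" "w \<in> sects P c" for c w
    using in_F[OF that(1) app_in[OF s that]] s1 s2 that pbD(1) by simp
  define t where "t = transf_of P A (\<lambda>c w. app (\<eta> M) c (app s c w))"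
  have t: "t \<in> hom S P A"
    unfolding t_def
  proof (rule transf_of_hom[OF psh(3) Apsh])
    fix h w assume h: "h \<in> Arr C" "w \<in> sects P (Cod C h)"
    have "app u (Dom C h) (restr A h (app (\<eta> M) (Cod C h) (app s (Cod C h) w))) =
        restr (LO M) h (app u (Cod C h) (app (\<eta> M) (Cod C h) (app s (Cod C h) w)))"
      by (rule app_nat[OF u h(1)]) (use s_F h A in simp)
    moreover have "restr A h (app (\<eta> M) (Cod C h) (app s (Cod C h) w)) \<in> F (Dom C h)"
      using s_F[of "Cod C h" w] h A Apsh restr_in[OF Apsh h(1) refl] by simp
    ultimately show "app (\<eta> M) (Dom C h) (app s (Dom C h) (restr P h w)) = restr A h (app (\<eta> M) (Cod C h) (app s (Cod C h) w))"
      using h s_F u_app app_nat[OF s h] app_nat[OF etaM h(1)] app_in[OF s] by simp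
  qed (use s_F A in simp)
  have t_app: "app t c w = app (\<eta> M) c (app s c w)" if "c \<in> Obj C" "w \<in> sects P c" for c w
    using that by (simp add: t_def)
  have ut: "app u c (app t c w) = app (\<eta> M) c (app s c w)" if "c \<in> Obj C" "w \<in> sects P c" for c w
    using that t_app u_app s_F by simp
  \<comment> \<open>By \<open>in_F\<close>, the unit sends a section of \<open>M\<close> into
    \<open>A\<close> exactly when its two components have the same image in \<open>B\<close>, that
    is, when it comes from \<open>P\<close>.\<close>
  have "is_pullback S u (\<eta> M) t s"
  proof (rule pullbackI[OF u etaM t s])
    fix c a m assume c: "c \<in> Obj C" and a: "a \<in> sects A c" and m: "m \<in> sects M c" and eq: "app u c a = app (\<eta> M) c m"
    then have am: "a = app (\<eta> M) c m" using A u_app by simp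
    then have "app f c (app pr1 c m) = app g c (app pr2 c m)" using in_F[OF c m] a A c by simp
    then obtain w where w: "w \<in> sects P c" "app p c w = app pr1 c m" "app q c w = app pr2 c m"
      using pbD(2)[OF c app_in[OF pr1 c m] app_in[OF pr2 c m]] by blast
    then have "app s c w = m" using M_uniq[OF c app_in[OF s c w(1)] m] s1 s2 c by simp
    then show "\<exists>w\<in>sects P c. app t c w = a \<and> app s c w = m" using w am t_app[OF c w(1)] by blast
  next
    fix c w w' assume c: "c \<in> Obj C" and w: "w \<in> sects P c" "w' \<in> sects P c" and eq: "app s c w = app s c w'"
    have "app p c w = app p c w'" "app q c w = app q c w'"
      using s1[OF c w(1)] s1[OF c w(2)] s2[OF c w(1)] s2[OF c w(2)] eq by simp_all
    then show "w = w'" using pbD(3)[OF c w] by simp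
  qed (rule ut)
  then have Lpb: "is_pullback S (LA u) (LA (\<eta> M)) (LA t) (LA s)"
    using semi_left_exact_pullback[OF sle _ u AE M t s] by blast
  note LpbD = pullbackD[OF Lpb L_hom[OF u] L_hom[OF etaM] L_hom[OF t] L_hom[OF s], unfolded L_eta_eq[OF M]]
  have Ls1: "app (LA pr1) c (app (LA s) c w) = app (LA p) c w" if "c \<in> Obj C" "w \<in> sects (LO P) c" for c w
    using comp_appD[OF _ L_hom[OF s] that, of "LA pr1" "LA p"] L_comp[OF s pr1] pr1s by simp
  have Ls2: "app (LA pr2) c (app (LA s) c w) = app (LA q) c w" if "c \<in> Obj C" "w \<in> sects (LO P) c" for c w
    using comp_appD[OF _ L_hom[OF s] that, of "LA pr2" "LA q"] L_comp[OF s pr2] pr2s by simp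
  note Lf = L_factor[OF f B f' f'_eta] and Lg = L_factor[OF g B g' g'_eta]
  have fp: "f \<odot> p = g \<odot> q" using pb unfolding is_pullback_def by blast
  have "is_pullback S (LA f) (LA g) (LA p) (LA q)"
  proof (rule pullbackI[OF L_hom[OF f] L_hom[OF g] L_hom[OF p] L_hom[OF q]])
    fix c w assume "c \<in> Obj C" "w \<in> sects (LO P) c"
    then show "app (LA f) c (app (LA p) c w) = app (LA g) c (app (LA q) c w)"
      by (rule comp_app_eqD[OF _ L_hom[OF p] L_hom[OF q], rotated]) (metis fp L_comp[OF p f] L_comp[OF q g])
  next
    fix c x y assume c: "c \<in> Obj C" and x: "x \<in> sects (LO X) c" and y: "y \<in> sects (LO Y) c"
      and eq: "app (LA f) c x = app (LA g) c y"
    obtain m where m: "m \<in> sects (LO M) c" "app (LA pr1) c m = x" "app (LA pr2) c m = y"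
      using LM_ex[OF c x y] by blast
    have "app f' c x = app g' c y"
      using eta_inj[OF B c] eq c x y Lf Lg by simp
    then have mF: "m \<in> F c" using m by (simp add: F_def)
    then have mA: "m \<in> sects A c" using A c by simp
    have "app (LA u) c (app (\<eta> A) c m) = app (\<eta> (LO M)) c m" using L_eta[OF u c mA] u_app[OF c mF] by simp
    then obtain w where w: "w \<in> sects (LO P) c" "app (LA t) c w = app (\<eta> A) c m" "app (LA s) c w = m"
      using LpbD(2)[OF c app_in[OF eta[OF Apsh] c mA] m(1)] by blast
    then show "\<exists>w\<in>sects (LO P) c. app (LA p) c w = x \<and> app (LA q) c w = y"
      using Ls1[OF c w(1)] Ls2[OF c w(1)] m by auto
  next
    fix c w w' assume c: "c \<in> Obj C" and w: "w \<in> sects (LO P) c" "w' \<in> sects (LO P) c"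
      and eq: "app (LA p) c w = app (LA p) c w'" "app (LA q) c w = app (LA q) c w'"
    have s_eq: "app (LA s) c w = app (LA s) c w'"
      using LM_uniq[OF c app_in[OF L_hom[OF s] c w(1)] app_in[OF L_hom[OF s] c w(2)]]
        Ls1[OF c w(1)] Ls1[OF c w(2)] Ls2[OF c w(1)] Ls2[OF c w(2)] eq by simp
    \<comment> \<open>As \<open>LA u\<close> is injective, the value of \<open>LA s\<close>
      determines that of \<open>LA t\<close>, so the two projections of \<open>LO P\<close> to the
      reflected product already separate its sections.\<close>
    then have "app (LA u) c (app (LA t) c w) = app (LA u) c (app (LA t) c w')"
      using LpbD(1)[OF c w(1)] LpbD(1)[OF c w(2)] by simp
    then have "app (LA t) c w = app (LA t) c w'"
      using LA_inj_on_E[OF u AE LO_E[OF M] c u_inj[OF c]] app_in[OF L_hom[OF t] c] w by blast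
    then show "w = w'" using LpbD(3)[OF c w] s_eq by simp
  qed
  then show "is_pullback T (LA f) (LA g) (LA p) (LA q)"
    using pullback_T_iff[OF L_hom[OF f] L_hom[OF g] L_hom[OF p] L_hom[OF q]] LO_E psh E_psh[OF B] by blast
qed

section \<open>From stable units to a pair of topologies\<close>

definition separated_at where
  "separated_at X c R \<longleftrightarrow>
     (\<forall>x\<in>sects X c. \<forall>y\<in>sects X c. (\<forall>f\<in>R. restr X f x = restr X f y) \<longrightarrow> x = y)"

definition sheaf_at where
  "sheaf_at X c R \<longleftrightarrow> (\<forall>x. matching_family C X R x \<longrightarrow> (\<exists>!y. gluing X c R x y))"

lemma separated_atD:
  "separated_at X c R \<Longrightarrow> x \<in> sects X c \<Longrightarrow> y \<in> sects X c \<Longrightarrow> (\<And>f. f \<in> R \<Longrightarrow> restr X f x = restr X f y) \<Longrightarrow> x = y"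
  unfolding separated_at_def by blast

lemma maximal_sieve_iff [simp]: "f \<in> maximal_sieve C c \<longleftrightarrow> f \<in> Arr C \<and> Cod C f = c"
  by (simp add: maximal_sieve_def)

lemma pull_sieve_iff [simp]: "g \<in> pull_sieve C f R \<longleftrightarrow> g \<in> Arr C \<and> Cod C g = Dom C f \<and> Cmp C f g \<in> R"
  by (simp add: pull_sieve_def)

lemma is_sieveI:
  assumes "\<And>f. f \<in> R \<Longrightarrow> f \<in> Arr C \<and> Cod C f = c"
    and "\<And>f g. f \<in> R \<Longrightarrow> g \<in> Arr C \<Longrightarrow> Cod C g = Dom C f \<Longrightarrow> Cmp C f g \<in> R"
  shows "is_sieve C c R"
  using assms unfolding is_sieve_def maximal_sieve_def by blast

lemma is_sieveD:
  assumes "is_sieve C c R" "f \<in> R"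
  shows "f \<in> Arr C" "Cod C f = c" "g \<in> Arr C \<Longrightarrow> Cod C g = Dom C f \<Longrightarrow> Cmp C f g \<in> R"
  using assms unfolding is_sieve_def maximal_sieve_def by blast+

lemma maximal_sieve: "is_sieve C c (maximal_sieve C c)"
  by (rule is_sieveI) auto

lemma pull_sieve:
  "is_sieve C c R \<Longrightarrow> f \<in> Arr C \<Longrightarrow> Cod C f = c \<Longrightarrow> is_sieve C (Dom C f) (pull_sieve C f R)"
  by (rule is_sieveI) (auto simp: cmp_assoc[symmetric] intro: is_sieveD(3))

lemma pull_pull_sieve:
  "f \<in> Arr C \<Longrightarrow> g \<in> Arr C \<Longrightarrow> Cod C g = Dom C f
    \<Longrightarrow> pull_sieve C g (pull_sieve C f R) = pull_sieve C (Cmp C f g) R"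
  by (auto simp: cmp_assoc)

lemma pull_sieve_idn: "is_sieve C c R \<Longrightarrow> c \<in> Obj C \<Longrightarrow> pull_sieve C (Idn C c) R = R"
  using is_sieveD(1,2)[of c R] by (intro set_eqI) (metis cmp_idn(2) idn(2) pull_sieve_iff)

lemma pull_sieve_mem: "is_sieve C c R \<Longrightarrow> f \<in> R \<Longrightarrow> pull_sieve C f R = maximal_sieve C (Dom C f)"
  by (auto dest: is_sieveD)

lemma pull_maximal_sieve:
  "f \<in> Arr C \<Longrightarrow> Cod C f = c \<Longrightarrow> pull_sieve C f (maximal_sieve C c) = maximal_sieve C (Dom C f)"
  by auto

lemma restr_matching_family:
  assumes "psh X" "is_sieve C c R" "x \<in> sects X c"
  shows "matching_family C X R (\<lambda>f. restr X f x)"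
  unfolding matching_family_def using assms is_sieveD[OF assms(2)] by (simp add: restr_cmp)

lemma sheaf_at_separated:
  assumes X: "psh X" and R: "is_sieve C c R" and sh: "sheaf_at X c R"
  shows "separated_at X c R"
  unfolding separated_at_def
proof (intro ballI impI)
  fix x y assume x: "x \<in> sects X c" and y: "y \<in> sects X c" and eq: "\<forall>f\<in>R. restr X f x = restr X f y"
  have "\<exists>!z. gluing X c R (\<lambda>f. restr X f x) z"
    using sh restr_matching_family[OF X R x] unfolding sheaf_at_def by blast
  moreover have "gluing X c R (\<lambda>f. restr X f x) x" "gluing X c R (\<lambda>f. restr X f x) y"
    using x y eq by (simp_all add: gluing_def)
  ultimately show "x = y" by blast
qed

lemma sheaf_atI:
  assumes sep: "separated_at X c R"
    and ex: "\<And>x. matching_family C X R x \<Longrightarrow> \<exists>y\<in>sects X c. \<forall>f\<in>R. restr X f y = x f"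
  shows "sheaf_at X c R"
  unfolding sheaf_at_def
proof (intro allI impI)
  fix x assume "matching_family C X R x"
  then obtain y where y: "y \<in> sects X c" "\<forall>f\<in>R. restr X f y = x f" using ex by blast
  show "\<exists>!y. gluing X c R x y"
  proof (rule ex1I[of _ y])
    fix z assume "gluing X c R x z"
    then show "z = y" using separated_atD[OF sep, of z y] y by (simp add: gluing_def)
  qed (use y in \<open>simp add: gluing_def\<close>)
qed

lemma sheaf_atE:
  assumes "sheaf_at X c R" "matching_family C X R x"
  obtains y where "y \<in> sects X c" "\<And>f. f \<in> R \<Longrightarrow> restr X f y = x f"
  using assms unfolding sheaf_at_def gluing_def by blast

lemma Sh_iff: "X \<in> Sh C U j \<longleftrightarrow> psh X \<and> (\<forall>c\<in>Obj C. \<forall>R\<in>j c. sheaf_at X c R)"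
  by (simp add: Sh_def sheaf_at_def)

text \<open>A matching family that has a gluing is the family of restrictions of that gluing, so
  uniqueness of gluings is a condition on pairs of sections.\<close>

lemma Sep_iff:
  assumes "grothendieck_topology C k"
  shows "X \<in> Sep C U k \<longleftrightarrow> psh X \<and> (\<forall>c\<in>Obj C. \<forall>R\<in>k c. separated_at X c R)"
proof -
  have "(\<forall>x. matching_family C X R x \<longrightarrow> (\<exists>\<^sub>\<le>\<^sub>1y. gluing X c R x y)) \<longleftrightarrow> separated_at X c R"
    if X: "psh X" and c: "c \<in> Obj C" "R \<in> k c" for c R
  proof
    have R: "is_sieve C c R" using assms c unfolding grothendieck_topology_def by blast
    assume *: "\<forall>x. matching_family C X R x \<longrightarrow> (\<exists>\<^sub>\<le>\<^sub>1y. gluing X c R x y)"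
    show "separated_at X c R"
      unfolding separated_at_def
    proof (intro ballI impI)
      fix x y assume x: "x \<in> sects X c" and y: "y \<in> sects X c" and eq: "\<forall>f\<in>R. restr X f x = restr X f y"
      have "\<exists>\<^sub>\<le>\<^sub>1z. gluing X c R (\<lambda>f. restr X f x) z"
        using * restr_matching_family[OF X R x] by blast
      moreover have "gluing X c R (\<lambda>f. restr X f x) x" "gluing X c R (\<lambda>f. restr X f x) y"
        using x y eq by (simp_all add: gluing_def)
      ultimately show "x = y" unfolding Uniq_def by blast
    qed
  next
    assume "separated_at X c R"
    then show "\<forall>x. matching_family C X R x \<longrightarrow> (\<exists>\<^sub>\<le>\<^sub>1y. gluing X c R x y)"
      unfolding Uniq_def gluing_def by (metis separated_atD)
  qed
  then show ?thesis unfolding Sep_def by auto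
qed

lemma separated_trans:
  assumes X: "psh X" and R: "is_sieve C c R" and P: "is_sieve C c P"
    and sep: "separated_at X c R" and sep': "\<And>f. f \<in> R \<Longrightarrow> separated_at X (Dom C f) (pull_sieve C f P)"
  shows "separated_at X c P"
  unfolding separated_at_def
proof (intro ballI impI)
  fix x y assume x: "x \<in> sects X c" and y: "y \<in> sects X c" and eq: "\<forall>f\<in>P. restr X f x = restr X f y"
  show "x = y"
  proof (rule separated_atD[OF sep x y])
    fix f assume f: "f \<in> R"
    note f' = is_sieveD[OF R f]
    show "restr X f x = restr X f y"
    proof (rule separated_atD[OF sep'[OF f]])
      fix g assume "g \<in> pull_sieve C f P"
      then show "restr X g (restr X f x) = restr X g (restr X f y)"
        using eq f' x y X by (auto simp: restr_cmp[symmetric])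
    qed (use x y X f' in auto)
  qed
qed

text \<open>A family on \<open>P\<close> is glued first over each arrow of \<open>R\<close>.
  Separation along the pulled-back sieves makes these local gluings match, so they glue along
  \<open>R\<close>. That the result restricts correctly to an arrow \<open>q\<close> of
  \<open>P\<close> can only be checked locally, along the pullback of \<open>R\<close> by
  \<open>q\<close>; this is why the condition is assumed for all pullbacks of \<open>R\<close>, but
  for \<open>P\<close> only for pullbacks along \<open>R\<close>.\<close>

lemma sheaf_trans:
  assumes X: "psh X" and R: "is_sieve C c R" and P: "is_sieve C c P" and c: "c \<in> Obj C"
    and sh: "\<And>g. g \<in> maximal_sieve C c \<Longrightarrow> sheaf_at X (Dom C g) (pull_sieve C g R)"
    and sh': "\<And>f. f \<in> R \<Longrightarrow> sheaf_at X (Dom C f) (pull_sieve C f P)"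
  shows "sheaf_at X c P"
proof (rule sheaf_atI)
  have shR: "sheaf_at X c R" using sh[of "Idn C c"] c by (simp add: pull_sieve_idn[OF R])
  have sep': "separated_at X (Dom C f) (pull_sieve C f P)" if "f \<in> R" for f
    using sheaf_at_separated[OF X pull_sieve[OF P] sh'[OF that]] is_sieveD[OF R that] by blast
  show "separated_at X c P"
    by (rule separated_trans[OF X R P sheaf_at_separated[OF X R shR] sep'])
  fix x assume x: "matching_family C X P x"
  have "\<exists>y\<in>sects X (Dom C f). \<forall>g\<in>pull_sieve C f P. restr X g y = x (Cmp C f g)" if f: "f \<in> R" for f
  proof -
    have "matching_family C X (pull_sieve C f P) (\<lambda>g. x (Cmp C f g))"
      using x is_sieveD[OF R f] unfolding matching_family_def
      by (auto simp: cmp_assoc[symmetric]) (metis cmp(2))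
    then show ?thesis by (rule sheaf_atE[OF sh'[OF f]]) blast
  qed
  then obtain y where y_in: "\<And>f. f \<in> R \<Longrightarrow> y f \<in> sects X (Dom C f)"
    and y: "\<And>f g. f \<in> R \<Longrightarrow> g \<in> pull_sieve C f P \<Longrightarrow> restr X g (y f) = x (Cmp C f g)" by metis
  have "matching_family C X R y"
    unfolding matching_family_def
  proof (intro conjI ballI impI)
    fix f g assume f: "f \<in> R" and g: "g \<in> Arr C" "Cod C g = Dom C f"
    note f' = is_sieveD[OF R f]
    have fg: "Cmp C f g \<in> R" using f' g by blast
    show "y (Cmp C f g) = restr X g (y f)"
    proof (rule separated_atD[OF sep'[OF fg]])
      fix h assume h: "h \<in> pull_sieve C (Cmp C f g) P"
      then have "Cmp C g h \<in> pull_sieve C f P" using f' g by (auto simp: cmp_assoc)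
      then have "restr X (Cmp C g h) (y f) = x (Cmp C (Cmp C f g) h)"
        using y[OF f] f' g h by (simp add: cmp_assoc)
      then show "restr X h (y (Cmp C f g)) = restr X h (restr X g (y f))"
        using y[OF fg h] y_in[OF f] f' g h X by (simp add: restr_cmp)
    qed (use y_in[OF f] y_in[OF fg] f' g X in auto)
  qed (use y_in in blast)
  then obtain z where z: "z \<in> sects X c" "\<And>f. f \<in> R \<Longrightarrow> restr X f z = y f"
    by (rule sheaf_atE[OF shR]) blast
  have "restr X q z = x q" if q: "q \<in> P" for q
  proof (rule separated_atD)
    note q' = is_sieveD[OF P q]
    show "separated_at X (Dom C q) (pull_sieve C q R)"
      using sheaf_at_separated[OF X pull_sieve[OF R q'(1,2)] sh] q' by simp
    show "restr X q z \<in> sects X (Dom C q)" "x q \<in> sects X (Dom C q)"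
      using q' z X x q by (auto simp: matching_family_def)
    fix g assume g: "g \<in> pull_sieve C q R"
    then have qg: "Cmp C q g \<in> R" "g \<in> Arr C" "Cod C g = Dom C q" by auto
    \<comment> \<open>Since \<open>q\<close> already lies in \<open>P\<close>, the local gluing over
      \<open>Cmp C q g\<close> can be evaluated at an identity, which returns the family
      itself.\<close>
    have "Idn C (Dom C g) \<in> pull_sieve C (Cmp C q g) P" using q' qg by auto
    from y[OF qg(1) this] have "y (Cmp C q g) = x (Cmp C q g)" using y_in[OF qg(1)] X qg q' by simp
    also have "x (Cmp C q g) = restr X g (x q)" using x q qg by (simp add: matching_family_def)
    finally show "restr X g (restr X q z) = restr X g (x q)"
      using z(2)[OF qg(1)] q' qg X z(1) by (simp add: restr_cmp)
  qed
  then show "\<exists>y\<in>sects X c. \<forall>f\<in>P. restr X f y = x f" using z(1) by blast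
qed

text \<open>The sheaf and separation conditions at one sieve do not pass to its pullbacks, so
  stability is built in by imposing \<open>Q\<close> on every pullback.\<close>

definition largest_topology where
  "largest_topology Q c =
     {R. is_sieve C c R \<and> (\<forall>f\<in>maximal_sieve C c. Q (Dom C f) (pull_sieve C f R))}"

text \<open>Pullback stability holds by construction, so only maximal sieves and transitivity are
  left to \<open>Q\<close>. The assumption \<open>trans\<close> grants \<open>Q\<close> for all
  pullbacks of \<open>R\<close>, as needed for gluing in \<open>sheaf_trans\<close>.\<close>

lemma largest_topology:
  assumes max: "\<And>c. c \<in> Obj C \<Longrightarrow> Q c (maximal_sieve C c)"
    and trans: "\<And>c R P. c \<in> Obj C \<Longrightarrow> is_sieve C c R \<Longrightarrow> is_sieve C c P
      \<Longrightarrow> (\<And>g. g \<in> maximal_sieve C c \<Longrightarrow> Q (Dom C g) (pull_sieve C g R))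
      \<Longrightarrow> (\<And>f. f \<in> R \<Longrightarrow> Q (Dom C f) (pull_sieve C f P)) \<Longrightarrow> Q c P"
  shows "grothendieck_topology C (largest_topology Q)"
  unfolding grothendieck_topology_def
proof (intro conjI ballI allI impI)
  show "is_sieve C c R" if "R \<in> largest_topology Q c" for c R
    using that by (simp add: largest_topology_def)
  show "maximal_sieve C c \<in> largest_topology Q c" if "c \<in> Obj C" for c
    using max by (auto simp: largest_topology_def maximal_sieve pull_maximal_sieve)
  show "pull_sieve C f R \<in> largest_topology Q (Dom C f)"
    if f: "f \<in> Arr C" and R: "R \<in> largest_topology Q (Cod C f)" for f R
    unfolding largest_topology_def
  proof (intro CollectI conjI ballI)
    show "is_sieve C (Dom C f) (pull_sieve C f R)" using R f by (auto simp: largest_topology_def intro: pull_sieve)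
    fix g assume "g \<in> maximal_sieve C (Dom C f)"
    then have g: "g \<in> Arr C" "Cod C g = Dom C f" by auto
    have "\<forall>h\<in>maximal_sieve C (Cod C f). Q (Dom C h) (pull_sieve C h R)" using R by (simp add: largest_topology_def)
    from bspec[OF this, of "Cmp C f g"] show "Q (Dom C g) (pull_sieve C g (pull_sieve C f R))"
      using f g by (simp add: pull_pull_sieve)
  qed
  fix c R P assume c: "c \<in> Obj C" and R: "R \<in> largest_topology Q c" and P: "is_sieve C c P"
    and loc: "\<forall>f\<in>R. pull_sieve C f P \<in> largest_topology Q (Dom C f)"
  have R': "is_sieve C c R" "\<And>f. f \<in> Arr C \<Longrightarrow> Cod C f = c \<Longrightarrow> Q (Dom C f) (pull_sieve C f R)"
    using R by (auto simp: largest_topology_def)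
  show "P \<in> largest_topology Q c"
    unfolding largest_topology_def
  proof (intro CollectI conjI ballI P)
    fix h assume "h \<in> maximal_sieve C c"
    then have h: "h \<in> Arr C" "Cod C h = c" by auto
    show "Q (Dom C h) (pull_sieve C h P)"
    proof (rule trans[OF _ pull_sieve[OF R'(1) h] pull_sieve[OF P h]])
      fix g assume "g \<in> maximal_sieve C (Dom C h)"
      then show "Q (Dom C g) (pull_sieve C g (pull_sieve C h R))"
        using R'(2)[of "Cmp C h g"] h by (simp add: pull_pull_sieve)
    next
      fix f assume "f \<in> pull_sieve C h R"
      then have f: "f \<in> Arr C" "Cod C f = Dom C h" "Cmp C h f \<in> R" by auto
      have "pull_sieve C (Cmp C h f) P \<in> largest_topology Q (Dom C f)"
        using bspec[OF loc f(3)] f h by simp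
      then have *: "is_sieve C (Dom C f) (pull_sieve C (Cmp C h f) P)"
        "\<forall>g\<in>maximal_sieve C (Dom C f). Q (Dom C g) (pull_sieve C g (pull_sieve C (Cmp C h f) P))"
        by (simp_all add: largest_topology_def)
      show "Q (Dom C f) (pull_sieve C f (pull_sieve C h P))"
        using bspec[OF *(2), of "Idn C (Dom C f)"] f h
        by (simp add: pull_pull_sieve pull_sieve_idn[OF *(1)])
    qed (use h in simp)
  qed
qed

lemma largest_topologyD:
  assumes "R \<in> largest_topology Q c" "c \<in> Obj C"
  shows "is_sieve C c R" "Q c R"
proof -
  show R: "is_sieve C c R" using assms by (simp add: largest_topology_def)
  show "Q c R" using assms pull_sieve_idn[OF R assms(2)] idn[OF assms(2)]
    unfolding largest_topology_def by (metis (mono_tags, lifting) maximal_sieve_iff mem_Collect_eq)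
qed

lemma separated_at_maximal: "psh X \<Longrightarrow> c \<in> Obj C \<Longrightarrow> separated_at X c (maximal_sieve C c)"
  unfolding separated_at_def by (metis idn(1,3) maximal_sieve_iff restr_idn)

lemma sheaf_at_maximal:
  assumes X: "psh X" and c: "c \<in> Obj C"
  shows "sheaf_at X c (maximal_sieve C c)"
proof (rule sheaf_atI[OF separated_at_maximal[OF X c]])
  fix x assume x: "matching_family C X (maximal_sieve C c) x"
  have id: "Idn C c \<in> maximal_sieve C c" using c by simp
  have "x (Idn C c) \<in> sects X c" using x id c unfolding matching_family_def by (metis idn(2))
  moreover have "\<forall>f\<in>maximal_sieve C c. restr X f (x (Idn C c)) = x f"
    using x id c unfolding matching_family_def by (metis cmp_idn(2) idn(2) maximal_sieve_iff)
  ultimately show "\<exists>y\<in>sects X c. \<forall>f\<in>maximal_sieve C c. restr X f y = x f" by blast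
qed

lemma sheaf_topology:
  assumes "\<And>X. X \<in> F \<Longrightarrow> psh X"
  shows "grothendieck_topology C (largest_topology (\<lambda>c R. \<forall>X\<in>F. sheaf_at X c R))"
  by (rule largest_topology) (use assms in \<open>blast intro: sheaf_at_maximal sheaf_trans\<close>)+

lemma separated_topology:
  assumes "\<And>X. X \<in> F \<Longrightarrow> psh X"
  shows "grothendieck_topology C (largest_topology (\<lambda>c R. \<forall>X\<in>F. separated_at X c R))"
proof (rule largest_topology)
  fix c R P assume c: "c \<in> Obj C" and R: "is_sieve C c R" and P: "is_sieve C c P"
    and 1: "\<And>g. g \<in> maximal_sieve C c \<Longrightarrow> \<forall>X\<in>F. separated_at X (Dom C g) (pull_sieve C g R)"
    and 2: "\<And>f. f \<in> R \<Longrightarrow> \<forall>X\<in>F. separated_at X (Dom C f) (pull_sieve C f P)"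
  have "\<forall>X\<in>F. separated_at X c R" using 1[of "Idn C c"] c by (simp add: pull_sieve_idn[OF R])
  then show "\<forall>X\<in>F. separated_at X c P" using separated_trans[OF _ R P] 2 assms by blast
qed (use assms separated_at_maximal in blast)

text \<open>This sieve covers exactly when \<open>x\<close> and \<open>y\<close> are locally equal
  for the topology in question.\<close>

definition equalizer_sieve where
  "equalizer_sieve X c x y = {f \<in> maximal_sieve C c. restr X f x = restr X f y}"

lemma equalizer_sieve:
  "psh X \<Longrightarrow> x \<in> sects X c \<Longrightarrow> y \<in> sects X c \<Longrightarrow> is_sieve C c (equalizer_sieve X c x y)"
  by (rule is_sieveI) (auto simp: equalizer_sieve_def restr_cmp)

lemma pull_equalizer_sieve:
  "psh X \<Longrightarrow> x \<in> sects X c \<Longrightarrow> y \<in> sects X c \<Longrightarrow> f \<in> Arr C \<Longrightarrow> Cod C f = c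
    \<Longrightarrow> pull_sieve C f (equalizer_sieve X c x y) = equalizer_sieve X (Dom C f) (restr X f x) (restr X f y)"
  by (auto simp: equalizer_sieve_def restr_cmp)

text \<open>\<open>t\<close> is locally surjective for a topology exactly when all these sieves
  cover.\<close>

definition image_sieve where
  "image_sieve t c a = {f \<in> maximal_sieve C c.
     restr (target t) f a \<in> app t (Dom C f) ` sects (source t) (Dom C f)}"

lemma image_sieve_iff:
  assumes "t \<in> hom S X Y"
  shows "f \<in> image_sieve t c a \<longleftrightarrow>
    f \<in> Arr C \<and> Cod C f = c \<and> (\<exists>x\<in>sects X (Dom C f). app t (Dom C f) x = restr Y f a)"
  unfolding image_sieve_def homD(3,4)[OF assms] image_iff by (auto; metis)

lemma image_sieve:
  assumes t: "t \<in> hom S X Y" and a: "a \<in> sects Y c"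
  shows "is_sieve C c (image_sieve t c a)"
proof (rule is_sieveI)
  fix f g assume f: "f \<in> image_sieve t c a" and g: "g \<in> Arr C" "Cod C g = Dom C f"
  then obtain x where x: "f \<in> Arr C" "Cod C f = c" "x \<in> sects X (Dom C f)" "app t (Dom C f) x = restr Y f a"
    by (auto simp: image_sieve_iff[OF t])
  have "app t (Dom C g) (restr X g x) = restr Y (Cmp C f g) a"
    using app_nat[OF t g(1), of x] x g a homD[OF t] by (simp add: restr_cmp)
  moreover have "restr X g x \<in> sects X (Dom C g)" using x g homD[OF t] by simp
  ultimately show "Cmp C f g \<in> image_sieve t c a" using x g by (auto simp: image_sieve_iff[OF t])
qed (simp add: image_sieve_iff[OF t])

lemma pull_image_sieve:
  assumes t: "t \<in> hom S X Y" and a: "a \<in> sects Y c" and f: "f \<in> Arr C" "Cod C f = c"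
  shows "pull_sieve C f (image_sieve t c a) = image_sieve t (Dom C f) (restr Y f a)"
proof (rule set_eqI)
  fix g show "g \<in> pull_sieve C f (image_sieve t c a) \<longleftrightarrow> g \<in> image_sieve t (Dom C f) (restr Y f a)"
    by (cases "g \<in> Arr C \<and> Cod C g = Dom C f")
      (use f a homD(2)[OF t] in \<open>simp_all add: image_sieve_iff[OF t] restr_cmp\<close>, blast)
qed

end

context reflective_presheaves
begin

text \<open>Let \<open>K\<close> be the pullback of the units of \<open>X\<close> and \<open>M = X \<times> B \<times> B\<close> over \<open>L X\<close>, so that the projection \<open>K \<rightarrow> M\<close>
  is inverted by \<open>L\<close>, and let \<open>Z \<subseteq> K\<close> be the union of the diagonal, a section of this projection, with the
  subobject generated by \<open>(x, y, b, b')\<close>. As \<open>L\<close> preserves the monomorphism \<open>Z \<rightarrow> K\<close>, it inverts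
  the diagonal \<open>M \<rightarrow> Z\<close> too. Hence the two maps \<open>Z \<rightarrow> B\<close> that are equal to \<open>b\<close> on the diagonal, but
  \<open>b\<close> and \<open>b'\<close> off the diagonal, coincide.\<close>

lemma eta_kernel_separated:
  assumes su: "has_stable_units S E L" and pm: "preserves_monos S T L"
    and X: "psh X" and c: "c \<in> Obj C" and x: "x \<in> sects X c" and y: "y \<in> sects X c"
    and eq: "app (\<eta> X) c x = app (\<eta> X) c y" and B: "B \<in> E"
  shows "separated_at B c (equalizer_sieve X c x y)"
  unfolding separated_at_def
proof (intro ballI impI)
  fix b b' assume b: "b \<in> sects B c" and b': "b' \<in> sects B c"
    and agree: "\<forall>f\<in>equalizer_sieve X c x y. restr B f b = restr B f b'"
  have Bpsh: "psh B" using E_psh[OF B] .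
  note etaX = eta[OF X]
  obtain BB p1 p2 where p1: "p1 \<in> hom S BB B" and p2: "p2 \<in> hom S BB B"
    and BB_ex: "\<And>c x y. c \<in> Obj C \<Longrightarrow> x \<in> sects B c \<Longrightarrow> y \<in> sects B c \<Longrightarrow> \<exists>w\<in>sects BB c. app p1 c w = x \<and> app p2 c w = y"
    by (rule product_exists[OF Bpsh Bpsh]) blast
  \<comment> \<open>The factor \<open>BB\<close> makes \<open>b\<close> and \<open>b'\<close> the
    values of its two projections at one section, so that maps to \<open>B\<close> taking these
    values are defined on all of \<open>K\<close>, the diagonal included.\<close>
  obtain M a q where a: "a \<in> hom S M X" and q: "q \<in> hom S M BB"
    and M_ex: "\<And>c x y. c \<in> Obj C \<Longrightarrow> x \<in> sects X c \<Longrightarrow> y \<in> sects BB c \<Longrightarrow> \<exists>w\<in>sects M c. app a c w = x \<and> app q c w = y"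
    by (rule product_exists[OF X homD(1)[OF p1]]) blast
  note M = homD(1)[OF a]
  have etaa: "\<eta> X \<odot> a \<in> hom S M (LO X)" using comp_hom[OF a etaX] .
  obtain K k1 k2 where k1: "k1 \<in> hom S K X" and k2: "k2 \<in> hom S K M" and pb: "is_pullback S (\<eta> X) (\<eta> X \<odot> a) k1 k2"
    using pullback_exists[OF etaX etaa] .
  note K = homD(1)[OF k1]
  note pbD = pullbackD[OF pb etaX etaa k1 k2]
  obtain w0 where w0: "w0 \<in> sects BB c" "app p1 c w0 = b" "app p2 c w0 = b'" using BB_ex[OF c b b'] by blast
  obtain m where m: "m \<in> sects M c" "app a c m = y" "app q c m = w0" using M_ex[OF c y w0(1)] by blast
  have "app (\<eta> X) c x = app (\<eta> X \<odot> a) c m" using eq m c homD[OF a] by simp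
  then obtain z where z: "z \<in> sects K c" "app k1 c z = x" "app k2 c z = m" using pbD(2)[OF c x m(1)] by blast
  define diag where "diag d w \<longleftrightarrow> app k1 d w = app a d (app k2 d w)" for d w
  define \<beta> where "\<beta> d w = app p1 d (app q d (app k2 d w))" for d w
  define \<beta>' where "\<beta>' d w = app p2 d (app q d (app k2 d w))" for d w
  have \<beta>_in: "\<beta> d w \<in> sects B d" "\<beta>' d w \<in> sects B d" if "d \<in> Obj C" "w \<in> sects K d" for d w
    using that by (auto simp: \<beta>_def \<beta>'_def intro!: app_in[OF p1] app_in[OF p2] app_in[OF q] app_in[OF k2])
  have nat: "\<beta> (Dom C f) (restr K f w) = restr B f (\<beta> (Cod C f) w)"
    "\<beta>' (Dom C f) (restr K f w) = restr B f (\<beta>' (Cod C f) w)"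
    "app k1 (Dom C f) (restr K f w) = restr X f (app k1 (Cod C f) w)"
    "app a (Dom C f) (app k2 (Dom C f) (restr K f w)) = restr X f (app a (Cod C f) (app k2 (Cod C f) w))"
    if f: "f \<in> Arr C" "w \<in> sects K (Cod C f)" for f w
    using app_nat[OF k2 f] app_nat[OF k1 f] app_nat[OF a f(1)] app_nat[OF q f(1)] app_nat[OF p1 f(1)] app_nat[OF p2 f(1)]
      app_in[OF k2 _ f(2)] app_in[OF q] f
    by (simp_all add: \<beta>_def \<beta>'_def)
  have diag_restr: "diag (Dom C f) (restr K f w)" if "f \<in> Arr C" "w \<in> sects K (Cod C f)" "diag (Cod C f) w" for f w
    using nat(3,4)[OF that(1,2)] that(3) by (simp add: diag_def)
  have zb: "\<beta> c z = b" "\<beta>' c z = b'" using z m w0 by (auto simp: \<beta>_def \<beta>'_def)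
  \<comment> \<open>Restriction along \<open>f\<close> moves \<open>z\<close> onto the diagonal only
    if \<open>f\<close> identifies \<open>x\<close> with \<open>y\<close>, and there
    \<open>b\<close> and \<open>b'\<close> agree by assumption. This makes the case distinction in
    \<open>\<tau>\<close> compatible with restriction.\<close>
  have diag_z: "\<beta> (Dom C f) (restr K f z) = \<beta>' (Dom C f) (restr K f z)"
    if "f \<in> Arr C" "Cod C f = c" "diag (Dom C f) (restr K f z)" for f
    using nat[OF that(1), of z] that z zb m agree by (auto simp: diag_def equalizer_sieve_def)
  define F where "F d = {w \<in> sects K d. diag d w \<or> (\<exists>f\<in>Arr C. Dom C f = d \<and> Cod C f = c \<and> w = restr K f z)}" for d
  have zF: "z \<in> F c" using z(1) c K by (auto simp: F_def intro!: bexI[of _ "Idn C c"])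
  obtain Z i where i: "i \<in> hom S Z K" and Z: "\<And>d. d \<in> Obj C \<Longrightarrow> sects Z d = F d"
    and i_app: "\<And>d w. d \<in> Obj C \<Longrightarrow> w \<in> F d \<Longrightarrow> app i d w = w"
    and Z_restr: "\<And>f w. f \<in> Arr C \<Longrightarrow> w \<in> F (Cod C f) \<Longrightarrow> restr Z f w = restr K f w"
  proof (rule subpresheaf[OF K, of F])
    show "restr K h w \<in> F (Dom C h)" if h: "h \<in> Arr C" and w: "w \<in> F (Cod C h)" for h w
    proof -
      consider "diag (Cod C h) w" | f where "f \<in> Arr C" "Dom C f = Cod C h" "Cod C f = c" "w = restr K f z"
        using w by (auto simp: F_def)
      then show ?thesis
      proof cases
        case 1
        then show ?thesis using diag_restr h w K by (auto simp: F_def)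
      next
        case 2
        then have "restr K h w = restr K (Cmp C f h) z" using h K z by (simp add: restr_cmp)
        then show ?thesis using 2 h K z w by (auto simp: F_def intro!: bexI[of _ "Cmp C f h"])
      qed
    qed
  qed (auto simp: F_def)
  note Zpsh = homD(1)[OF i]
  have FK: "w \<in> sects K d" if "w \<in> F d" for d w using that by (simp add: F_def)
  have s: "transf_of Z B \<beta> \<in> hom S Z B"
    by (rule transf_of_hom[OF Zpsh Bpsh]) (use Z Z_restr \<beta>_in nat FK in simp_all)
  define \<tau> where "\<tau> d w = (if diag d w then \<beta> d w else \<beta>' d w)" for d w
  have t: "transf_of Z B \<tau> \<in> hom S Z B"
  proof (rule transf_of_hom[OF Zpsh Bpsh])
    show "\<tau> d w \<in> sects B d" if "d \<in> Obj C" "w \<in> sects Z d" for d w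
      using that Z \<beta>_in FK by (simp add: \<tau>_def)
    fix h w assume h: "h \<in> Arr C" and w: "w \<in> sects Z (Cod C h)"
    then have wF: "w \<in> F (Cod C h)" and wK: "w \<in> sects K (Cod C h)" using Z FK by simp_all
    show "\<tau> (Dom C h) (restr Z h w) = restr B h (\<tau> (Cod C h) w)"
    proof (cases "diag (Cod C h) w")
      case True
      then show ?thesis using diag_restr[OF h wK] Z_restr[OF h wF] nat[OF h wK] by (simp add: \<tau>_def)
    next
      case False
      then obtain f where f: "f \<in> Arr C" "Dom C f = Cod C h" "Cod C f = c" "w = restr K f z"
        using wF by (auto simp: F_def)
      then have "restr K h w = restr K (Cmp C f h) z" using h K z by (simp add: restr_cmp)
      then have "\<beta> (Dom C h) (restr K h w) = \<beta>' (Dom C h) (restr K h w)" if "diag (Dom C h) (restr K h w)"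
        using diag_z[of "Cmp C f h"] that f h by simp
      then show ?thesis using False Z_restr[OF h wF] nat[OF h wK] by (simp add: \<tau>_def)
    qed
  qed
  have "(\<eta> X) \<odot> a = (\<eta> X \<odot> a) \<odot> Idn S M" using comp_idn(1)[OF etaa] by simp
  then obtain \<delta> where \<delta>: "\<delta> \<in> hom S M K" "k1 \<odot> \<delta> = a" "k2 \<odot> \<delta> = Idn S M"
    using pullback_universal[OF pb etaX etaa k1 k2 a idn_hom[OF M]] by blast
  have \<delta>_app: "app k1 d (app \<delta> d w) = app a d w" "app k2 d (app \<delta> d w) = w" if "d \<in> Obj C" "w \<in> sects M d" for d w
    using comp_appD[OF \<delta>(2,1) that] comp_appD[OF \<delta>(3,1) that] that by simp_all
  have \<delta>F: "app \<delta> d w \<in> F d" if "d \<in> Obj C" "w \<in> sects M d" for d w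
    using \<delta>_app[OF that] app_in[OF \<delta>(1) that] by (simp add: F_def diag_def)
  define e where "e = transf_of M Z (app \<delta>)"
  have e: "e \<in> hom S M Z"
    unfolding e_def by (rule transf_of_hom[OF M Zpsh]) (use \<delta>F Z Z_restr app_nat[OF \<delta>(1)] in simp_all)
  have e_app: "app e d w = app \<delta> d w" if "d \<in> Obj C" "w \<in> sects M d" for d w using that by (simp add: e_def)
  have ki: "k2 \<odot> i \<in> hom S Z M" using comp_hom[OF i k2] .
  have kie: "(k2 \<odot> i) \<odot> e = Idn S M"
    by (rule comp_eqI[OF e ki idn_hom[OF M]])
      (use e_app i_app \<delta>F \<delta>_app Z in \<open>simp add: homD[OF i]\<close>)
  have Lpb: "is_pullback S (LA (\<eta> X)) (LA (\<eta> X \<odot> a)) (LA k1) (LA k2)"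
    using stable_units_pullback[OF su pb etaX etaa k1 k2 LO_E[OF X]] .
  note LpbD = pullbackD[OF Lpb L_hom[OF etaX] L_hom[OF etaa] L_hom[OF k1] L_hom[OF k2]]
  \<comment> \<open>The preserved pullback has \<open>LA (\<eta> X) = \<eta> (LO X)\<close> as one
    of its legs. This map is injective as \<open>LO X\<close> lies in \<open>E\<close>, hence so is
    the projection opposite to it.\<close>
  have Lk2_inj: "w = w'" if d: "d \<in> Obj C" and w: "w \<in> sects (LO K) d" "w' \<in> sects (LO K) d"
      and k2_eq: "app (LA k2) d w = app (LA k2) d w'" for d w w'
  proof -
    have "app (\<eta> (LO X)) d (app (LA k1) d w) = app (\<eta> (LO X)) d (app (LA k1) d w')"
      using LpbD(1)[OF d w(1)] LpbD(1)[OF d w(2)] k2_eq by (simp add: L_eta_eq[OF X])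
    then have "app (LA k1) d w = app (LA k1) d w'"
      using eta_inj[OF LO_E[OF X] d] app_in[OF L_hom[OF k1] d] w by blast
    then show ?thesis using LpbD(3)[OF d w] k2_eq by blast
  qed
  have Li_inj: "inj_on (app (LA i) d) (sects (LO Z) d)" if "d \<in> Obj C" for d
    using L_mono[OF pm i _ that] i_app Z by (simp add: inj_on_def)
  have Lki: "app (LA (k2 \<odot> i)) d w = app (LA k2) d (app (LA i) d w)" if "d \<in> Obj C" "w \<in> sects (LO Z) d" for d w
    using comp_appD[OF _ L_hom[OF i] that] L_comp[OF i k2] by metis
  have Lki_inj: "w = w'" if "d \<in> Obj C" "w \<in> sects (LO Z) d" "w' \<in> sects (LO Z) d"
    "app (LA (k2 \<odot> i)) d w = app (LA (k2 \<odot> i)) d w'" for d w w'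
    using that Lki Lk2_inj[OF that(1)] app_in[OF L_hom[OF i] that(1)] Li_inj[OF that(1)] by (metis inj_onD)
  have Le_surj: "app (LA e) d (app (LA (k2 \<odot> i)) d w) = w" if d: "d \<in> Obj C" and w: "w \<in> sects (LO Z) d" for d w
  proof (rule Lki_inj[OF d _ w])
    have v: "app (LA (k2 \<odot> i)) d w \<in> sects (LO M) d" using app_in[OF L_hom[OF ki] d w] .
    show "app (LA e) d (app (LA (k2 \<odot> i)) d w) \<in> sects (LO Z) d" using app_in[OF L_hom[OF e] d v] .
    show "app (LA (k2 \<odot> i)) d (app (LA e) d (app (LA (k2 \<odot> i)) d w)) = app (LA (k2 \<odot> i)) d w"
      using comp_appD[OF _ L_hom[OF e] d v, of "LA (k2 \<odot> i)" "Idn S (LO M)"] L_comp[OF e ki] kie L_idn[OF M] v d by simp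
  qed
  obtain s' where s': "s' \<in> hom S (LO Z) B"
    and s'_eta: "\<And>d w. d \<in> Obj C \<Longrightarrow> w \<in> sects Z d \<Longrightarrow> app s' d (app (\<eta> Z) d w) = app (transf_of Z B \<beta>) d w"
    using extend[OF s B] by blast
  obtain t' where t': "t' \<in> hom S (LO Z) B"
    and t'_eta: "\<And>d w. d \<in> Obj C \<Longrightarrow> w \<in> sects Z d \<Longrightarrow> app t' d (app (\<eta> Z) d w) = app (transf_of Z B \<tau>) d w"
    using extend[OF t B] by blast
  have st: "s' \<odot> LA e = t' \<odot> LA e"
  proof (rule extend_unique[OF B M comp_hom[OF L_hom[OF e] s'] comp_hom[OF L_hom[OF e] t']])
    fix d w assume d: "d \<in> Obj C" "w \<in> sects M d"
    have "diag d (app \<delta> d w)" using \<delta>_app[OF d] by (simp add: diag_def)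
    then show "app (s' \<odot> LA e) d (app (\<eta> M) d w) = app (t' \<odot> LA e) d (app (\<eta> M) d w)"
      using d app_in[OF eta[OF M] d] L_eta[OF e d] s'_eta t'_eta e_app[OF d] \<delta>F[OF d] Z
      by (simp add: homD[OF L_hom[OF e]] \<tau>_def)
  qed
  have zZ: "z \<in> sects Z c" using zF Z[OF c] by simp
  have v: "app (\<eta> Z) c z \<in> sects (LO Z) c" using app_in[OF eta[OF Zpsh] c zZ] .
  have "app s' c (app (\<eta> Z) c z) = app t' c (app (\<eta> Z) c z)"
    using comp_app_eqD[OF st L_hom[OF e] L_hom[OF e] c app_in[OF L_hom[OF ki] c v]] Le_surj[OF c v] by simp
  then have "\<beta> c z = \<tau> c z" using s'_eta[OF c zZ] t'_eta[OF c zZ] c zZ by simp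
  then have "\<beta> c z = \<beta>' c z" using diag_z[of "Idn C c"] c z(1) K by (auto simp: \<tau>_def split: if_splits)
  then show "b = b'" using zb by simp
qed

text \<open>Let \<open>\<alpha>\<close> be the map from the representable \<open>Y\<close> of
  \<open>c\<close> that classifies \<open>a\<close>, and let \<open>R\<close> be the pullback of the
  unit along it. The image of \<open>R\<close> in \<open>Y\<close> is the sieve in question. By
  stable units \<open>LA r1\<close> is a pullback of \<open>LA (\<eta> X) = \<eta> (LO X)\<close>,
  hence invertible, so maps into \<open>B\<close> from \<open>R\<close> and from \<open>Y\<close>
  correspond. The former come from matching families on the sieve, the latter are sections of
  \<open>B\<close> over \<open>c\<close>.\<close>

lemma eta_image_sheaf:
  assumes su: "has_stable_units S E L" and X: "psh X" and c: "c \<in> Obj C" and a: "a \<in> sects (LO X) c"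
    and inj: "\<And>d. d \<in> Obj C \<Longrightarrow> inj_on (app (\<eta> X) d) (sects X d)" and B: "B \<in> E"
  shows "sheaf_at B c (image_sieve (\<eta> X) c a)"
proof -
  let ?R = "image_sieve (\<eta> X) c a"
  have Bpsh: "psh B" using E_psh[OF B] .
  note etaX = eta[OF X]
  obtain Y \<iota> where Y: "represents c Y \<iota>" using representable[OF c] .
  have Ypsh: "psh Y" and \<iota>: "\<iota> \<in> sects Y c"
    and Ybij: "\<And>d. d \<in> Obj C \<Longrightarrow> bij_betw (\<lambda>f. restr Y f \<iota>) {f \<in> Arr C. Dom C f = d \<and> Cod C f = c} (sects Y d)"
    using Y unfolding represents_def by auto
  obtain \<alpha> where \<alpha>: "\<alpha> \<in> hom S Y (LO X)" and \<alpha>_app: "\<And>f. f \<in> Arr C \<Longrightarrow> Cod C f = c \<Longrightarrow>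
      app \<alpha> (Dom C f) (restr Y f \<iota>) = restr (LO X) f a"
    using yoneda[OF Y LO_psh[OF X] a c] by metis
  obtain R r1 r2 where r1: "r1 \<in> hom S R Y" and r2: "r2 \<in> hom S R X" and pb: "is_pullback S \<alpha> (\<eta> X) r1 r2"
    using pullback_exists[OF \<alpha> etaX] .
  note R = homD(1)[OF r1]
  note pbD = pullbackD[OF pb \<alpha> etaX r1 r2]
  note LpbD = pullbackD[OF stable_units_pullback[OF su pb \<alpha> etaX r1 r2 LO_E[OF X]]
      L_hom[OF \<alpha>] L_hom[OF etaX] L_hom[OF r1] L_hom[OF r2], unfolded L_eta_eq[OF X]]
  have Lr1_bij: "bij_betw (app (LA r1) d) (sects (LO R) d) (sects (LO Y) d)" if d: "d \<in> Obj C" for d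
    unfolding bij_betw_def
  proof (intro conjI inj_onI subset_antisym subsetI)
    fix w w' assume w: "w \<in> sects (LO R) d" "w' \<in> sects (LO R) d" and eq: "app (LA r1) d w = app (LA r1) d w'"
    have "app (LA r2) d w = app (LA r2) d w'"
      by (rule eta_inj[OF LO_E[OF X] d])
        (use LpbD(1)[OF d w(1)] LpbD(1)[OF d w(2)] eq app_in[OF L_hom[OF r2] d] w in simp_all)
    then show "w = w'" using LpbD(3)[OF d w eq] by simp
  next
    fix y assume y: "y \<in> sects (LO Y) d"
    have "app (LA \<alpha>) d y \<in> sects (LO (LO X)) d" using app_in[OF L_hom[OF \<alpha>] d y] .
    then obtain x where x: "x \<in> sects (LO X) d" "app (LA \<alpha>) d y = app (\<eta> (LO X)) d x"
      using eta_bij[OF LO_E[OF X] d] unfolding bij_betw_def by auto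
    then show "y \<in> app (LA r1) d ` sects (LO R) d" using LpbD(2)[OF d y x(1)] by auto
  qed (use app_in[OF L_hom[OF r1] d] in auto)
  obtain r1' where r1': "r1' \<in> hom S (LO Y) (LO R)" "r1' \<odot> LA r1 = Idn S (LO R)" "LA r1 \<odot> r1' = Idn S (LO Y)"
    using cat_inverse[OF L_hom[OF r1] Lr1_bij] by blast
  have in_R: "\<exists>w\<in>sects R (Dom C f). app r1 (Dom C f) w = restr Y f \<iota>" if f: "f \<in> ?R" for f
  proof -
    obtain x where f': "f \<in> Arr C" "Cod C f = c" and x: "x \<in> sects X (Dom C f)" "app (\<eta> X) (Dom C f) x = restr (LO X) f a"
      using f by (auto simp: image_sieve_iff[OF etaX])
    then show ?thesis using pbD(2)[of "Dom C f" "restr Y f \<iota>" x] \<alpha>_app[OF f'] Ypsh \<iota> by auto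
  qed
  \<comment> \<open>The arrow of the sieve that a section of \<open>R\<close> names through its
    projection to the representable.\<close>
  define \<psi> where "\<psi> d w = inv_into {f \<in> Arr C. Dom C f = d \<and> Cod C f = c} (\<lambda>f. restr Y f \<iota>) (app r1 d w)" for d w
  have \<psi>: "\<psi> d w = f" if "d \<in> Obj C" "f \<in> Arr C" "Dom C f = d" "Cod C f = c" "app r1 d w = restr Y f \<iota>" for d w f
    using bij_betw_inv_into_left[OF Ybij[OF that(1)], of f] that by (simp add: \<psi>_def)
  have \<psi>': "\<psi> d w \<in> ?R" "Dom C (\<psi> d w) = d" "restr Y (\<psi> d w) \<iota> = app r1 d w"
    if d: "d \<in> Obj C" and w: "w \<in> sects R d" for d w
  proof -
    have "app r1 d w \<in> (\<lambda>f. restr Y f \<iota>) ` {f \<in> Arr C. Dom C f = d \<and> Cod C f = c}"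
      using app_in[OF r1 d w] bij_betw_imp_surj_on[OF Ybij[OF d]] by simp
    then obtain f where f: "f \<in> Arr C" "Dom C f = d" "Cod C f = c" "app r1 d w = restr Y f \<iota>" by blast
    have "app (\<eta> X) d (app r2 d w) = restr (LO X) f a" using pbD(1)[OF d w] f \<alpha>_app[OF f(1,3)] by simp
    then have "f \<in> ?R"
      using f app_in[OF r2 d w] by (auto simp: image_sieve_iff[OF etaX])
    moreover have "\<psi> d w = f" using \<psi>[OF d f(1,2,3,4)] .
    ultimately show "\<psi> d w \<in> ?R" "Dom C (\<psi> d w) = d" "restr Y (\<psi> d w) \<iota> = app r1 d w"
      using f by auto
  qed
  show ?thesis
  proof (rule sheaf_atI)
    show "separated_at B c ?R"
      unfolding separated_at_def
    proof (intro ballI impI)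
      fix b b' assume b: "b \<in> sects B c" "b' \<in> sects B c"
        and agree: "\<forall>f\<in>?R. restr B f b = restr B f b'"
      obtain t where t: "t \<in> hom S Y B" "app t c \<iota> = b"
          "\<And>f. f \<in> Arr C \<Longrightarrow> Cod C f = c \<Longrightarrow> app t (Dom C f) (restr Y f \<iota>) = restr B f b"
        by (rule yoneda[OF Y Bpsh b(1) c]) blast
      obtain t' where t': "t' \<in> hom S Y B" "app t' c \<iota> = b'"
          "\<And>f. f \<in> Arr C \<Longrightarrow> Cod C f = c \<Longrightarrow> app t' (Dom C f) (restr Y f \<iota>) = restr B f b'"
        by (rule yoneda[OF Y Bpsh b(2) c]) blast
      have tr: "app t d (app r1 d w) = app t' d (app r1 d w)" if "d \<in> Obj C" "w \<in> sects R d" for d w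
      proof -
        have "\<psi> d w \<in> Arr C" "Cod C (\<psi> d w) = c" using \<psi>'(1)[OF that] by (auto simp: image_sieve_iff[OF etaX])
        then show ?thesis using t(3)[of "\<psi> d w"] t'(3)[of "\<psi> d w"] \<psi>'[OF that] agree by simp
      qed
      obtain u where u: "u \<in> hom S (LO Y) B"
        and u_eta: "\<And>d w. d \<in> Obj C \<Longrightarrow> w \<in> sects Y d \<Longrightarrow> app u d (app (\<eta> Y) d w) = app t d w"
        using extend[OF t(1) B] by blast
      obtain u' where u': "u' \<in> hom S (LO Y) B"
        and u'_eta: "\<And>d w. d \<in> Obj C \<Longrightarrow> w \<in> sects Y d \<Longrightarrow> app u' d (app (\<eta> Y) d w) = app t' d w"
        using extend[OF t'(1) B] by blast
      have uu: "u \<odot> LA r1 = u' \<odot> LA r1"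
        by (rule extend_unique[OF B R comp_hom[OF L_hom[OF r1] u] comp_hom[OF L_hom[OF r1] u']])
          (simp add: homD[OF L_hom[OF r1]] app_in[OF eta[OF R]] L_eta[OF r1] u_eta u'_eta app_in[OF r1] tr)
      have v: "app (\<eta> Y) c \<iota> \<in> sects (LO Y) c" using app_in[OF eta[OF Ypsh] c \<iota>] .
      then have "app (\<eta> Y) c \<iota> \<in> app (LA r1) c ` sects (LO R) c"
        using bij_betw_imp_surj_on[OF Lr1_bij[OF c]] by simp
      then obtain w where w: "w \<in> sects (LO R) c" "app (LA r1) c w = app (\<eta> Y) c \<iota>" by (metis imageE)
      have "app u c (app (\<eta> Y) c \<iota>) = app u' c (app (\<eta> Y) c \<iota>)"
        using comp_app_eqD[OF uu L_hom[OF r1] L_hom[OF r1] c w(1)] w(2) by simp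
      then show "b = b'" using u_eta[OF c \<iota>] u'_eta[OF c \<iota>] t(2) t'(2) by simp
    qed
  next
    fix \<beta> assume \<beta>: "matching_family C B ?R \<beta>"
    \<comment> \<open>Composition with \<open>\<psi>\<close> turns the family into a map from
      \<open>R\<close> to \<open>B\<close>; its naturality is the matching condition.\<close>
    have t: "transf_of R B (\<lambda>d w. \<beta> (\<psi> d w)) \<in> hom S R B"
    proof (rule transf_of_hom[OF R Bpsh])
      show "\<beta> (\<psi> d w) \<in> sects B d" if "d \<in> Obj C" "w \<in> sects R d" for d w
        using \<beta> \<psi>'(1,2)[OF that] unfolding matching_family_def by metis
      fix h w assume h: "h \<in> Arr C" and w: "w \<in> sects R (Cod C h)"
      let ?f = "\<psi> (Cod C h) w"
      have f: "?f \<in> ?R" "Dom C ?f = Cod C h" "restr Y ?f \<iota> = app r1 (Cod C h) w"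
        using \<psi>'[OF _ w] h by auto
      then have f': "?f \<in> Arr C" "Cod C ?f = c" by (auto simp: image_sieve_iff[OF etaX])
      have "app r1 (Dom C h) (restr R h w) = restr Y (Cmp C ?f h) \<iota>"
        using app_nat[OF r1 h w] f f' h Ypsh \<iota> by (simp add: restr_cmp)
      then have "\<psi> (Dom C h) (restr R h w) = Cmp C ?f h" using \<psi>[of "Dom C h" "Cmp C ?f h" "restr R h w"] f f' h by simp
      then show "\<beta> (\<psi> (Dom C h) (restr R h w)) = restr B h (\<beta> ?f)"
        using \<beta> f h unfolding matching_family_def by simp
    qed
    obtain u where u: "u \<in> hom S (LO R) B"
      and u_eta: "\<And>d w. d \<in> Obj C \<Longrightarrow> w \<in> sects R d \<Longrightarrow> app u d (app (\<eta> R) d w) = app (transf_of R B (\<lambda>d w. \<beta> (\<psi> d w))) d w"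
      using extend[OF t B] by blast
    \<comment> \<open>The map just built is carried over to the representable through the inverse of
      \<open>LA r1\<close>; its value at \<open>\<iota>\<close> is the gluing.\<close>
    define g where "g d y = app u d (app r1' d (app (\<eta> Y) d y))" for d y
    have g_in: "g c \<iota> \<in> sects B c"
      unfolding g_def using app_in[OF u c app_in[OF r1'(1) c app_in[OF eta[OF Ypsh] c \<iota>]]] .
    have "restr B f (g c \<iota>) = \<beta> f" if f: "f \<in> ?R" for f
    proof -
      have f': "f \<in> Arr C" "Cod C f = c" using f by (auto simp: image_sieve_iff[OF etaX])
      obtain w where w: "w \<in> sects R (Dom C f)" "app r1 (Dom C f) w = restr Y f \<iota>" using in_R[OF f] by blast
      let ?d = "Dom C f"
      have d: "?d \<in> Obj C" using f' by simp
      have "restr B f (g c \<iota>) = g ?d (restr Y f \<iota>)"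
        unfolding g_def using f' \<iota> app_nat[OF eta[OF Ypsh] f'(1)] app_nat[OF r1'(1) f'(1)] app_nat[OF u f'(1)]
          app_in[OF eta[OF Ypsh] c \<iota>] app_in[OF r1'(1) c] by simp
      also have "\<dots> = app u ?d (app r1' ?d (app (LA r1) ?d (app (\<eta> R) ?d w)))"
        unfolding g_def w(2)[symmetric] using L_eta[OF r1 d w(1)] by simp
      also have "\<dots> = app u ?d (app (\<eta> R) ?d w)"
        using comp_appD[OF r1'(2) L_hom[OF r1] d app_in[OF eta[OF R] d w(1)]] d app_in[OF eta[OF R] d w(1)] by simp
      also have "\<dots> = \<beta> (\<psi> ?d w)" using u_eta[OF d w(1)] d w(1) by simp
      also have "\<psi> ?d w = f" using \<psi>[OF d f'(1) refl f'(2) w(2)] .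
      finally show ?thesis .
    qed
    then show "\<exists>b\<in>sects B c. \<forall>f\<in>?R. restr B f b = \<beta> f" using g_in by blast
  qed
qed

lemma stable_units_quasitopos:
  assumes su: "has_stable_units S E L" and pm: "preserves_monos S T L"
  shows "\<exists>j k. grothendieck_topology C j \<and> grothendieck_topology C k \<and> topology_le C j k \<and>
    E = Sep C U k \<inter> Sh C U j"
proof -
  define j where "j = largest_topology (\<lambda>c R. \<forall>X\<in>E. sheaf_at X c R)"
  define k where "k = largest_topology (\<lambda>c R. \<forall>X\<in>E. separated_at X c R)"
  have j: "grothendieck_topology C j" and k: "grothendieck_topology C k"
    unfolding j_def k_def using sheaf_topology separated_topology E_psh by blast+
  have jD: "is_sieve C c R" "A \<in> E \<Longrightarrow> sheaf_at A c R" if "R \<in> j c" "c \<in> Obj C" for c R A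
    using largest_topologyD[OF that[unfolded j_def]] by auto
  have kD: "is_sieve C c R" "A \<in> E \<Longrightarrow> separated_at A c R" if "R \<in> k c" "c \<in> Obj C" for c R A
    using largest_topologyD[OF that[unfolded k_def]] by auto
  have le: "topology_le C j k"
    unfolding topology_le_def
  proof (intro ballI subsetI)
    fix c R assume c: "c \<in> Obj C" and R: "R \<in> j c"
    have "separated_at A (Dom C f) (pull_sieve C f R)" if "f \<in> Arr C" "Cod C f = c" "A \<in> E" for f A
      using R that sheaf_at_separated[OF E_psh pull_sieve[OF jD(1)[OF R c]]]
      unfolding j_def largest_topology_def by (simp del: pull_sieve_iff)
    then show "R \<in> k c" using jD(1)[OF R c] unfolding k_def largest_topology_def by simp
  qed
  have "X \<in> E" if "X \<in> Sep C U k" "X \<in> Sh C U j" for X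
  proof -
    have X: "psh X" and sep: "\<And>c R. c \<in> Obj C \<Longrightarrow> R \<in> k c \<Longrightarrow> separated_at X c R"
      and sh: "\<And>c R. c \<in> Obj C \<Longrightarrow> R \<in> j c \<Longrightarrow> sheaf_at X c R"
      using that by (auto simp: Sep_iff[OF k] Sh_iff)
    note etaX = eta[OF X]
    have inj: "inj_on (app (\<eta> X) c) (sects X c)" if c: "c \<in> Obj C" for c
    proof (rule inj_onI)
      fix x y assume x: "x \<in> sects X c" and y: "y \<in> sects X c" and eq: "app (\<eta> X) c x = app (\<eta> X) c y"
      \<comment> \<open>A pullback of this sieve is the equaliser sieve of restrictions of
        \<open>x\<close> and \<open>y\<close>, which the unit identifies as well, so
        \<open>eta_kernel_separated\<close> covers all pullbacks at once.\<close>
      have "equalizer_sieve X c x y \<in> k c"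
        unfolding k_def largest_topology_def
      proof (intro CollectI conjI ballI equalizer_sieve[OF X x y])
        fix f A assume "f \<in> maximal_sieve C c" and A: "A \<in> E"
        then have f: "f \<in> Arr C" "Cod C f = c" by auto
        show "separated_at A (Dom C f) (pull_sieve C f (equalizer_sieve X c x y))"
          unfolding pull_equalizer_sieve[OF X x y f]
          by (rule eta_kernel_separated[OF su pm X _ _ _ _ A])
            (use f x y X eq app_nat[OF etaX f(1)] in auto)
      qed
      from sep[OF c this] show "x = y"
        by (rule separated_atD[OF _ x y]) (simp add: equalizer_sieve_def)
    qed
    have "bij_betw (app (\<eta> X) c) (sects X c) (sects (LO X) c)" if c: "c \<in> Obj C" for c
      unfolding bij_betw_def
    proof (intro conjI inj[OF c] subset_antisym subsetI)
      fix a assume a: "a \<in> sects (LO X) c"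
      let ?R = "image_sieve (\<eta> X) c a"
      have R: "?R \<in> j c"
        unfolding j_def largest_topology_def
      proof (intro CollectI conjI ballI image_sieve[OF etaX a])
        fix f A assume "f \<in> maximal_sieve C c" and A: "A \<in> E"
        then have f: "f \<in> Arr C" "Cod C f = c" by auto
        show "sheaf_at A (Dom C f) (pull_sieve C f ?R)"
          unfolding pull_image_sieve[OF etaX a f]
          by (rule eta_image_sheaf[OF su X _ _ inj A]) (use f a LO_psh[OF X] in auto)
      qed
      have "\<forall>f\<in>?R. \<exists>x\<in>sects X (Dom C f). app (\<eta> X) (Dom C f) x = restr (LO X) f a"
        by (simp add: image_sieve_iff[OF etaX])
      then obtain \<xi> where \<xi>: "\<And>f. f \<in> ?R \<Longrightarrow> \<xi> f \<in> sects X (Dom C f)"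
        "\<And>f. f \<in> ?R \<Longrightarrow> app (\<eta> X) (Dom C f) (\<xi> f) = restr (LO X) f a" by metis
      \<comment> \<open>The preimages are chosen arbitrarily, but the unit is injective, so
        compatibility can be checked after applying it, where they are restrictions of
        \<open>a\<close>.\<close>
      have "matching_family C X ?R \<xi>"
        unfolding matching_family_def
      proof (intro conjI ballI impI)
        fix f g assume f: "f \<in> ?R" and g: "g \<in> Arr C" "Cod C g = Dom C f"
        note f' = is_sieveD[OF image_sieve[OF etaX a] f]
        have fg: "Cmp C f g \<in> ?R" using f' g by blast
        have "app (\<eta> X) (Dom C g) (\<xi> (Cmp C f g)) = app (\<eta> X) (Dom C g) (restr X g (\<xi> f))"
          using \<xi>[OF fg] \<xi>[OF f] f' g app_nat[OF etaX g(1)] a LO_psh[OF X] by (simp add: restr_cmp)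
        then show "\<xi> (Cmp C f g) = restr X g (\<xi> f)"
          using inj[of "Dom C g"] \<xi>(1)[OF fg] \<xi>(1)[OF f] f' g X by (auto dest!: inj_onD)
      qed (use \<xi> in blast)
      then obtain x where x: "x \<in> sects X c" "\<And>f. f \<in> ?R \<Longrightarrow> restr X f x = \<xi> f"
        using sheaf_atE[OF sh[OF c R]] by blast
      have "app (\<eta> X) c x = a"
      proof (rule separated_atD[OF sheaf_at_separated[OF LO_psh[OF X] jD(1)[OF R c] jD(2)[OF R c LO_E[OF X]]]])
        fix f assume f: "f \<in> ?R"
        note f' = is_sieveD[OF image_sieve[OF etaX a] f]
        show "restr (LO X) f (app (\<eta> X) c x) = restr (LO X) f a"
          using app_nat[OF etaX f'(1), of x] x \<xi>(2)[OF f] f f' by simp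
      qed (use a x app_in[OF etaX c] in auto)
      then show "a \<in> app (\<eta> X) c ` sects X c" using x by blast
    qed (use app_in[OF etaX c] in auto)
    then show ?thesis by (rule bij_eta_in_E[OF X])
  qed
  moreover have "X \<in> Sep C U k \<inter> Sh C U j" if "X \<in> E" for X
    using that jD kD E_psh by (simp add: Sep_iff[OF k] Sh_iff)
  ultimately have "E = Sep C U k \<inter> Sh C U j" by blast
  then show ?thesis using j k le by blast
qed

section \<open>From a pair of topologies to stable units\<close>

context
  fixes k assumes k: "grothendieck_topology C k"
begin

lemma cover_sieve: "c \<in> Obj C \<Longrightarrow> R \<in> k c \<Longrightarrow> is_sieve C c R"
  using k unfolding grothendieck_topology_def by blast

lemma cover_maximal: "c \<in> Obj C \<Longrightarrow> maximal_sieve C c \<in> k c"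
  using k unfolding grothendieck_topology_def by blast

lemma cover_pull: "f \<in> Arr C \<Longrightarrow> Cod C f = c \<Longrightarrow> R \<in> k c \<Longrightarrow> pull_sieve C f R \<in> k (Dom C f)"
  using k unfolding grothendieck_topology_def by blast

lemma cover_trans:
  assumes "c \<in> Obj C" "R \<in> k c" "is_sieve C c P" "\<And>f. f \<in> R \<Longrightarrow> pull_sieve C f P \<in> k (Dom C f)"
  shows "P \<in> k c"
proof -
  have "\<forall>c\<in>Obj C. \<forall>R\<in>k c. \<forall>Q. is_sieve C c Q \<longrightarrow> (\<forall>f\<in>R. pull_sieve C f Q \<in> k (Dom C f)) \<longrightarrow> Q \<in> k c"
    using k unfolding grothendieck_topology_def by (elim conjE)
  then show ?thesis using assms by blast
qed

lemma cover_superset: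
  assumes c: "c \<in> Obj C" and R: "R \<in> k c" and P: "is_sieve C c P" and sub: "R \<subseteq> P"
  shows "P \<in> k c"
proof (rule cover_trans[OF c R P])
  fix f assume f: "f \<in> R"
  then have "Dom C f \<in> Obj C" using is_sieveD(1)[OF cover_sieve[OF c R]] by simp
  then show "pull_sieve C f P \<in> k (Dom C f)"
    using cover_maximal pull_sieve_mem[OF P, of f] sub f by auto
qed

lemma cover_Int:
  assumes c: "c \<in> Obj C" and R: "R \<in> k c" and P: "P \<in> k c"
  shows "R \<inter> P \<in> k c"
proof (rule cover_trans[OF c R])
  note R' = is_sieveD[OF cover_sieve[OF c R]] and P' = is_sieveD[OF cover_sieve[OF c P]]
  show "is_sieve C c (R \<inter> P)"
    by (rule is_sieveI) (use R' P' in blast)+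
  fix f assume f: "f \<in> R"
  have "pull_sieve C f (R \<inter> P) = pull_sieve C f P" using R'(3)[OF f] by auto
  then show "pull_sieve C f (R \<inter> P) \<in> k (Dom C f)"
    using cover_pull[OF R'(1,2)[OF f] P] by simp
qed

text \<open>\<open>\<Omega> c d\<close> consists of the \<open>k\<close>-closed subpresheaves of the product of the representables of \<open>d\<close>
  and \<open>c\<close>, that is, of the sections over \<open>d\<close> of the exponential of the classifier of \<open>k\<close>-closed
  subobjects by the representable of \<open>c\<close>.\<close>

definition spans where
  "spans c d = {(f, g). f \<in> Arr C \<and> g \<in> Arr C \<and> Dom C f = Dom C g \<and> Cod C f = d \<and> Cod C g = c}"

definition span_sieve where
  "span_sieve V f g = {h \<in> Arr C. Cod C h = Dom C f \<and> (Cmp C f h, Cmp C g h) \<in> V}"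

definition \<Omega> where
  "\<Omega> c d = {V. V \<subseteq> spans c d \<and>
     (\<forall>f g h. (f, g) \<in> V \<longrightarrow> h \<in> Arr C \<longrightarrow> Cod C h = Dom C f \<longrightarrow> (Cmp C f h, Cmp C g h) \<in> V) \<and>
     (\<forall>f g. (f, g) \<in> spans c d \<longrightarrow> span_sieve V f g \<in> k (Dom C f) \<longrightarrow> (f, g) \<in> V)}"

definition \<Omega>_restr where
  "\<Omega>_restr c u V = {(f, g) \<in> spans c (Dom C u). (Cmp C u f, g) \<in> V}"

lemma spans_iff [simp]:
  "(f, g) \<in> spans c d \<longleftrightarrow> f \<in> Arr C \<and> g \<in> Arr C \<and> Dom C f = Dom C g \<and> Cod C f = d \<and> Cod C g = c"
  by (simp add: spans_def)

lemma \<Omega>_restr_iff [simp]: "(f, g) \<in> \<Omega>_restr c u V \<longleftrightarrow> (f, g) \<in> spans c (Dom C u) \<and> (Cmp C u f, g) \<in> V"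
  by (simp add: \<Omega>_restr_def)

lemma \<Omega>D:
  assumes "V \<in> \<Omega> c d"
  shows "(f, g) \<in> V \<Longrightarrow> (f, g) \<in> spans c d"
    and "(f, g) \<in> V \<Longrightarrow> h \<in> Arr C \<Longrightarrow> Cod C h = Dom C f \<Longrightarrow> (Cmp C f h, Cmp C g h) \<in> V"
    and "(f, g) \<in> spans c d \<Longrightarrow> span_sieve V f g \<in> k (Dom C f) \<Longrightarrow> (f, g) \<in> V"
  using assms unfolding \<Omega>_def by blast+

lemma \<Omega>I:
  assumes "\<And>f g. (f, g) \<in> V \<Longrightarrow> (f, g) \<in> spans c d"
    and "\<And>f g h. (f, g) \<in> V \<Longrightarrow> h \<in> Arr C \<Longrightarrow> Cod C h = Dom C f \<Longrightarrow> (Cmp C f h, Cmp C g h) \<in> V"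
    and "\<And>f g. (f, g) \<in> spans c d \<Longrightarrow> span_sieve V f g \<in> k (Dom C f) \<Longrightarrow> (f, g) \<in> V"
  shows "V \<in> \<Omega> c d"
  unfolding \<Omega>_def
proof (intro CollectI conjI subrelI allI impI)
  show "(Cmp C f h, Cmp C g h) \<in> V" if "(f, g) \<in> V" "h \<in> Arr C" "Cod C h = Dom C f" for f g h
    using that by (rule assms(2))
  show "(f, g) \<in> V" if "(f, g) \<in> spans c d" "span_sieve V f g \<in> k (Dom C f)" for f g
    using that by (rule assms(3))
qed (rule assms(1))

lemma \<Omega>_restr_in:
  assumes V: "V \<in> \<Omega> c (Cod C u)" and u: "u \<in> Arr C"
  shows "\<Omega>_restr c u V \<in> \<Omega> c (Dom C u)"
proof (rule \<Omega>I)
  fix f g h assume fg: "(f, g) \<in> \<Omega>_restr c u V" and h: "h \<in> Arr C" "Cod C h = Dom C f"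
  then show "(Cmp C f h, Cmp C g h) \<in> \<Omega>_restr c u V"
    using \<Omega>D(2)[OF V, of "Cmp C u f" g h] u by (auto simp: cmp_assoc)
next
  fix f g assume fg: "(f, g) \<in> spans c (Dom C u)" and cov: "span_sieve (\<Omega>_restr c u V) f g \<in> k (Dom C f)"
  have "span_sieve (\<Omega>_restr c u V) f g = span_sieve V (Cmp C u f) g"
    using fg u by (auto simp: span_sieve_def cmp_assoc)
  then show "(f, g) \<in> \<Omega>_restr c u V"
    using \<Omega>D(3)[OF V, of "Cmp C u f" g] fg u cov by auto
qed simp

text \<open>If \<open>Cmp C f h\<close> lies in \<open>R\<close>, the restriction along it records
  whether the span \<open>(f, g)\<close> composed with \<open>h\<close> is present, as a span with
  an identity as left leg. So a span of \<open>V\<close> lies in \<open>V'\<close> on a cover, and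
  \<open>V'\<close> is closed. Exchanging \<open>V\<close> and \<open>V'\<close> gives
  equality.\<close>

lemma \<Omega>_separated:
  assumes V: "V \<in> \<Omega> c d" and V': "V' \<in> \<Omega> c d" and d: "d \<in> Obj C" and R: "R \<in> k d"
    and eq: "\<And>r. r \<in> R \<Longrightarrow> \<Omega>_restr c r V = \<Omega>_restr c r V'"
  shows "V \<subseteq> V'"
proof (rule subrelI)
  fix f g assume fg: "(f, g) \<in> V"
  then have sp: "f \<in> Arr C" "g \<in> Arr C" "Dom C f = Dom C g" "Cod C f = d" "Cod C g = c"
    using \<Omega>D(1)[OF V fg] by auto
  have c: "Dom C f \<in> Obj C" using sp by simp
  have in_V': "(Cmp C f h, Cmp C g h) \<in> V'" if h: "h \<in> pull_sieve C f R" for h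
  proof -
    have h': "h \<in> Arr C" "Cod C h = Dom C f" "Cmp C f h \<in> R" using h by auto
    have "(Cmp C f h, Cmp C g h) \<in> V" using \<Omega>D(2)[OF V fg] h' by blast
    then have "(Idn C (Dom C h), Cmp C g h) \<in> \<Omega>_restr c (Cmp C f h) V" using h' sp by simp
    then have "(Idn C (Dom C h), Cmp C g h) \<in> \<Omega>_restr c (Cmp C f h) V'" using eq[OF h'(3)] by simp
    then show ?thesis using h' sp by simp
  qed
  have "span_sieve V' f g \<in> k (Dom C f)"
  proof (rule cover_superset[OF c cover_pull[OF sp(1,4) R]])
    show "is_sieve C (Dom C f) (span_sieve V' f g)"
      by (rule is_sieveI) (use sp \<Omega>D(2)[OF V'] in \<open>auto simp: span_sieve_def cmp_assoc[symmetric]\<close>)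
    show "pull_sieve C f R \<subseteq> span_sieve V' f g" using in_V' by (auto simp: span_sieve_def)
  qed
  then show "(f, g) \<in> V'" using \<Omega>D(3)[OF V'] sp by simp
qed

text \<open>The gluing \<open>W\<close> consists of the spans that belong to the family locally.
  \<open>G f g\<close> collects the arrows \<open>h\<close> for which this can be tested and holds:
  \<open>Cmp C f h\<close> lies in \<open>R\<close>, and the composed span is a member of
  \<open>V (Cmp C f h)\<close> with an identity as left leg. Transitivity of the topology makes
  \<open>W\<close> closed. Over \<open>r\<close> in \<open>R\<close>, the sieve
  \<open>G (Cmp C r f) g\<close> is the one on which \<open>(f, g)\<close> lies in
  \<open>V r\<close>, so closedness of \<open>V r\<close> gives back \<open>V r\<close>.\<close>

lemma \<Omega>_glue:
  assumes d: "d \<in> Obj C" and R: "R \<in> k d" and V: "\<And>r. r \<in> R \<Longrightarrow> V r \<in> \<Omega> c (Dom C r)"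
    and match: "\<And>r h. r \<in> R \<Longrightarrow> h \<in> Arr C \<Longrightarrow> Cod C h = Dom C r \<Longrightarrow> V (Cmp C r h) = \<Omega>_restr c h (V r)"
  shows "\<exists>W\<in>\<Omega> c d. \<forall>r\<in>R. \<Omega>_restr c r W = V r"
proof -
  note R' = is_sieveD[OF cover_sieve[OF d R]]
  define G where "G f g = {h \<in> Arr C. Cod C h = Dom C f \<and> Cmp C f h \<in> R \<and> (Idn C (Dom C h), Cmp C g h) \<in> V (Cmp C f h)}" for f g
  define W where "W = {(f, g) \<in> spans c d. G f g \<in> k (Dom C f)}"
  have G_sieve: "is_sieve C (Dom C f) (G f g)" if fg: "(f, g) \<in> spans c d" for f g
  proof (rule is_sieveI)
    fix h h' assume h: "h \<in> G f g" and h': "h' \<in> Arr C" "Cod C h' = Dom C h"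
    have fh: "h \<in> Arr C" "Cod C h = Dom C f" "Cmp C f h \<in> R" "(Idn C (Dom C h), Cmp C g h) \<in> V (Cmp C f h)"
      using h by (auto simp: G_def)
    have "(Cmp C (Idn C (Dom C h)) h', Cmp C (Cmp C g h) h') \<in> V (Cmp C f h)"
      by (rule \<Omega>D(2)[OF V[OF fh(3)] fh(4)]) (use h' fh in auto)
    then have "(Idn C (Dom C h'), Cmp C (Cmp C g h) h') \<in> V (Cmp C (Cmp C f h) h')"
      using match[OF fh(3), of h'] h' fh fg by auto
    then show "Cmp C h h' \<in> G f g"
      using h' fh fg R'(3)[OF fh(3), of h'] by (auto simp: G_def cmp_assoc)
  qed (auto simp: G_def)
  have pull_G: "pull_sieve C h (G f g) = G (Cmp C f h) (Cmp C g h)"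
    if "(f, g) \<in> spans c d" "h \<in> Arr C" "Cod C h = Dom C f" for f g h
    using that by (auto simp: G_def cmp_assoc)
  have "W \<in> \<Omega> c d"
  proof (rule \<Omega>I)
    fix f g h assume fg: "(f, g) \<in> W" and h: "h \<in> Arr C" "Cod C h = Dom C f"
    then have sp: "(f, g) \<in> spans c d" and cov: "G f g \<in> k (Dom C f)" by (auto simp: W_def)
    have "G (Cmp C f h) (Cmp C g h) \<in> k (Dom C h)"
      using cover_pull[OF h cov] pull_G[OF sp h] by simp
    then show "(Cmp C f h, Cmp C g h) \<in> W" using sp h by (auto simp: W_def)
  next
    fix f g assume sp: "(f, g) \<in> spans c d" and cov: "span_sieve W f g \<in> k (Dom C f)"
    have "G f g \<in> k (Dom C f)"
    proof (rule cover_trans[OF _ cov G_sieve[OF sp]])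
      fix h assume "h \<in> span_sieve W f g"
      then show "pull_sieve C h (G f g) \<in> k (Dom C h)"
        using sp pull_G[OF sp] by (auto simp: span_sieve_def W_def)
    qed (use sp in simp)
    then show "(f, g) \<in> W" using sp by (simp add: W_def)
  qed (simp add: W_def)
  moreover have "\<Omega>_restr c r W = V r" if r: "r \<in> R" for r
  proof -
    note r' = R'(1,2)[OF r]
    have "(f, g) \<in> \<Omega>_restr c r W \<longleftrightarrow> (f, g) \<in> V r" if fg: "(f, g) \<in> spans c (Dom C r)" for f g
    proof -
      have sp: "f \<in> Arr C" "g \<in> Arr C" "Dom C f = Dom C g" "Cod C f = Dom C r" "Cod C g = c" using fg by auto
      have "h \<in> G (Cmp C r f) g \<longleftrightarrow> h \<in> span_sieve (V r) f g" for h
      proof (cases "h \<in> Arr C \<and> Cod C h = Dom C f")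
        case True
        then have "Cmp C (Cmp C r f) h = Cmp C r (Cmp C f h)" "Cmp C r (Cmp C f h) \<in> R"
          "V (Cmp C r (Cmp C f h)) = \<Omega>_restr c (Cmp C f h) (V r)"
          using sp r' R'(3)[OF r] match[OF r] by (simp_all add: cmp_assoc)
        then show ?thesis using True sp r' by (simp add: G_def span_sieve_def)
      qed (use sp r' in \<open>auto simp: G_def span_sieve_def\<close>)
      then have eq: "G (Cmp C r f) g = span_sieve (V r) f g" by blast
      have "span_sieve (V r) f g = maximal_sieve C (Dom C f)" if "(f, g) \<in> V r"
        using \<Omega>D(2)[OF V[OF r] that] by (auto simp: span_sieve_def)
      then have "span_sieve (V r) f g \<in> k (Dom C f) \<longleftrightarrow> (f, g) \<in> V r"
        using \<Omega>D(3)[OF V[OF r] fg] cover_maximal[of "Dom C f"] sp by auto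
      then show ?thesis using eq sp r' by (simp add: W_def)
    qed
    then show ?thesis using \<Omega>D(1)[OF V[OF r]] by (auto simp: \<Omega>_restr_def)
  qed
  ultimately show ?thesis by blast
qed

text \<open>The sheaf is \<open>\<Omega>\<close>; a section \<open>z\<close> goes to the spans \<open>(f, g)\<close> with \<open>z f = x g\<close> \<open>k\<close>-locally.\<close>

lemma sheaf_separating:
  assumes X: "psh X" and c: "c \<in> Obj C" and x: "x \<in> sects X c"
  obtains W t where "psh W" "\<And>d R. d \<in> Obj C \<Longrightarrow> R \<in> k d \<Longrightarrow> sheaf_at W d R" "t \<in> hom S X W"
    "\<And>y. y \<in> sects X c \<Longrightarrow> app t c x = app t c y \<Longrightarrow> equalizer_sieve X c x y \<in> k c"
proof -
  obtain W \<phi> where W: "psh W" and \<phi>: "\<And>d. d \<in> Obj C \<Longrightarrow> bij_betw (\<phi> d) (\<Omega> c d) (sects W d)"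
    and r: "\<And>u V. u \<in> Arr C \<Longrightarrow> V \<in> \<Omega> c (Cod C u) \<Longrightarrow> restr W u (\<phi> (Cod C u) V) = \<phi> (Dom C u) (\<Omega>_restr c u V)"
  proof (rule small_presheaf[of "\<Omega> c" "\<Omega>_restr c"])
    show "small_in U (\<Omega> c d)" for d
      by (rule small_inj[OF small_Pow_Arr_Arr, where g = "\<lambda>V. V"]) (auto simp: \<Omega>_def spans_def)
    show "\<Omega>_restr c (Idn C d) V = V" if "d \<in> Obj C" "V \<in> \<Omega> c d" for d V
    proof (rule set_eqI, clarify)
      fix f g show "(f, g) \<in> \<Omega>_restr c (Idn C d) V \<longleftrightarrow> (f, g) \<in> V"
        using that \<Omega>D(1)[OF that(2), of f g] by auto
    qed
    show "\<Omega>_restr c (Cmp C v u) V = \<Omega>_restr c u (\<Omega>_restr c v V)"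
      if "u \<in> Arr C" "v \<in> Arr C" "Dom C v = Cod C u" "V \<in> \<Omega> c (Cod C v)" for u v V
    proof (rule set_eqI, clarify)
      fix f g show "(f, g) \<in> \<Omega>_restr c (Cmp C v u) V \<longleftrightarrow> (f, g) \<in> \<Omega>_restr c u (\<Omega>_restr c v V)"
        using that(1-3) by (auto simp: cmp_assoc)
    qed
    show "\<Omega>_restr c u V \<in> \<Omega> c (Dom C u)" if "u \<in> Arr C" "V \<in> \<Omega> c (Cod C u)" for u V
      using \<Omega>_restr_in that by blast
  qed blast
  have \<phi>_in: "\<phi> d V \<in> sects W d" if "d \<in> Obj C" "V \<in> \<Omega> c d" for d V using bij_betwE[OF \<phi>[OF that(1)]] that(2) by blast
  have \<phi>_inj: "V = V'" if "d \<in> Obj C" "V \<in> \<Omega> c d" "V' \<in> \<Omega> c d" "\<phi> d V = \<phi> d V'" for d V V'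
    using inj_onD[OF bij_betw_imp_inj_on[OF \<phi>[OF that(1)]] that(4)] that by blast
  have \<phi>_surj: "\<exists>V\<in>\<Omega> c d. \<phi> d V = w" if "d \<in> Obj C" "w \<in> sects W d" for d w
  proof -
    have "w \<in> \<phi> d ` \<Omega> c d" using bij_betw_imp_surj_on[OF \<phi>[OF that(1)]] that(2) by simp
    then show ?thesis by (elim imageE) (rule bexI, rule sym)
  qed
  have sheaf: "sheaf_at W d R" if d: "d \<in> Obj C" and R: "R \<in> k d" for d R
  proof (rule sheaf_atI)
    note R' = is_sieveD[OF cover_sieve[OF d R]]
    show "separated_at W d R"
      unfolding separated_at_def
    proof (intro ballI impI)
      fix v v' assume v: "v \<in> sects W d" "v' \<in> sects W d" and eq: "\<forall>f\<in>R. restr W f v = restr W f v'"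
      obtain V where V: "V \<in> \<Omega> c d" "v = \<phi> d V" using \<phi>_surj[OF d v(1)] by blast
      obtain V' where V': "V' \<in> \<Omega> c d" "v' = \<phi> d V'" using \<phi>_surj[OF d v(2)] by blast
      have eq': "\<Omega>_restr c f V = \<Omega>_restr c f V'" if f: "f \<in> R" for f
        by (rule \<phi>_inj[of "Dom C f"])
          (use bspec[OF eq f] r[of f] R'(1,2)[OF f] V V' \<Omega>_restr_in in simp_all)
      have "V = V'"
        using \<Omega>_separated[OF V(1) V'(1) d R] \<Omega>_separated[OF V'(1) V(1) d R] eq' by blast
      then show "v = v'" using V V' by simp
    qed
    fix \<beta> assume \<beta>: "matching_family C W R \<beta>"
    have "\<forall>f\<in>R. \<exists>V\<in>\<Omega> c (Dom C f). \<phi> (Dom C f) V = \<beta> f"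
    proof
      fix f assume f: "f \<in> R"
      then have "\<beta> f \<in> sects W (Dom C f)" using \<beta> unfolding matching_family_def by simp
      then show "\<exists>V\<in>\<Omega> c (Dom C f). \<phi> (Dom C f) V = \<beta> f" using \<phi>_surj R'(1)[OF f] by simp
    qed
    then obtain V where V: "\<And>f. f \<in> R \<Longrightarrow> V f \<in> \<Omega> c (Dom C f)" "\<And>f. f \<in> R \<Longrightarrow> \<phi> (Dom C f) (V f) = \<beta> f" by metis
    have "V (Cmp C f h) = \<Omega>_restr c h (V f)" if f: "f \<in> R" and h: "h \<in> Arr C" "Cod C h = Dom C f" for f h
    proof (rule \<phi>_inj[of "Dom C h"])
      note f' = R'(1,2)[OF f]
      have fh: "Cmp C f h \<in> R" using R'(3)[OF f h] .
      show "V (Cmp C f h) \<in> \<Omega> c (Dom C h)" using V(1)[OF fh] f' h by simp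
      show "\<Omega>_restr c h (V f) \<in> \<Omega> c (Dom C h)" using \<Omega>_restr_in[OF _ h(1)] V(1)[OF f] h by simp
      show "\<phi> (Dom C h) (V (Cmp C f h)) = \<phi> (Dom C h) (\<Omega>_restr c h (V f))"
        using r[OF h(1), of "V f"] V[OF f] V(2)[OF fh] f' h f \<beta> unfolding matching_family_def by simp
    qed (use h in simp)
    then obtain Z where Z: "Z \<in> \<Omega> c d" "\<forall>f\<in>R. \<Omega>_restr c f Z = V f" using \<Omega>_glue[OF d R V(1)] by blast
    have "restr W f (\<phi> d Z) = \<beta> f" if f: "f \<in> R" for f
      using r[of f Z] R'(1,2)[OF f] Z V(2)[OF f] f by simp
    then show "\<exists>y\<in>sects W d. \<forall>f\<in>R. restr W f y = \<beta> f" using \<phi>_in[OF d Z(1)] by blast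
  qed
  define \<tau> where "\<tau> d z = {(f, g) \<in> spans c d. equalizer_sieve X (Dom C f) (restr X f z) (restr X g x) \<in> k (Dom C f)}" for d z
  have eq_sieve: "is_sieve C (Dom C f) (equalizer_sieve X (Dom C f) (restr X f z) (restr X g x))"
    if "(f, g) \<in> spans c d" "z \<in> sects X d" for f g d z
    by (rule equalizer_sieve[OF X]) (use that X x in auto)
  have pull_eq: "pull_sieve C h (equalizer_sieve X (Dom C f) (restr X f z) (restr X g x)) =
      equalizer_sieve X (Dom C h) (restr X (Cmp C f h) z) (restr X (Cmp C g h) x)"
    if "(f, g) \<in> spans c d" "z \<in> sects X d" "h \<in> Arr C" "Cod C h = Dom C f" for f g d z h
    using that X x by (subst pull_equalizer_sieve[OF X]) (auto simp: restr_cmp)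
  have \<tau>: "\<tau> d z \<in> \<Omega> c d" if d: "d \<in> Obj C" and z: "z \<in> sects X d" for d z
  proof (rule \<Omega>I)
    fix f g h assume fg: "(f, g) \<in> \<tau> d z" and h: "h \<in> Arr C" "Cod C h = Dom C f"
    then have sp: "(f, g) \<in> spans c d" by (simp add: \<tau>_def)
    have "equalizer_sieve X (Dom C f) (restr X f z) (restr X g x) \<in> k (Dom C f)" using fg by (auto simp: \<tau>_def)
    from cover_pull[OF h this]
    have "equalizer_sieve X (Dom C h) (restr X (Cmp C f h) z) (restr X (Cmp C g h) x) \<in> k (Dom C h)"
      unfolding pull_eq[OF sp z h] .
    then show "(Cmp C f h, Cmp C g h) \<in> \<tau> d z" using sp h by (simp add: \<tau>_def)
  next
    fix f g assume sp: "(f, g) \<in> spans c d" and cov: "span_sieve (\<tau> d z) f g \<in> k (Dom C f)"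
    have "equalizer_sieve X (Dom C f) (restr X f z) (restr X g x) \<in> k (Dom C f)"
    proof (rule cover_trans[OF _ cov eq_sieve[OF sp z]])
      fix h assume "h \<in> span_sieve (\<tau> d z) f g"
      then have h: "h \<in> Arr C" "Cod C h = Dom C f" "(Cmp C f h, Cmp C g h) \<in> \<tau> d z"
        by (simp_all add: span_sieve_def)
      then show "pull_sieve C h (equalizer_sieve X (Dom C f) (restr X f z) (restr X g x)) \<in> k (Dom C h)"
        unfolding pull_eq[OF sp z h(1,2)] using sp by (simp add: \<tau>_def)
    qed (use sp in simp)
    then show "(f, g) \<in> \<tau> d z" using sp by (simp add: \<tau>_def)
  qed (simp add: \<tau>_def)
  have \<tau>_restr: "\<tau> (Dom C u) (restr X u z) = \<Omega>_restr c u (\<tau> (Cod C u) z)"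
    if "u \<in> Arr C" "z \<in> sects X (Cod C u)" for u z
    using that X by (auto simp: \<tau>_def \<Omega>_restr_def restr_cmp)
  have t: "transf_of X W (\<lambda>d z. \<phi> d (\<tau> d z)) \<in> hom S X W"
    by (rule transf_of_hom[OF X W]) (use \<phi>_in \<tau> \<tau>_restr r in simp_all)
  have sep: "equalizer_sieve X c x y \<in> k c"
    if y: "y \<in> sects X c" and eq: "app (transf_of X W (\<lambda>d z. \<phi> d (\<tau> d z))) c x = app (transf_of X W (\<lambda>d z. \<phi> d (\<tau> d z))) c y" for y
  proof -
    have "\<tau> c x = \<tau> c y" using \<phi>_inj[OF c \<tau>[OF c x] \<tau>[OF c y]] eq c x y by simp
    moreover have "equalizer_sieve X c x x = maximal_sieve C c" by (auto simp: equalizer_sieve_def)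
    \<comment> \<open>The span of two identities is the generic place to compare: it belongs to
      \<open>\<tau> c z\<close> exactly when \<open>z\<close> and \<open>x\<close> are locally
      equal.\<close>
    then have "(Idn C c, Idn C c) \<in> \<tau> c x" using c x X cover_maximal[OF c] by (simp add: \<tau>_def)
    ultimately have "(Idn C c, Idn C c) \<in> \<tau> c y" by simp
    then have "equalizer_sieve X c y x \<in> k c" using c x y X by (simp add: \<tau>_def)
    moreover have "equalizer_sieve X c y x = equalizer_sieve X c x y" by (auto simp: equalizer_sieve_def)
    ultimately show ?thesis by simp
  qed
  show ?thesis using that[OF W sheaf t sep] .
qed

end

end

section \<open>The unit of the reflection onto separated sheaves, and local arguments with
  it\<close>

locale quasitopos_presheaves = reflective_presheaves C U E L \<eta>
  for C :: "('o, 'a) cat" and U :: "'u set set" and E L \<eta> +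
  fixes j k
  assumes j: "grothendieck_topology C j" and k: "grothendieck_topology C k"
    and le: "topology_le C j k" and E_eq: "E = Sep C U k \<inter> Sh C U j"
begin

lemma E_iff:
  "X \<in> E \<longleftrightarrow> psh X \<and> (\<forall>c\<in>Obj C. \<forall>R\<in>k c. separated_at X c R) \<and> (\<forall>c\<in>Obj C. \<forall>R\<in>j c. sheaf_at X c R)"
  unfolding E_eq by (auto simp: Sep_iff[OF k] Sh_iff)

lemma LO_separated: "psh X \<Longrightarrow> c \<in> Obj C \<Longrightarrow> R \<in> k c \<Longrightarrow> separated_at (LO X) c R"
  using LO_E[of X] by (simp add: E_iff)

lemma LO_sheaf: "psh X \<Longrightarrow> c \<in> Obj C \<Longrightarrow> R \<in> j c \<Longrightarrow> sheaf_at (LO X) c R"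
  using LO_E[of X] by (simp add: E_iff)

lemma LO_separated_j: "psh X \<Longrightarrow> c \<in> Obj C \<Longrightarrow> R \<in> j c \<Longrightarrow> separated_at (LO X) c R"
  using LO_separated le unfolding topology_le_def by blast

text \<open>The \<open>j\<close>-closure of the image of the unit belongs to \<open>E\<close>, so it is all of \<open>L X\<close>.\<close>

lemma eta_dense:
  assumes X: "psh X" and c: "c \<in> Obj C" and a: "a \<in> sects (LO X) c"
  shows "image_sieve (\<eta> X) c a \<in> j c"
proof -
  note etaX = eta[OF X]
  note LX = LO_psh[OF X]
  define F where "F d = {a \<in> sects (LO X) d. image_sieve (\<eta> X) d a \<in> j d}" for d
  obtain A i where i: "i \<in> hom S A (LO X)" and A: "\<And>d. d \<in> Obj C \<Longrightarrow> sects A d = F d"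
    and i_app: "\<And>d a. d \<in> Obj C \<Longrightarrow> a \<in> F d \<Longrightarrow> app i d a = a"
    and A_restr: "\<And>f a. f \<in> Arr C \<Longrightarrow> a \<in> F (Cod C f) \<Longrightarrow> restr A f a = restr (LO X) f a"
  proof (rule subpresheaf[OF LX, of F])
    show "restr (LO X) f a \<in> F (Dom C f)" if "f \<in> Arr C" "a \<in> F (Cod C f)" for f a
      using that LX cover_pull[OF j that(1) refl, of "image_sieve (\<eta> X) (Cod C f) a"]
        pull_image_sieve[OF etaX, of a "Cod C f" f] by (auto simp: F_def)
  qed (auto simp: F_def)
  note Apsh = homD(1)[OF i]
  have A_sep: "separated_at A d R" if d: "d \<in> Obj C" and R: "R \<in> k d" for d R
    unfolding separated_at_def
  proof (intro ballI impI)
    fix a b assume ab: "a \<in> sects A d" "b \<in> sects A d" and eq: "\<forall>f\<in>R. restr A f a = restr A f b"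
    note R' = is_sieveD[OF cover_sieve[OF k d R]]
    show "a = b"
    proof (rule separated_atD[OF LO_separated[OF X d R]])
      show "restr (LO X) f a = restr (LO X) f b" if "f \<in> R" for f
        using bspec[OF eq that] ab A_restr[of f] R'(1,2)[OF that] A[OF d] by simp
    qed (use ab A[OF d] in \<open>auto simp: F_def\<close>)
  qed
  have A_sh: "sheaf_at A d R" if d: "d \<in> Obj C" and R: "R \<in> j d" for d R
  proof (rule sheaf_atI)
    show "separated_at A d R" using A_sep d R le unfolding topology_le_def by blast
    fix \<beta> assume \<beta>: "matching_family C A R \<beta>"
    note R' = is_sieveD[OF cover_sieve[OF j d R]]
    have \<beta>F: "\<beta> f \<in> F (Dom C f)" if "f \<in> R" for f
      using \<beta> A[of "Dom C f"] R'(1)[OF that] that unfolding matching_family_def by auto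
    have "matching_family C (LO X) R \<beta>"
      unfolding matching_family_def
    proof (intro conjI ballI impI)
      show "\<beta> f \<in> sects (LO X) (Dom C f)" if "f \<in> R" for f using \<beta>F[OF that] by (simp add: F_def)
      show "\<beta> (Cmp C f g) = restr (LO X) g (\<beta> f)" if "f \<in> R" "g \<in> Arr C" "Cod C g = Dom C f" for f g
        using \<beta> that \<beta>F[OF that(1)] A_restr[of g "\<beta> f"] unfolding matching_family_def by simp
    qed
    then obtain y where y: "y \<in> sects (LO X) d" "\<And>f. f \<in> R \<Longrightarrow> restr (LO X) f y = \<beta> f"
      using sheaf_atE[OF LO_sheaf[OF X d R]] by blast
    have "image_sieve (\<eta> X) d y \<in> j d"
    proof (rule cover_trans[OF j d R image_sieve[OF etaX y(1)]])
      fix f assume f: "f \<in> R"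
      show "pull_sieve C f (image_sieve (\<eta> X) d y) \<in> j (Dom C f)"
        using \<beta>F[OF f] y(2)[OF f] pull_image_sieve[OF etaX y(1) R'(1,2)[OF f]] by (simp add: F_def)
    qed
    then have "y \<in> F d" using y by (simp add: F_def)
    then show "\<exists>y\<in>sects A d. \<forall>f\<in>R. restr A f y = \<beta> f"
      using A[OF d] A_restr y R' by (intro bexI[of _ y]) auto
  qed
  have AE: "A \<in> E" using E_iff Apsh A_sep A_sh by blast
  have eta_F: "app (\<eta> X) d x \<in> F d" if d: "d \<in> Obj C" and x: "x \<in> sects X d" for d x
  proof -
    have "image_sieve (\<eta> X) d (app (\<eta> X) d x) = maximal_sieve C d"
      using app_nat[OF etaX, of _ x] X x by (force simp: image_sieve_iff[OF etaX])
    then show ?thesis using cover_maximal[OF j d] app_in[OF etaX d x] by (simp add: F_def)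
  qed
  have e: "transf_of X A (app (\<eta> X)) \<in> hom S X A"
    by (rule transf_of_hom[OF X Apsh]) (use eta_F A A_restr app_nat[OF etaX] in simp_all)
  obtain r where r: "r \<in> hom S (LO X) A"
    and r_eta: "\<And>d x. d \<in> Obj C \<Longrightarrow> x \<in> sects X d \<Longrightarrow> app r d (app (\<eta> X) d x) = app (transf_of X A (app (\<eta> X))) d x"
    using extend[OF e AE] by blast
  \<comment> \<open>The composite fixes the image of the unit, so it is the identity, and every
    section of \<open>LO X\<close> comes from \<open>A\<close>.\<close>
  have "i \<odot> r = Idn S (LO X)"
    by (rule extend_unique[OF LO_E[OF X] X comp_hom[OF r i] idn_hom[OF LX]])
      (simp add: homD[OF r] app_in[OF etaX] r_eta i_app eta_F)
  then have "app i c (app r c a) = a" using comp_appD[OF _ r c a, of i] a c by simp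
  moreover have rF: "app r c a \<in> F c" using app_in[OF r c a] A[OF c] by simp
  ultimately have "a \<in> F c" using i_app[OF c rF] by simp
  then show ?thesis by (simp add: F_def)
qed

text \<open>A \<open>k\<close>-sheaf belongs to \<open>E\<close> since
  \<open>j \<subseteq> k\<close>. Hence the map into the separating sheaf factors through the unit,
  and sections identified by the unit are identified by that map. Conversely \<open>LO X\<close> is
  \<open>k\<close>-separated, so \<open>k\<close>-local equality is enough for equality after the
  unit.\<close>

lemma eta_kernel:
  assumes X: "psh X" and c: "c \<in> Obj C" and x: "x \<in> sects X c" and y: "y \<in> sects X c"
  shows "app (\<eta> X) c x = app (\<eta> X) c y \<longleftrightarrow> equalizer_sieve X c x y \<in> k c"
proof
  assume eq: "app (\<eta> X) c x = app (\<eta> X) c y"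
  obtain W t where W: "psh W" "\<And>d R. d \<in> Obj C \<Longrightarrow> R \<in> k d \<Longrightarrow> sheaf_at W d R" and t: "t \<in> hom S X W"
    and sep: "\<And>y. y \<in> sects X c \<Longrightarrow> app t c x = app t c y \<Longrightarrow> equalizer_sieve X c x y \<in> k c"
    by (rule sheaf_separating[OF k X c x]) blast
  have "separated_at W d R" if "d \<in> Obj C" "R \<in> k d" for d R
    using sheaf_at_separated[OF W(1) cover_sieve[OF k that] W(2)[OF that]] .
  then have WE: "W \<in> E" using W le unfolding E_iff topology_le_def by blast
  obtain u where "u \<in> hom S (LO X) W" and u: "\<And>d x. d \<in> Obj C \<Longrightarrow> x \<in> sects X d \<Longrightarrow> app u d (app (\<eta> X) d x) = app t d x"
    using extend[OF t WE] by blast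
  have "app t c x = app t c y" using u[OF c x] u[OF c y] eq by simp
  then show "equalizer_sieve X c x y \<in> k c" using sep[OF y] by blast
next
  assume cov: "equalizer_sieve X c x y \<in> k c"
  show "app (\<eta> X) c x = app (\<eta> X) c y"
  proof (rule separated_atD[OF LO_separated[OF X c cov]])
    fix f assume "f \<in> equalizer_sieve X c x y"
    then show "restr (LO X) f (app (\<eta> X) c x) = restr (LO X) f (app (\<eta> X) c y)"
      using x y app_nat[OF eta[OF X], of f x] app_nat[OF eta[OF X], of f y] by (simp add: equalizer_sieve_def)
  qed (use app_in[OF eta[OF X] c] x y in auto)
qed

text \<open>Both sections lift through the unit on a common \<open>j\<close>-cover, and lifts that
  are \<open>k\<close>-locally equal have the same image. As \<open>j \<subseteq> k\<close>, the
  separated presheaf \<open>LO X\<close> allows equality to be tested on that cover.\<close>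

lemma eta_locally_eqI:
  assumes X: "psh X" and c: "c \<in> Obj C" and z: "z \<in> sects (LO X) c" and z': "z' \<in> sects (LO X) c"
    and eq: "\<And>f x x'. f \<in> Arr C \<Longrightarrow> Cod C f = c \<Longrightarrow> x \<in> sects X (Dom C f) \<Longrightarrow> x' \<in> sects X (Dom C f)
      \<Longrightarrow> app (\<eta> X) (Dom C f) x = restr (LO X) f z \<Longrightarrow> app (\<eta> X) (Dom C f) x' = restr (LO X) f z'
      \<Longrightarrow> equalizer_sieve X (Dom C f) x x' \<in> k (Dom C f)"
  shows "z = z'"
proof (rule separated_atD[OF LO_separated_j[OF X c cover_Int[OF j c eta_dense[OF X c z] eta_dense[OF X c z']]] z z'])
  fix f assume "f \<in> image_sieve (\<eta> X) c z \<inter> image_sieve (\<eta> X) c z'"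
  then obtain x x' where f: "f \<in> Arr C" "Cod C f = c" and x: "x \<in> sects X (Dom C f)" "x' \<in> sects X (Dom C f)"
    "app (\<eta> X) (Dom C f) x = restr (LO X) f z" "app (\<eta> X) (Dom C f) x' = restr (LO X) f z'"
    by (auto simp: image_sieve_iff[OF eta[OF X]])
  then have "app (\<eta> X) (Dom C f) x = app (\<eta> X) (Dom C f) x'"
    using eq[OF f x] eta_kernel[OF X _ x(1,2)] by simp
  then show "restr (LO X) f z = restr (LO X) f z'" using x by simp
qed

text \<open>Supplies the input of \<open>eta_locally_eqI\<close>: by naturality of the unit, an
  equation between values of \<open>LA t\<close> becomes a local equation between values of
  \<open>t\<close> at lifts.\<close>

lemma L_locally_eq:
  assumes t: "t \<in> hom S X Y" and f: "f \<in> Arr C" "Cod C f = c"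
    and z: "z \<in> sects (LO X) c" "z' \<in> sects (LO X) c" "app (LA t) c z = app (LA t) c z'"
    and x: "x \<in> sects X (Dom C f)" "x' \<in> sects X (Dom C f)"
    and xz: "app (\<eta> X) (Dom C f) x = restr (LO X) f z" "app (\<eta> X) (Dom C f) x' = restr (LO X) f z'"
  shows "equalizer_sieve Y (Dom C f) (app t (Dom C f) x) (app t (Dom C f) x') \<in> k (Dom C f)"
proof -
  have d: "Dom C f \<in> Obj C" using f by simp
  have "app (\<eta> Y) (Dom C f) (app t (Dom C f) x) = app (\<eta> Y) (Dom C f) (app t (Dom C f) x')"
    using L_eta[OF t d x(1)] L_eta[OF t d x(2)] xz app_nat[OF L_hom[OF t] f(1)] f z by simp
  then show ?thesis using eta_kernel[OF homD(2)[OF t] d app_in[OF t d x(1)] app_in[OF t d x(2)]] by blast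
qed

lemma quasitopos_preserves_monos: "preserves_monos S T L"
  unfolding preserves_monos_def
proof (intro allI impI)
  fix m assume mono: "monic S m"
  then have "m \<in> Arr S" by (simp add: monic_def)
  then obtain X Y where m: "m \<in> hom S X Y" using Arr_hom by blast
  have X: "psh X" and Y: "psh Y" using homD[OF m] by auto
  have inj: "inj_on (app m c) (sects X c)" if "c \<in> Obj C" for c using monic_iff[OF m] mono that by blast
  have "inj_on (app (LA m) c) (sects (LO X) c)" if c: "c \<in> Obj C" for c
  proof (rule inj_onI)
    fix z z' assume z: "z \<in> sects (LO X) c" "z' \<in> sects (LO X) c" and eq: "app (LA m) c z = app (LA m) c z'"
    show "z = z'"
    proof (rule eta_locally_eqI[OF X c z])
      fix f x x' assume f: "f \<in> Arr C" "Cod C f = c" and x: "x \<in> sects X (Dom C f)" "x' \<in> sects X (Dom C f)"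
        and xz: "app (\<eta> X) (Dom C f) x = restr (LO X) f z" "app (\<eta> X) (Dom C f) x' = restr (LO X) f z'"
      let ?d = "Dom C f"
      have "equalizer_sieve Y ?d (app m ?d x) (app m ?d x') \<in> k ?d" using L_locally_eq[OF m f z eq x xz] .
      \<comment> \<open>An injective map neither creates nor destroys places where two sections
        agree.\<close>
      moreover have "equalizer_sieve Y ?d (app m ?d x) (app m ?d x') = equalizer_sieve X ?d x x'"
      proof -
        have "restr Y g (app m ?d x) = restr Y g (app m ?d x') \<longleftrightarrow> restr X g x = restr X g x'"
          if g: "g \<in> Arr C" "Cod C g = ?d" for g
          using app_nat[OF m g(1)] inj_on_eq_iff[OF inj[of "Dom C g"]] g x X
          by (metis dom_cod(1) restr_in)
        then show ?thesis by (auto simp: equalizer_sieve_def)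
      qed
      ultimately show "equalizer_sieve X ?d x x' \<in> k ?d" by simp
    qed
  qed
  then show "monic T (LA m)" using monic_T_iff[OF L_hom[OF m]] LO_E X Y by blast
qed

text \<open>For uniqueness, lifts to \<open>P\<close> whose projections agree on
  \<open>k\<close>-covers agree on the intersection of these covers. For existence, the two sections
  lift jointly on a \<open>j\<close>-cover and give local sections of \<open>LO P\<close>. These
  match by the uniqueness part, which is why it comes first, and glue because \<open>LO P\<close> is
  a \<open>j\<close>-sheaf.\<close>

lemma quasitopos_stable_units: "has_stable_units S E L"
  unfolding has_stable_units_def preserves_pullback_of_def
proof (intro ballI allI impI)
  fix B f g p q
  assume B: "B \<in> E" and "f \<in> Arr S" "g \<in> Arr S" "Cod S f = B" "Cod S g = B" and pb: "is_pullback S f g p q"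
  then obtain X Y P where f: "f \<in> hom S X B" and g: "g \<in> hom S Y B" and p: "p \<in> hom S P X" and q: "q \<in> hom S P Y"
    unfolding is_pullback_def hom_def by auto
  have X: "psh X" and Y: "psh Y" and P: "psh P" using homD[OF f] homD[OF g] homD[OF p] by auto
  note pbD = pullbackD[OF pb f g p q]
  have fp: "f \<odot> p = g \<odot> q" using pb unfolding is_pullback_def by blast
  have uniq: "w = w'" if c: "c \<in> Obj C" and w: "w \<in> sects (LO P) c" "w' \<in> sects (LO P) c"
    and eq: "app (LA p) c w = app (LA p) c w'" "app (LA q) c w = app (LA q) c w'" for c w w'
  proof (rule eta_locally_eqI[OF P c w])
    fix h v v' assume h: "h \<in> Arr C" "Cod C h = c" and v: "v \<in> sects P (Dom C h)" "v' \<in> sects P (Dom C h)"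
      and vw: "app (\<eta> P) (Dom C h) v = restr (LO P) h w" "app (\<eta> P) (Dom C h) v' = restr (LO P) h w'"
    let ?d = "Dom C h"
    have d: "?d \<in> Obj C" using h by simp
    note 1 = L_locally_eq[OF p h w eq(1) v vw] and 2 = L_locally_eq[OF q h w eq(2) v vw]
    show "equalizer_sieve P ?d v v' \<in> k ?d"
    proof (rule cover_superset[OF k d cover_Int[OF k d 1 2] equalizer_sieve[OF P v]], rule subsetI)
      fix l assume "l \<in> equalizer_sieve X ?d (app p ?d v) (app p ?d v') \<inter> equalizer_sieve Y ?d (app q ?d v) (app q ?d v')"
      then have l: "l \<in> Arr C" "Cod C l = ?d" and eqs: "restr X l (app p ?d v) = restr X l (app p ?d v')"
        "restr Y l (app q ?d v) = restr Y l (app q ?d v')" by (auto simp: equalizer_sieve_def)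
      have "restr P l v = restr P l v'"
        by (rule pbD(3)[of "Dom C l"]) (use l eqs v P app_nat[OF p l(1)] app_nat[OF q l(1)] in simp_all)
      then show "l \<in> equalizer_sieve P ?d v v'" using l by (simp add: equalizer_sieve_def)
    qed
  qed
  have "is_pullback S (LA f) (LA g) (LA p) (LA q)"
  proof (rule pullbackI[OF L_hom[OF f] L_hom[OF g] L_hom[OF p] L_hom[OF q] _ _ uniq])
    fix c w assume "c \<in> Obj C" "w \<in> sects (LO P) c"
    then show "app (LA f) c (app (LA p) c w) = app (LA g) c (app (LA q) c w)"
      by (rule comp_app_eqD[OF _ L_hom[OF p] L_hom[OF q], rotated]) (metis fp L_comp[OF p f] L_comp[OF q g])
  next
    fix c x y assume c: "c \<in> Obj C" and x: "x \<in> sects (LO X) c" and y: "y \<in> sects (LO Y) c"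
      and eq: "app (LA f) c x = app (LA g) c y"
    let ?R = "image_sieve (\<eta> X) c x \<inter> image_sieve (\<eta> Y) c y"
    have R: "?R \<in> j c" by (rule cover_Int[OF j c eta_dense[OF X c x] eta_dense[OF Y c y]])
    note R' = is_sieveD[OF cover_sieve[OF j c R]]
    have "\<exists>w\<in>sects (LO P) (Dom C h). app (LA p) (Dom C h) w = restr (LO X) h x \<and> app (LA q) (Dom C h) w = restr (LO Y) h y"
      if hR: "h \<in> ?R" for h
    proof -
      let ?d = "Dom C h"
      obtain a b where h: "h \<in> Arr C" "Cod C h = c" and a: "a \<in> sects X ?d" "app (\<eta> X) ?d a = restr (LO X) h x"
        and b: "b \<in> sects Y ?d" "app (\<eta> Y) ?d b = restr (LO Y) h y"
        using hR by (auto simp: image_sieve_iff[OF eta[OF X]] image_sieve_iff[OF eta[OF Y]])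
      have d: "?d \<in> Obj C" using h by simp
      have "app (\<eta> B) ?d (app f ?d a) = app (\<eta> B) ?d (app g ?d b)"
        using L_eta[OF f d a(1)] L_eta[OF g d b(1)] a b eq h x y app_nat[OF L_hom[OF f] h(1)] app_nat[OF L_hom[OF g] h(1)]
        by simp
      \<comment> \<open>Membership of \<open>B\<close> in \<open>E\<close> makes its unit injective,
        so the two lifts agree in \<open>B\<close> outright and not merely locally. Hence they form
        a section of \<open>P\<close> over the same object.\<close>
      then have "app f ?d a = app g ?d b" using eta_inj[OF B d] app_in[OF f d a(1)] app_in[OF g d b(1)] by blast
      then obtain v where v: "v \<in> sects P ?d" "app p ?d v = a" "app q ?d v = b" using pbD(2)[OF d a(1) b(1)] by blast
      then show ?thesis
        using L_eta[OF p d v(1)] L_eta[OF q d v(1)] a b app_in[OF eta[OF P] d v(1)] by metis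
    qed
    then obtain \<omega> where \<omega>: "\<And>h. h \<in> ?R \<Longrightarrow> \<omega> h \<in> sects (LO P) (Dom C h)"
      "\<And>h. h \<in> ?R \<Longrightarrow> app (LA p) (Dom C h) (\<omega> h) = restr (LO X) h x"
      "\<And>h. h \<in> ?R \<Longrightarrow> app (LA q) (Dom C h) (\<omega> h) = restr (LO Y) h y" by metis
    have "matching_family C (LO P) ?R \<omega>"
      unfolding matching_family_def
    proof (intro conjI ballI impI)
      fix h l assume h: "h \<in> ?R" and l: "l \<in> Arr C" "Cod C l = Dom C h"
      note h' = R'(1,2)[OF h]
      have hl: "Cmp C h l \<in> ?R" using R'(3)[OF h l] .
      have [simp]: "Dom C (Cmp C h l) = Dom C l" using h' l by simp
      have \<omega>h: "\<omega> h \<in> sects (LO P) (Cod C l)" using \<omega>(1)[OF h] l by simp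
      show "\<omega> (Cmp C h l) = restr (LO P) l (\<omega> h)"
      proof (rule uniq[of "Dom C l"])
        show "app (LA p) (Dom C l) (\<omega> (Cmp C h l)) = app (LA p) (Dom C l) (restr (LO P) l (\<omega> h))"
          using \<omega>(2)[OF hl] \<omega>(2)[OF h] app_nat[OF L_hom[OF p] l(1) \<omega>h] l h' x LO_psh[OF X] by (simp add: restr_cmp)
        show "app (LA q) (Dom C l) (\<omega> (Cmp C h l)) = app (LA q) (Dom C l) (restr (LO P) l (\<omega> h))"
          using \<omega>(3)[OF hl] \<omega>(3)[OF h] app_nat[OF L_hom[OF q] l(1) \<omega>h] l h' y LO_psh[OF Y] by (simp add: restr_cmp)
        show "\<omega> (Cmp C h l) \<in> sects (LO P) (Dom C l)" using \<omega>(1)[OF hl] by simp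
      qed (use l \<omega>h LO_psh[OF P] in simp_all)
    qed (use \<omega>(1) in blast)
    then obtain w where w: "w \<in> sects (LO P) c" "\<And>h. h \<in> ?R \<Longrightarrow> restr (LO P) h w = \<omega> h"
      using sheaf_atE[OF LO_sheaf[OF P c R]] by blast
    have "app (LA p) c w = x"
    proof (rule separated_atD[OF LO_separated_j[OF X c R] app_in[OF L_hom[OF p] c w(1)] x])
      fix h assume h: "h \<in> ?R"
      show "restr (LO X) h (app (LA p) c w) = restr (LO X) h x"
        using app_nat[OF L_hom[OF p] R'(1)[OF h], of w] R'(2)[OF h] w(1) w(2)[OF h] \<omega>(2)[OF h] by simp
    qed
    moreover have "app (LA q) c w = y"
    proof (rule separated_atD[OF LO_separated_j[OF Y c R] app_in[OF L_hom[OF q] c w(1)] y])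
      fix h assume h: "h \<in> ?R"
      show "restr (LO Y) h (app (LA q) c w) = restr (LO Y) h y"
        using app_nat[OF L_hom[OF q] R'(1)[OF h], of w] R'(2)[OF h] w(1) w(2)[OF h] \<omega>(3)[OF h] by simp
    qed
    ultimately show "\<exists>w\<in>sects (LO P) c. app (LA p) c w = x \<and> app (LA q) c w = y" using w(1) by blast
  qed
  then show "is_pullback T (LA f) (LA g) (LA p) (LA q)"
    using pullback_T_iff[OF L_hom[OF f] L_hom[OF g] L_hom[OF p] L_hom[OF q]] LO_E X Y P E_psh[OF B] by blast
qed

end

theorem theorem6p1:
  fixes C :: "('o, 'a) cat"
    and U :: "'u set set"
    and E :: "('o, 'a, 'u) presheaf set"
    and L :: "(('o, 'a, 'u) presheaf, ('o, 'a, 'u) transf,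
               ('o, 'a, 'u) presheaf, ('o, 'a, 'u) transf) fctr"
    and \<eta> :: "('o, 'a, 'u) presheaf \<Rightarrow> ('o, 'a, 'u) transf"
  assumes "is_category C"
    and "universe_for C U"
    and "replete (presheaf_cat C U) E"
    and "is_reflection (presheaf_cat C U) E L \<eta>"
  shows "((\<exists>j k. grothendieck_topology C j \<and> grothendieck_topology C k \<and>
             topology_le C j k \<and> E = Sep C U k \<inter> Sh C U j)
          \<longleftrightarrow>
          (semi_left_exact (presheaf_cat C U) E L \<eta> \<and>
           preserves_finite_products (presheaf_cat C U) (full_subcat (presheaf_cat C U) E) L \<and>
           preserves_monos (presheaf_cat C U) (full_subcat (presheaf_cat C U) E) L))
       \<and> ((semi_left_exact (presheaf_cat C U) E L \<eta> \<and>
           preserves_finite_products (presheaf_cat C U) (full_subcat (presheaf_cat C U) E) L \<and>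
           preserves_monos (presheaf_cat C U) (full_subcat (presheaf_cat C U) E) L)
          \<longleftrightarrow>
          (has_stable_units (presheaf_cat C U) E L \<and>
           preserves_monos (presheaf_cat C U) (full_subcat (presheaf_cat C U) E) L))"
proof -
  interpret reflective_presheaves C U E L \<eta>
    by (rule reflective_presheaves.intro[OF presheaves.intro[OF assms(1,2)] reflective_presheaves_axioms.intro[OF assms(3,4)]])
  have "has_stable_units S E L \<and> preserves_monos S T L"
    if jk: "grothendieck_topology C j" "grothendieck_topology C k" "topology_le C j k" "E = Sep C U k \<inter> Sh C U j" for j k
  proof -
    have "quasitopos_presheaves C U E L \<eta> j k"
      by (rule quasitopos_presheaves.intro[OF reflective_presheaves_axioms quasitopos_presheaves_axioms.intro[OF jk]])
    then show ?thesis
      using quasitopos_presheaves.quasitopos_stable_units quasitopos_presheaves.quasitopos_preserves_monos by blast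
  qed
  then have 1: "(\<exists>j k. grothendieck_topology C j \<and> grothendieck_topology C k \<and> topology_le C j k \<and>
      E = Sep C U k \<inter> Sh C U j) \<longrightarrow> has_stable_units S E L \<and> preserves_monos S T L"
    by (intro impI) (elim exE conjE)
  \<comment> \<open>With the first implication, these close the circle: the condition on stable
    units implies each of the other two and is implied by each.\<close>
  note 2 = stable_units_quasitopos stable_units_semi_left_exact stable_units_preserves_products semi_left_exact_stable_units
  show ?thesis
    using 1 2 by blast
qed

end
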